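(* Let $d\in\{2,3\}$ and let $\alpha,\beta,\gamma\in\mathbb R$ with $\alpha+\beta<0$ and $\alpha+\beta+\gamma\ge0$. Then there exists a map $D:\mathscr H^\alpha\times\mathscr C^\beta\times\mathscr H^\gamma\to\mathbb R$ and a constant such that for all $f\in\mathscr H^\alpha$, $g\in\mathscr C^\beta$, $h\in\mathscr H^\gamma$ $$|D(f,g,h)|\lesssim\|g\|_{\mathscr C^\beta}\|f\|_{\mathscr H^\alpha}\|h\|_{\mathscr H^\gamma},$$ and such that for smooth $f,g,h$ $$D(f,g,h)=\langle f,h\circ g\rangle-\langle f\prec g,h\rangle .$$
   Context: All functions and distributions are real valued on $\mathbb T^d=\mathbb R^d/\mathbb Z^d$; $\langle\cdot,\cdot\rangle$ is the $L^2(\mathbb T^d)$ inner product; $\mathscr H^s$ is the $L^2$-based Sobolev space. $\Delta_j$, $j\ge -1$, are Littlewood–Paley blocks: Fourier multipliers with symbols $\chi$ ($j=-1$) and $\rho(2^{-j}\cdot)$ ($j\ge0$), where $\chi,\rho\ge 0$ are smooth radial, $\chi$ supported in a ball, $\rho$ in an annulus, $\chi+\sum_{j\ge0}\rho(2^{-j}\cdot)=1$, $\chi\rho(2^{-j}\cdot)=0$ for $j\ge1$, $\rho(2^{-i}\cdot)\rho(2^{-j}\cdot)=0$ for $|i-j|>1$. $\mathscr C^\beta=B^\beta_{\infty,\infty}$ with norm $\sup_j2^{j\beta}\|\Delta_jf\|_{L^\infty}$. Paraproduct: $f\prec g=\sum_{j}\sum_{i\le j-2}\Delta_if\,\Delta_jg$;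 resonant product: $f\circ g=\sum_{|i-j|\le1}\Delta_if\,\Delta_jg$. $\lesssim$ means up to a constant depending only on $\alpha,\beta,\gamma,d$ and the partition of unity. *)

theory Defs
  imports "HOL-Analysis.Analysis"
begin

section \<open>Test functions and distributions on the torus\<close>

text \<open>The dimension is \<open>d = CARD('n)\<close>; functions on the torus are functions on \<open>real ^ 'n\<close> that
  are periodic with respect to the integer lattice.\<close>

definition int_lattice :: "(real ^ 'n) set" where
  "int_lattice = {k. \<forall>i. k $ i \<in> \<int>}"

definition torus_periodic :: "(real ^ 'n \<Rightarrow> real) \<Rightarrow> bool" where
  "torus_periodic f \<longleftrightarrow> (\<forall>x. \<forall>k\<in>int_lattice. f (x + k) = f x)"

primrec iter_partial :: "'n list \<Rightarrow> (real ^ 'n \<Rightarrow> real) \<Rightarrow> real ^ 'n \<Rightarrow> real" where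
  "iter_partial [] f = f"
| "iter_partial (i # is) f = (\<lambda>x. frechet_derivative (iter_partial is f) (at x) (axis i 1))"

text \<open>Differentiability of all iterated partial derivatives entails their continuity, so this is
  the class of infinitely differentiable functions.\<close>

definition smooth :: "(real ^ 'n \<Rightarrow> real) \<Rightarrow> bool" where
  "smooth f \<longleftrightarrow> (\<forall>is x. iter_partial is f differentiable (at x))"

definition test_functions :: "(real ^ 'n \<Rightarrow> real) set" where
  "test_functions = {\<phi>. smooth \<phi> \<and> torus_periodic \<phi>}"

text \<open>Distributions are the continuous linear functionals on the Frechet space of test functions.
  They are made extensional, so that a distribution is determined by its values on test
  functions.\<close>

type_synonym 'n distr = "(real ^ 'n \<Rightarrow> real) \<Rightarrow> real"

definition distributions :: "('n::finite) distr set" where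
  "distributions = {u. u \<in> extensional test_functions \<and>
     (\<forall>\<phi>\<in>test_functions. \<forall>\<psi>\<in>test_functions. u (\<lambda>x. \<phi> x + \<psi> x) = u \<phi> + u \<psi>) \<and>
     (\<forall>\<phi>\<in>test_functions. \<forall>c. u (\<lambda>x. c * \<phi> x) = c * u \<phi>) \<and>
     (\<exists>N C. \<forall>\<phi>\<in>test_functions.
        \<bar>u \<phi>\<bar> \<le> C * (\<Sum>is\<in>{is. length is \<le> N}. SUP x. \<bar>iter_partial is \<phi> x\<bar>))}"

definition torus_inner :: "(real ^ 'n \<Rightarrow> real) \<Rightarrow> (real ^ 'n \<Rightarrow> real) \<Rightarrow> real" where
  "torus_inner f g = (LINT x:cbox 0 1|lborel. f x * g x)"

definition distr_of :: "(real ^ 'n \<Rightarrow> real) \<Rightarrow> ('n::finite) distr" where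
  "distr_of f = restrict (torus_inner f) test_functions"

text \<open>The pairing of \<open>u\<close> with \<open>x \<mapsto> exp (- 2 \<pi> \<i> k \<bullet> x)\<close>, by complex linearity.\<close>

definition fourier_coeff :: "('n::finite) distr \<Rightarrow> real ^ 'n \<Rightarrow> complex" where
  "fourier_coeff u k =
     Complex (u (\<lambda>x. cos (2 * pi * (k \<bullet> x)))) (- u (\<lambda>x. sin (2 * pi * (k \<bullet> x))))"


section \<open>Littlewood--Paley blocks and function spaces\<close>

definition dyadic_partition :: "(real ^ 'n \<Rightarrow> real) \<Rightarrow> (real ^ 'n \<Rightarrow> real) \<Rightarrow> bool" where
  "dyadic_partition chi \<rho> \<longleftrightarrow>
     smooth chi \<and> smooth \<rho> \<and>
     (\<forall>\<xi>. 0 \<le> chi \<xi>) \<and> (\<forall>\<xi>. 0 \<le> \<rho> \<xi>) \<and>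
     (\<forall>\<xi> \<eta>. norm \<xi> = norm \<eta> \<longrightarrow> chi \<xi> = chi \<eta> \<and> \<rho> \<xi> = \<rho> \<eta>) \<and>
     (\<exists>R. \<forall>\<xi>. chi \<xi> \<noteq> 0 \<longrightarrow> norm \<xi> \<le> R) \<and>
     (\<exists>r R. 0 < r \<and> r < R \<and> (\<forall>\<xi>. \<rho> \<xi> \<noteq> 0 \<longrightarrow> r \<le> norm \<xi> \<and> norm \<xi> \<le> R)) \<and>
     (\<forall>\<xi>. (\<lambda>j. \<rho> ((1 / 2 ^ j) *\<^sub>R \<xi>)) sums (1 - chi \<xi>)) \<and>
     (\<forall>j\<ge>1::nat. \<forall>\<xi>. chi \<xi> * \<rho> ((1 / 2 ^ j) *\<^sub>R \<xi>) = 0) \<and>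
     (\<forall>(i::nat) (j::nat). \<bar>int i - int j\<bar> > 1 \<longrightarrow>
        (\<forall>\<xi>. \<rho> ((1 / 2 ^ i) *\<^sub>R \<xi>) * \<rho> ((1 / 2 ^ j) *\<^sub>R \<xi>) = 0))"

text \<open>Only the values at indices \<open>j \<ge> -1\<close> are used.\<close>

definition lp_symbol ::
  "(real ^ 'n \<Rightarrow> real) \<Rightarrow> (real ^ 'n \<Rightarrow> real) \<Rightarrow> int \<Rightarrow> real ^ 'n \<Rightarrow> real" where
  "lp_symbol chi \<rho> j \<xi> = (if j = -1 then chi \<xi> else \<rho> ((1 / 2 ^ nat j) *\<^sub>R \<xi>))"

text \<open>Only finitely many terms of the sum are nonzero, and since the symbol is even and the
  distribution real, the sum itself is real: \<^const>\<open>Re\<close> merely changes the type.\<close>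

definition lp_block ::
  "(real ^ 'n \<Rightarrow> real) \<Rightarrow> (real ^ 'n \<Rightarrow> real) \<Rightarrow>
   int \<Rightarrow> ('n::finite) distr \<Rightarrow> real ^ 'n \<Rightarrow> real" where
  "lp_block chi \<rho> j u x =
     Re (\<Sum>\<^sub>\<infinity>k\<in>int_lattice.
           of_real (lp_symbol chi \<rho> j k) * fourier_coeff u k * cis (2 * pi * (k \<bullet> x)))"

text \<open>The weight is the symbol of \<open>(1 - Laplacian)\<^sup>s\<close>.\<close>

definition sobolev_weight :: "real \<Rightarrow> real ^ 'n \<Rightarrow> real" where
  "sobolev_weight s k = (1 + (2 * pi * norm k)\<^sup>2) powr s"

definition sobolev_space :: "real \<Rightarrow> ('n::finite) distr set" where
  "sobolev_space s = {u \<in> distributions.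
     (\<lambda>k. sobolev_weight s k * (cmod (fourier_coeff u k))\<^sup>2) summable_on int_lattice}"

definition sobolev_norm :: "real \<Rightarrow> ('n::finite) distr \<Rightarrow> real" where
  "sobolev_norm s u =
     sqrt (\<Sum>\<^sub>\<infinity>k\<in>int_lattice. sobolev_weight s k * (cmod (fourier_coeff u k))\<^sup>2)"

text \<open>The Littlewood--Paley blocks are trigonometric polynomials, so their \<open>L\<^sup>\<infinity>\<close> norm is the
  supremum of a bounded continuous function.\<close>

definition sup_norm :: "(real ^ 'n \<Rightarrow> real) \<Rightarrow> real" where
  "sup_norm f = (SUP x. \<bar>f x\<bar>)"

definition besov_space ::
  "(real ^ 'n \<Rightarrow> real) \<Rightarrow> (real ^ 'n \<Rightarrow> real) \<Rightarrow>
   real \<Rightarrow> ('n::finite) distr set" where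
  "besov_space chi \<rho> \<beta> = {u \<in> distributions.
     bdd_above ((\<lambda>j::int. 2 powr (of_int j * \<beta>) * sup_norm (lp_block chi \<rho> j u)) ` {-1..})}"

definition besov_norm ::
  "(real ^ 'n \<Rightarrow> real) \<Rightarrow> (real ^ 'n \<Rightarrow> real) \<Rightarrow>
   real \<Rightarrow> ('n::finite) distr \<Rightarrow> real" where
  "besov_norm chi \<rho> \<beta> u =
     (SUP j\<in>{-1::int..}. 2 powr (of_int j * \<beta>) * sup_norm (lp_block chi \<rho> j u))"

text \<open>The products below are pointwise sums. They are meant for smooth \<open>f\<close> and \<open>g\<close>, for which
  the series converge absolutely and uniformly.\<close>

definition paraproduct ::
  "(real ^ 'n \<Rightarrow> real) \<Rightarrow> (real ^ 'n \<Rightarrow> real) \<Rightarrow>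
   (real ^ 'n \<Rightarrow> real) \<Rightarrow> (real ^ 'n \<Rightarrow> real) \<Rightarrow> real ^ 'n \<Rightarrow> real" where
  "paraproduct chi \<rho> f g x =
     (\<Sum>\<^sub>\<infinity>j\<in>{-1..}. \<Sum>i\<in>{-1..j - 2}.
        lp_block chi \<rho> i (distr_of f) x * lp_block chi \<rho> j (distr_of g) x)"

definition resonant ::
  "(real ^ 'n \<Rightarrow> real) \<Rightarrow> (real ^ 'n \<Rightarrow> real) \<Rightarrow>
   (real ^ 'n \<Rightarrow> real) \<Rightarrow> (real ^ 'n \<Rightarrow> real) \<Rightarrow> real ^ 'n \<Rightarrow> real" where
  "resonant chi \<rho> f g x =
     (\<Sum>\<^sub>\<infinity>(i, j)\<in>{(i, j). -1 \<le> i \<and> -1 \<le> j \<and> \<bar>i - j\<bar> \<le> 1}.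
        lp_block chi \<rho> i (distr_of f) x * lp_block chi \<rho> j (distr_of g) x)"

end

theory Submission
  imports Defs
begin

text \<open>Since test functions embed injectively into distributions and \<open>D\<close> need not be multilinear, it
  suffices to bound the defect \<open>\<langle>f, h \<circ> g\<rangle> - \<langle>f \<prec> g, h\<rangle>\<close> for smooth functions and to extend \<open>D\<close> by zero.
  Writing \<open>G\<close> for the \<open>n\<close>-th block of \<open>g\<close>, the defect is the sum over \<open>n\<close> of the forms
  \<open>\<Sum>z. \<Sum>y. f z * h y * G (- (z + y)) * (near n y - low n z)\<close> in the Fourier coefficients.
  If \<open>z\<close> and \<open>y\<close> both have size \<open>2\<^sup>n\<close>, then Hoelder's inequality with exponents \<open>(2, \<infinity>, 2)\<close> is enough.
  Otherwise exactly one of them is small. The supports of \<open>\<rho> (2\<^sup>-\<^sup>i \<cdot>)\<close> and \<open>\<rho> (2\<^sup>-\<^sup>j \<cdot>)\<close> with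
  \<open>\<bar>i - j\<bar> > 1\<close> may touch, so the symbol need not vanish there, but it vanishes to infinite order on the
  spectrum of \<open>G\<close>. Expanding it into a Fourier series and subtracting the vanishing Taylor polynomial
  of each exponential separates the variables and gains any power of (small frequency) / \<open>2\<^sup>n\<close>.
  With a power exceeding \<open>\<alpha>\<close> and \<open>\<gamma>\<close> the sum over \<open>n\<close> closes by Cauchy--Schwarz, using
  \<open>\<alpha> + \<beta> + \<gamma> \<ge> 0\<close>.\<close>


section \<open>Summability over the integer lattice\<close>

text \<open>The bound at one scale must be uniform in \<open>n\<close>, although
  \<open>near n\<close> and \<open>low n\<close> change with \<open>n\<close>. The partition
  identity telescopes, so sums of consecutive symbols are differences of dilates of
  \<open>chi\<close>; for \<open>n \<ge> 2\<close> both multipliers are therefore dilates by the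
  factor \<open>2 ^ n\<close> of two fixed functions, and one expansion of each serves all scales.
  What is known about these functions is constancy on the open set where a dilate of
  \<open>\<rho>\<close> is nonzero, with no margin around that set. Constancy along a short segment
  through x in direction z still annihilates the moments of the Fourier series in that direction,
  however short the segment is, so the bound does not degrade as x approaches the boundary. The
  weight \<open>(jap k / 4 ^ n) ^ M\<close> then treats small and large frequencies alike: it
  expresses the gain for the former and is bounded below for the latter, so that every part of the
  bilinear sum is controlled by the same product of weighted norms.\<close>

lemma int_lattice_0 [simp]: "0 \<in> int_lattice"
  by (simp add: int_lattice_def)

lemma int_lattice_add: "k \<in> int_lattice \<Longrightarrow> l \<in> int_lattice \<Longrightarrow> k + l \<in> int_lattice"
  by (simp add: int_lattice_def)

lemma int_lattice_diff: "k \<in> int_lattice \<Longrightarrow> l \<in> int_lattice \<Longrightarrow> k - l \<in> int_lattice"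
  by (simp add: int_lattice_def)

lemma int_lattice_uminus [simp]: "- k \<in> int_lattice \<longleftrightarrow> k \<in> int_lattice"
  by (simp add: int_lattice_def minus_in_Ints_iff)

lemma axis_in_int_lattice [simp]: "axis i 1 \<in> int_lattice"
  by (simp add: int_lattice_def axis_def)

text \<open>Integer-valued functions serve as labels because finite boxes of them are
  \<open>PiE\<close> sets, over which sums of products factor.\<close>

definition lattice_of_int :: "('n::finite \<Rightarrow> int) \<Rightarrow> real ^ 'n" where
  "lattice_of_int m = (\<chi> i. of_int (m i))"

lemma lattice_of_int_nth [simp]: "lattice_of_int m $ i = of_int (m i)"
  by (simp add: lattice_of_int_def)

lemma bij_lattice_of_int: "bij_betw lattice_of_int UNIV int_lattice"
proof (rule bij_betwI')
  show "(lattice_of_int x = lattice_of_int y) = (x = y)" for x y :: "'n::finite \<Rightarrow> int"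
    by (auto simp: vec_eq_iff fun_eq_iff)
  show "lattice_of_int x \<in> int_lattice" for x :: "'n::finite \<Rightarrow> int"
    by (simp add: int_lattice_def)
  show "\<exists>x\<in>UNIV. y = lattice_of_int x" if "y \<in> int_lattice" for y :: "real ^ 'n::finite"
    using that by (intro bexI[of _ "\<lambda>i. \<lfloor>y $ i\<rfloor>"]) (auto simp: vec_eq_iff int_lattice_def elim: Ints_cases)
qed

definition lattice_ball :: "real \<Rightarrow> (real ^ 'n::finite) set" where
  "lattice_ball r = {k \<in> int_lattice. norm k \<le> r}"

lemma finite_lattice_ball [simp]: "finite (lattice_ball r :: (real ^ 'n::finite) set)"
proof -
  let ?N = "\<lceil>r\<rceil>"
  have "lattice_ball r \<subseteq> lattice_of_int ` PiE (UNIV :: 'n set) (\<lambda>_. {-?N..?N})"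
  proof
    fix k :: "real ^ 'n" assume k: "k \<in> lattice_ball r"
    then obtain m where m: "k = lattice_of_int m"
      using bij_lattice_of_int by (auto simp: lattice_ball_def bij_betw_def)
    have "\<bar>k $ i\<bar> \<le> r" for i
      using k component_le_norm_cart[of k i] by (simp add: lattice_ball_def)
    then have "\<bar>real_of_int (m i)\<bar> \<le> r" for i by (simp add: m)
    then have "real_of_int \<bar>m i\<bar> \<le> real_of_int ?N" for i
      by (metis le_of_int_ceiling of_int_abs order_trans)
    then have "m i \<in> {-?N..?N}" for i
      unfolding of_int_le_iff by (simp add: abs_le_iff minus_le_iff)
    then show "k \<in> lattice_of_int ` PiE UNIV (\<lambda>_. {-?N..?N})"
      using m by auto
  qed
  then show ?thesis
    by (rule finite_subset) (intro finite_imageI finite_PiE, auto)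
qed

lemma summable_inverse_square_int: "(\<lambda>n::int. 1 / (1 + \<bar>real_of_int n\<bar>)\<^sup>2) summable_on UNIV"
proof -
  have nn: "summable (\<lambda>n::nat. 1 / (1 + real n)\<^sup>2)"
    using inverse_power_summable[of 2, where 'a = real]
      summable_Suc_iff[of "\<lambda>n. inverse ((real n)\<^sup>2)"]
    by (simp add: inverse_eq_divide add.commute)
  have s: "(\<lambda>n::nat. 1 / (1 + real n)\<^sup>2) summable_on UNIV"
    by (subst summable_on_UNIV_nonneg_real_iff) (use nn in auto)
  have "(\<lambda>n::int. 1 / (1 + \<bar>real_of_int n\<bar>)\<^sup>2) summable_on range int"
    using s by (subst summable_on_reindex) (auto simp: o_def inj_on_def)
  moreover have "(\<lambda>n::int. 1 / (1 + \<bar>real_of_int n\<bar>)\<^sup>2) summable_on range (\<lambda>n::nat. - int n)"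
    using s by (subst summable_on_reindex) (auto simp: o_def inj_on_def)
  ultimately have "(\<lambda>n::int. 1 / (1 + \<bar>real_of_int n\<bar>)\<^sup>2) summable_on (range int \<union> range (\<lambda>n::nat. - int n))"
    by (rule summable_on_union)
  moreover have "n \<in> range int \<union> range (\<lambda>n::nat. - int n)" for n
    by (cases n rule: int_cases2) auto
  then have "range int \<union> range (\<lambda>n::nat. - int n) = UNIV"
    by auto
  ultimately show ?thesis by simp
qed

text \<open>A finite index set lies in the box spanned by its coordinate projections, and over a box
  the sum of the products is a product of one-dimensional sums.\<close>

lemma summable_lattice_inverse_squares:
  "(\<lambda>k::real ^ 'n::finite. \<Prod>i\<in>UNIV. 1 / (1 + \<bar>k $ i\<bar>)\<^sup>2) summable_on int_lattice"
proof -
  let ?a = "\<lambda>n::int. 1 / (1 + \<bar>real_of_int n\<bar>)\<^sup>2"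
  have "(\<lambda>m::'n \<Rightarrow> int. \<Prod>i\<in>UNIV. ?a (m i)) summable_on UNIV"
  proof (rule nonneg_bdd_above_summable_on)
    show "bdd_above (sum (\<lambda>m::'n \<Rightarrow> int. \<Prod>i\<in>UNIV. ?a (m i)) ` {F. F \<subseteq> UNIV \<and> finite F})"
    proof (rule bdd_aboveI2)
      fix F :: "('n \<Rightarrow> int) set" assume "F \<in> {F. F \<subseteq> UNIV \<and> finite F}"
      then have fin: "finite F" by simp
      let ?B = "\<lambda>i. (\<lambda>m. m i) ` F"
      have "sum (\<lambda>m. \<Prod>i\<in>UNIV. ?a (m i)) F \<le> sum (\<lambda>m. \<Prod>i\<in>UNIV. ?a (m i)) (PiE UNIV ?B)"
        using fin by (intro sum_mono2 finite_PiE prod_nonneg) auto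
      also have "\<dots> = (\<Prod>i\<in>UNIV. \<Sum>n\<in>?B i. ?a n)"
        using fin by (subst prod_sum_PiE) auto
      also have "\<dots> \<le> (\<Prod>i\<in>(UNIV::'n set). infsum ?a UNIV)"
        using fin by (intro prod_mono conjI sum_nonneg finite_sum_le_infsum[OF summable_inverse_square_int]) auto
      finally show "sum (\<lambda>m. \<Prod>i\<in>UNIV. ?a (m i)) F \<le> (\<Prod>i\<in>(UNIV::'n set). infsum ?a UNIV)" .
    qed
  qed (auto intro: prod_nonneg)
  then show ?thesis
    by (subst summable_on_reindex_bij_betw[OF bij_lattice_of_int, symmetric]) simp
qed

text \<open>Decay is available only along single coordinates. The largest coordinate
  \<open>m\<close> suffices: \<open>1 + m\<close> controls the norm up to the factor
  \<open>d\<close> and also every factor of the summable product.\<close>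

lemma summable_lattice_decay:
  fixes c :: "real ^ 'n::finite \<Rightarrow> 'b::real_normed_vector"
  assumes c: "\<And>p. \<exists>C. \<forall>k\<in>int_lattice. \<forall>i. \<bar>k $ i\<bar> ^ p * norm (c k) \<le> C"
  shows "(\<lambda>k. norm k ^ M * norm (c k)) summable_on int_lattice"
proof -
  define d where "d = real CARD('n)"
  \<comment> \<open>\<open>M\<close> powers pay for the norm, two per coordinate for the convergent
    product of inverse squares.\<close>
  define p where "p = M + 2 * CARD('n)"
  obtain C0 where C0: "\<And>k. k \<in> int_lattice \<Longrightarrow> norm (c k) \<le> C0"
    using c[of 0] by auto
  obtain C1 where C1: "\<And>k i. k \<in> int_lattice \<Longrightarrow> \<bar>k $ i\<bar> ^ p * norm (c k) \<le> C1"
    using c[of p] by auto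
  define K where "K = d ^ M * (2 ^ p * (C0 + C1))"
  have bd: "norm k ^ M * norm (c k) \<le> K * (\<Prod>i\<in>UNIV. 1 / (1 + \<bar>k $ i\<bar>)\<^sup>2)" 
    if k: "k \<in> int_lattice" for k :: "real ^ 'n"
  proof -
    define m where "m = Max (range (\<lambda>i. \<bar>k $ i\<bar>))"
    have mi: "\<bar>k $ i\<bar> \<le> m" for i unfolding m_def by (rule Max_ge) auto
    have "m \<in> range (\<lambda>i. \<bar>k $ i\<bar>)" unfolding m_def by (rule Max_in) auto
    then obtain i0 where i0: "m = \<bar>k $ i0\<bar>" by auto
    have m0: "m \<ge> 0" using i0 by simp
    have "norm k \<le> (\<Sum>i\<in>UNIV. \<bar>k $ i\<bar>)" by (rule norm_le_l1_cart)
    also have "\<dots> \<le> (\<Sum>i\<in>(UNIV::'n set). m)" by (intro sum_mono mi)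
    also have "\<dots> \<le> d * (1 + m)" by (simp add: d_def)
    finally have nk: "norm k \<le> d * (1 + m)" .
    have pr: "(\<Prod>i\<in>UNIV. (1 + \<bar>k $ i\<bar>)\<^sup>2) \<le> (1 + m) ^ (2 * CARD('n))"
    proof -
      have "(\<Prod>i\<in>UNIV. (1 + \<bar>k $ i\<bar>)\<^sup>2) \<le> (\<Prod>i\<in>(UNIV::'n set). (1 + m)\<^sup>2)"
        by (intro prod_mono conjI power_mono) (use mi in auto)
      then show ?thesis by (simp add: power_mult)
    qed
    have "(1 + m) ^ p \<le> 2 ^ p * (1 + m ^ p)"
    proof (cases "m \<le> 1")
      case True
      then have "(1 + m) ^ p \<le> 2 ^ p" using m0 by (intro power_mono) auto
      also have "\<dots> \<le> 2 ^ p * (1 + m ^ p)" using m0 by simp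
      finally show ?thesis .
    next
      case False
      then have "(1 + m) ^ p \<le> (2 * m) ^ p" using m0 by (intro power_mono) auto
      also have "\<dots> \<le> 2 ^ p * (1 + m ^ p)" using m0 by (simp add: power_mult_distrib)
      finally show ?thesis .
    qed
    then have "(1 + m) ^ p * norm (c k) \<le> 2 ^ p * (norm (c k) + m ^ p * norm (c k))"
      using mult_right_mono[of "(1+m)^p" "2 ^ p * (1 + m ^ p)" "norm (c k)"] by (simp add: algebra_simps)
    also have "\<dots> \<le> 2 ^ p * (C0 + C1)"
      using C0[OF k] C1[OF k, of i0] by (intro mult_left_mono add_mono) (auto simp: i0)
    finally have b1: "(1 + m) ^ p * norm (c k) \<le> 2 ^ p * (C0 + C1)" .
    have "norm k ^ M * norm (c k) * (\<Prod>i\<in>UNIV. (1 + \<bar>k $ i\<bar>)\<^sup>2)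
      \<le> (d * (1 + m)) ^ M * norm (c k) * (1 + m) ^ (2 * CARD('n))"
      using nk pr m0 by (intro mult_mono power_mono prod_nonneg mult_nonneg_nonneg) (auto simp: d_def)
    also have "\<dots> = d ^ M * ((1 + m) ^ p * norm (c k))"
      by (simp add: p_def power_add power_mult_distrib)
    also have "\<dots> \<le> K"
      unfolding K_def by (intro mult_left_mono b1) (auto simp: d_def)
    finally have "norm k ^ M * norm (c k) * (\<Prod>i\<in>UNIV. (1 + \<bar>k $ i\<bar>)\<^sup>2) \<le> K" .
    moreover have "(\<Prod>i\<in>UNIV. (1 + \<bar>k $ i\<bar>)\<^sup>2) > 0" by (intro prod_pos) (auto simp: zero_less_power add_pos_nonneg)
    ultimately show ?thesis by (simp add: prod_dividef pos_le_divide_eq)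
  qed
  have "(\<lambda>k::real ^ 'n. K * (\<Prod>i\<in>UNIV. 1 / (1 + \<bar>k $ i\<bar>)\<^sup>2)) summable_on int_lattice"
    by (intro summable_on_cmult_right summable_lattice_inverse_squares)
  then show ?thesis
    by (rule summable_on_comparison_test) (use bd in auto)
qed


section \<open>Lebesgue measure on the torus\<close>

definition torus_measure :: "(real ^ 'n::finite) measure" where
  "torus_measure = restrict_space lborel (cbox 0 1)"

lemma inner_one_Basis: "b \<in> Basis \<Longrightarrow> (1 :: real ^ 'n::finite) \<bullet> b = 1"
  by (auto simp: Basis_vec_def inner_axis)

lemma emeasure_unit_cube:
  "emeasure lborel (cbox 0 (1 :: real ^ 'n::finite)) = 1" "emeasure lborel (box 0 (1 :: real ^ 'n)) = 1"
  by (simp_all add: emeasure_lborel_cbox_eq emeasure_lborel_box_eq inner_one_Basis)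

lemma emeasure_torus_measure: "emeasure (torus_measure :: (real ^ 'n::finite) measure) (space torus_measure) = 1"
  by (simp add: torus_measure_def emeasure_restrict_space space_restrict_space emeasure_unit_cube)

interpretation torus: finite_measure "torus_measure :: (real ^ 'n::finite) measure"
  by (rule finite_measureI) (simp add: emeasure_torus_measure)

lemma space_torus_measure [simp]: "space torus_measure = cbox 0 1"
  by (simp add: torus_measure_def space_restrict_space)

lemma measure_torus_measure [simp]: "measure torus_measure (cbox 0 (1 :: real ^ 'n::finite)) = 1"
  using emeasure_torus_measure[where 'n = 'n] by (simp add: measure_def)

lemma integrable_torus_measure:
  fixes F :: "real ^ 'n::finite \<Rightarrow> 'b::{banach, second_countable_topology}"
  assumes "continuous_on UNIV F"
  shows "integrable torus_measure F"
proof -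
  obtain B where B: "\<And>x. x \<in> cbox 0 1 \<Longrightarrow> norm (F x) \<le> B"
    using compact_imp_bounded[OF compact_continuous_image[OF continuous_on_subset[OF assms subset_UNIV] compact_cbox[of 0 1]]]
    by (auto simp: bounded_iff)
  have [measurable]: "F \<in> borel_measurable borel"
    using assms by (rule borel_measurable_continuous_onI)
  have "F \<in> borel_measurable torus_measure"
    unfolding torus_measure_def by (rule measurable_restrict_space1) measurable
  then show ?thesis
    using B by (intro torus.integrable_const_bound[of _ B]) auto
qed

lemma LINT_torus_measure:
  fixes F :: "real ^ 'n::finite \<Rightarrow> 'b::{banach, second_countable_topology}"
  shows "(LINT x|torus_measure. F x) = (LINT x:cbox 0 1|lborel. F x)"
  by (simp add: torus_measure_def set_lebesgue_integral_def integral_restrict_space)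

lemma torus_inner_eq: "torus_inner f g = (LINT x|torus_measure. f x * g x)"
  by (simp add: LINT_torus_measure torus_inner_def)

text \<open>The lattice translates of this cube tile the space exactly, whereas those of the closed
  cube overlap in faces. The two differ by a null set, so integrals may use either.\<close>

definition half_open_cube :: "(real ^ 'n::finite) set" where
  "half_open_cube = {x. \<forall>i. 0 \<le> x $ i \<and> x $ i < 1}"

lemma half_open_cube_subset: "half_open_cube \<subseteq> cbox 0 1"
  by (auto simp: half_open_cube_def mem_box_cart less_imp_le)

lemma half_open_cube_measurable [measurable]: "half_open_cube \<in> sets borel"
proof -
  have "half_open_cube = (\<Inter>i\<in>UNIV. {x::real ^ 'n. 0 \<le> x $ i} \<inter> {x. x $ i < 1})"
    by (auto simp: half_open_cube_def)
  also have "\<dots> \<in> sets borel"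
    by (intro sets.countable_INT' sets.Int borel_closed borel_open closed_Collect_le open_Collect_less
        continuous_intros countable_finite finite_class.finite_UNIV) auto
  finally show ?thesis .
qed

lemma AE_half_open_cube:
  "AE x in lborel. x \<in> cbox 0 (1 :: real ^ 'n::finite) \<longleftrightarrow> x \<in> half_open_cube"
proof -
  have "emeasure lborel (cbox 0 (1 :: real ^ 'n) - box 0 1) = 0"
    by (subst emeasure_Diff) (auto simp: emeasure_unit_cube box_subset_cbox)
  then have "cbox 0 (1 :: real ^ 'n) - box 0 1 \<in> null_sets lborel"
    by (auto intro!: null_setsI)
  moreover have "{x \<in> space lborel. \<not> (x \<in> cbox 0 (1 :: real ^ 'n) \<longleftrightarrow> x \<in> half_open_cube)} \<subseteq> cbox 0 1 - box 0 1"
    by (auto simp: half_open_cube_def mem_box_cart less_imp_le)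
  ultimately show ?thesis
    by (rule AE_I')
qed

lemma LINT_torus_half_open:
  fixes F :: "real ^ 'n::finite \<Rightarrow> 'b::{banach, second_countable_topology}"
  assumes "continuous_on UNIV F"
  shows "(LINT x|torus_measure. F x) = (LINT x:half_open_cube|lborel. F x)"
proof -
  have [measurable]: "F \<in> borel_measurable borel"
    using assms by (rule borel_measurable_continuous_onI)
  show ?thesis
    unfolding LINT_torus_measure set_lebesgue_integral_def
    by (rule integral_cong_AE) (use AE_half_open_cube in \<open>auto simp: indicator_def\<close>)
qed

lemma set_integrable_half_open:
  fixes F :: "real ^ 'n::finite \<Rightarrow> 'b::{banach, second_countable_topology}"
  assumes "continuous_on UNIV F" "A \<in> sets borel" "A \<subseteq> half_open_cube"
  shows "set_integrable lborel A F"
proof (rule set_integrable_subset)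
  show "set_integrable lborel (cbox 0 1) F"
    by (rule borel_integrable_compact[OF compact_cbox, folded set_integrable_def])
      (rule continuous_on_subset[OF assms(1)], simp)
  show "A \<subseteq> cbox 0 1" using assms half_open_cube_subset by blast
qed (use assms in auto)

text \<open>The translated cube differs from the original one by a slab that has moved by one
  period, which the integral of a periodic function cannot see.\<close>

lemma LINT_torus_shift:
  fixes F :: "real ^ 'n::finite \<Rightarrow> complex"
  assumes cont: "continuous_on UNIV F"
    and per: "\<And>x. F (x + axis i 1) = F x"
    and t: "0 \<le> t" "t < 1"
  shows "(LINT x|torus_measure. F (x + t *\<^sub>R axis i 1)) = (LINT x|torus_measure. F x)"
proof -
  let ?e = "axis i (1::real)" and ?H = "half_open_cube :: (real ^ 'n) set"
  have [measurable]: "F \<in> borel_measurable borel"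
    using cont by (rule borel_measurable_continuous_onI)
  define A where "A = {y \<in> ?H. y $ i < t}"
  have A_sets [measurable]: "A \<in> sets borel"
  proof -
    have "A = ?H \<inter> {y. y $ i < t}" by (auto simp: A_def)
    moreover have "{y::real ^ 'n. y $ i < t} \<in> sets borel"
      by (intro borel_open open_Collect_less continuous_intros)
    ultimately show ?thesis by simp
  qed
  have sub: "A \<subseteq> ?H" by (auto simp: A_def)
  have shift: "(LINT x|lborel. f (x + v)) = (LINT x|lborel. f x)"
    if "f \<in> borel_measurable borel" for f :: "real ^ 'n \<Rightarrow> complex" and v
    using integral_distr[of "(+) v" lborel borel f] that
    by (simp add: lborel_distr_plus add.commute[of v])
  have shiftI: "integrable lborel (\<lambda>x. f (x + v))"
    if "integrable lborel f" for f :: "real ^ 'n \<Rightarrow> complex" and v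
    using integrable_distr[of "(+) v" lborel borel f] that
    by (simp add: lborel_distr_plus add.commute[of v])
  \<comment> \<open>The slice \<open>A\<close> is lost at one end of the cube and reappears one
    period further at the other. Only coordinate \<open>i\<close> matters; \<open>R\<close> collects
    the conditions on the remaining ones.\<close>
  have ind: "indicator ?H (y - t *\<^sub>R ?e) = indicator ?H y - indicator A y + (indicator A (y - ?e) :: real)" for y
  proof -
    have H: "x \<in> ?H \<longleftrightarrow> (0 \<le> x $ i \<and> x $ i < 1) \<and> (\<forall>j. j \<noteq> i \<longrightarrow> 0 \<le> x $ j \<and> x $ j < 1)" for x
      unfolding half_open_cube_def by auto
    define R where "R = (\<forall>j. j \<noteq> i \<longrightarrow> 0 \<le> y $ j \<and> y $ j < 1)"
    have R: "(\<forall>j. j \<noteq> i \<longrightarrow> 0 \<le> (y - s *\<^sub>R ?e) $ j \<and> (y - s *\<^sub>R ?e) $ j < 1) = R" for s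
      by (auto simp: R_def axis_def)
    have R1: "(\<forall>j. j \<noteq> i \<longrightarrow> 0 \<le> (y - ?e) $ j \<and> (y - ?e) $ j < 1) = R"
      using R[of 1] by simp
    have m: "y \<in> ?H \<longleftrightarrow> (0 \<le> y $ i \<and> y $ i < 1) \<and> R"
      "y - t *\<^sub>R ?e \<in> ?H \<longleftrightarrow> (t \<le> y $ i \<and> y $ i < 1 + t) \<and> R"
      "y \<in> A \<longleftrightarrow> (0 \<le> y $ i \<and> y $ i < t) \<and> R"
      "y - ?e \<in> A \<longleftrightarrow> (1 \<le> y $ i \<and> y $ i < 1 + t) \<and> R"
      unfolding A_def mem_Collect_eq H R R1 using t by (auto simp: R_def)
    show ?thesis unfolding indicator_def m using t by auto
  qed
  have iH: "integrable lborel (\<lambda>x. indicator ?H x *\<^sub>R F x)"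
    and iA: "integrable lborel (\<lambda>x. indicator A x *\<^sub>R F x)"
    using set_integrable_half_open[OF cont] sub by (auto simp: set_integrable_def)
  have per': "F (x - ?e) = F x" for x
    using per[of "x - ?e"] by simp
  have "(LINT x|torus_measure. F (x + t *\<^sub>R ?e)) = (LINT x|lborel. indicator ?H x *\<^sub>R F (x + t *\<^sub>R ?e))"
    by (subst LINT_torus_half_open) (auto simp: set_lebesgue_integral_def intro!: continuous_on_compose2[OF cont] continuous_intros)
  also have "\<dots> = (LINT x|lborel. indicator ?H (x - t *\<^sub>R ?e) *\<^sub>R F x)"
    using shift[of "\<lambda>x. indicator ?H (x - t *\<^sub>R ?e) *\<^sub>R F x" "t *\<^sub>R ?e"] by simp
  also have "\<dots> = (LINT x|lborel. indicator ?H x *\<^sub>R F x - indicator A x *\<^sub>R F x + indicator A (x - ?e) *\<^sub>R F (x - ?e))"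
    by (simp add: ind per' algebra_simps)
  also have "\<dots> = (LINT x|lborel. indicator ?H x *\<^sub>R F x) - (LINT x|lborel. indicator A x *\<^sub>R F x)
       + (LINT x|lborel. indicator A (x - ?e) *\<^sub>R F (x - ?e))"
    using shiftI[OF iA, of "- ?e"] by (simp add: iH iA)
  also have "(LINT x|lborel. indicator A (x - ?e) *\<^sub>R F (x - ?e)) = (LINT x|lborel. indicator A x *\<^sub>R F x)"
    using shift[of "\<lambda>x. indicator A x *\<^sub>R F x" "- ?e"] by simp
  finally show ?thesis
    by (simp add: LINT_torus_half_open[OF cont] set_lebesgue_integral_def)
qed


section \<open>Smooth periodic functions and characters\<close>

lemma iter_partial_append: "iter_partial (is @ js) f = iter_partial is (iter_partial js f)"
  by (induction "is") auto

lemma smooth_iter_partial: "smooth f \<Longrightarrow> smooth (iter_partial is f)"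
  by (simp add: smooth_def flip: iter_partial_append)

lemma smooth_imp_differentiable: "smooth f \<Longrightarrow> f differentiable (at x)"
  unfolding smooth_def by (metis iter_partial.simps(1))

lemma smooth_imp_continuous_on: "smooth f \<Longrightarrow> continuous_on S f"
  by (meson continuous_at_imp_continuous_on differentiable_imp_continuous_within smooth_imp_differentiable)

lemma smooth_has_partial:
  assumes "smooth f"
  shows "((\<lambda>t. f (x + t *\<^sub>R axis i 1)) has_real_derivative iter_partial [i] f (x + t *\<^sub>R axis i 1)) (at t)"
proof -
  let ?y = "x + t *\<^sub>R axis i 1"
  have "(f has_derivative frechet_derivative f (at ?y)) (at ?y)"
    using smooth_imp_differentiable[OF assms] frechet_derivative_works by blast
  then have "(f \<circ> (\<lambda>t. x + t *\<^sub>R axis i 1) has_derivative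
      frechet_derivative f (at ?y) \<circ> (\<lambda>t. t *\<^sub>R axis i 1)) (at t)"
    by (intro diff_chain_at) (auto intro!: derivative_eq_intros)
  moreover have "linear (frechet_derivative f (at ?y))"
    using smooth_imp_differentiable[OF assms] linear_frechet_derivative by blast
  ultimately show ?thesis
    by (simp add: has_field_derivative_def o_def linear_cmul mult_commute_abs)
qed

lemma iter_partial_cong_open:
  assumes "open S" "\<And>x. x \<in> S \<Longrightarrow> f x = g x"
  shows "x \<in> S \<Longrightarrow> iter_partial is f x = iter_partial is g x"
proof (induction "is" arbitrary: x)
  case (Cons i "is")
  have "(iter_partial is f has_derivative D) (at x) \<longleftrightarrow> (iter_partial is g has_derivative D) (at x)" for D
    using has_derivative_transform_within_open[OF _ assms(1) Cons.prems] Cons.IH by metis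
  then show ?case by (simp add: frechet_derivative_def)
qed (use assms in auto)

text \<open>Meant for periodizations, which are written with a discontinuous rounding function but
  agree near each point with an affine copy of a smooth function or with zero.\<close>

lemma smooth_locally:
  assumes "\<And>x. \<exists>S g. open S \<and> x \<in> S \<and> smooth g \<and> (\<forall>y\<in>S. f y = g y)"
  shows "smooth f"
  unfolding smooth_def
proof (intro allI)
  fix "is" x
  obtain S g where S: "open S" "x \<in> S" "smooth g" "\<And>y. y \<in> S \<Longrightarrow> f y = g y"
    using assms[of x] by (elim exE conjE) simp
  have "(iter_partial is f has_derivative D) (at x)" if "(iter_partial is g has_derivative D) (at x)" for D
    using that S(1,2) by (rule has_derivative_transform_within_open) (simp add: iter_partial_cong_open[OF S(1,4)])
  moreover have "iter_partial is g differentiable (at x)"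
    using S(3) by (simp add: smooth_def)
  ultimately show "iter_partial is f differentiable (at x)"
    unfolding differentiable_def by blast
qed

lemma smooth_0: "smooth (\<lambda>_. 0)"
proof -
  have "iter_partial is (\<lambda>_. 0) = (\<lambda>_. 0)" for "is" :: "'a list"
    by (induction "is") (simp_all add: frechet_derivative_const)
  then show ?thesis by (simp add: smooth_def)
qed

lemma iter_partial_diff:
  assumes "smooth f" "smooth g"
  shows "iter_partial is (\<lambda>x. f x - g x) = (\<lambda>x. iter_partial is f x - iter_partial is g x)"
proof (induction "is")
  case (Cons i "is")
  have "((\<lambda>x. iter_partial is f x - iter_partial is g x) has_derivative
      (\<lambda>h. frechet_derivative (iter_partial is f) (at x) h - frechet_derivative (iter_partial is g) (at x) h)) (at x)" for x
    using assms unfolding smooth_def frechet_derivative_works by (intro has_derivative_diff) blast+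
  then have "frechet_derivative (\<lambda>x. iter_partial is f x - iter_partial is g x) (at x) =
      (\<lambda>h. frechet_derivative (iter_partial is f) (at x) h - frechet_derivative (iter_partial is g) (at x) h)" for x
    by (rule frechet_derivative_at[symmetric])
  then show ?case by (simp add: Cons)
qed simp

lemma smooth_diff:
  assumes "smooth f" "smooth g"
  shows "smooth (\<lambda>x. f x - g x)"
  using assms by (auto simp: smooth_def iter_partial_diff[OF assms] intro!: differentiable_diff)

lemma iter_partial_affine:
  assumes "smooth f"
  shows "iter_partial is (\<lambda>x. f (a *\<^sub>R x + v)) = (\<lambda>x. a ^ length is * iter_partial is f (a *\<^sub>R x + v))"
proof (induction "is")
  case (Cons i "is")
  let ?g = "iter_partial is f"
  have "((\<lambda>x. a ^ length is * ?g (a *\<^sub>R x + v)) has_derivative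
      (\<lambda>h. a ^ length is * frechet_derivative ?g (at (a *\<^sub>R x + v)) (a *\<^sub>R h))) (at x)" for x
  proof -
    have "(?g has_derivative frechet_derivative ?g (at (a *\<^sub>R x + v))) (at (a *\<^sub>R x + v))"
      using assms unfolding smooth_def frechet_derivative_works by blast
    then have "(?g \<circ> (\<lambda>x. a *\<^sub>R x + v) has_derivative frechet_derivative ?g (at (a *\<^sub>R x + v)) \<circ> (\<lambda>h. a *\<^sub>R h)) (at x)"
      by (intro diff_chain_at) (auto intro!: derivative_eq_intros)
    then show ?thesis by (auto simp: o_def intro!: has_derivative_mult_right)
  qed
  then have "frechet_derivative (\<lambda>x. a ^ length is * ?g (a *\<^sub>R x + v)) (at x) =
      (\<lambda>h. a ^ length is * frechet_derivative ?g (at (a *\<^sub>R x + v)) (a *\<^sub>R h))" for x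
    by (rule frechet_derivative_at[symmetric])
  moreover have "linear (frechet_derivative ?g (at y))" for y
    using assms unfolding smooth_def by (blast intro: linear_frechet_derivative)
  ultimately show ?case
    by (simp add: Cons linear_cmul mult_ac)
qed simp

lemma smooth_affine:
  assumes "smooth f"
  shows "smooth (\<lambda>x. f (a *\<^sub>R x + v))"
  unfolding smooth_def iter_partial_affine[OF assms]
proof (intro allI differentiable_mult differentiable_const)
  fix "is" x
  have "((\<lambda>x. a *\<^sub>R x + v) has_derivative (\<lambda>h. a *\<^sub>R h)) (at x)"
    by (auto intro!: derivative_eq_intros)
  then have "(\<lambda>x. a *\<^sub>R x + v) differentiable (at x)"
    unfolding differentiable_def by blast
  moreover have "iter_partial is f differentiable (at (a *\<^sub>R x + v))"
    using assms by (simp add: smooth_def)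
  ultimately show "(\<lambda>x. iter_partial is f (a *\<^sub>R x + v)) differentiable (at x)"
    by (rule differentiable_compose[rotated])
qed

lemma test_functions_iter_partial:
  assumes "f \<in> test_functions"
  shows "iter_partial is f \<in> test_functions"
proof -
  have f: "smooth f" "\<And>x k. k \<in> int_lattice \<Longrightarrow> f (x + k) = f x"
    using assms by (auto simp: test_functions_def torus_periodic_def)
  have "iter_partial is f (x + k) = iter_partial is f x" if "k \<in> int_lattice" for x k
    using iter_partial_affine[OF f(1), of "is" 1 k] f(2)[OF that] by (simp add: fun_eq_iff)
  then show ?thesis
    using f by (simp add: test_functions_def torus_periodic_def smooth_iter_partial)
qed

text \<open>Combinations of cosine and sine of one fixed frequency are closed under partial
  derivatives; for the cosine or the sine alone the induction would not close.\<close>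

lemma iter_partial_trig:
  "\<exists>a' b'. iter_partial is (\<lambda>x. a * cos (c * (k \<bullet> x)) + b * sin (c * (k \<bullet> x))) =
     (\<lambda>x. a' * cos (c * (k \<bullet> x)) + b' * sin (c * (k \<bullet> x)))" for k :: "real ^ 'n::finite"
proof (induction "is")
  case (Cons i "is")
  then obtain a' b' where IH: "iter_partial is (\<lambda>x. a * cos (c * (k \<bullet> x)) + b * sin (c * (k \<bullet> x))) =
     (\<lambda>x. a' * cos (c * (k \<bullet> x)) + b' * sin (c * (k \<bullet> x)))" by blast
  have "((\<lambda>x. a' * cos (c * (k \<bullet> x)) + b' * sin (c * (k \<bullet> x))) has_derivative
     (\<lambda>h. (b' * c * (k \<bullet> h)) * cos (c * (k \<bullet> x)) + (- a' * c * (k \<bullet> h)) * sin (c * (k \<bullet> x)))) (at x)" for x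
    by (auto intro!: derivative_eq_intros simp: algebra_simps)
  then have "frechet_derivative (\<lambda>x. a' * cos (c * (k \<bullet> x)) + b' * sin (c * (k \<bullet> x))) (at x) =
     (\<lambda>h. (b' * c * (k \<bullet> h)) * cos (c * (k \<bullet> x)) + (- a' * c * (k \<bullet> h)) * sin (c * (k \<bullet> x)))" for x
    by (rule frechet_derivative_at[symmetric])
  then show ?case
    by (intro exI[of _ "b' * c * (k \<bullet> axis i 1)"] exI[of _ "- a' * c * (k \<bullet> axis i 1)"]) (simp add: IH)
qed auto

lemma smooth_trig: "smooth (\<lambda>x. a * cos (c * (k \<bullet> x)) + b * sin (c * (k \<bullet> x)))"
  unfolding smooth_def
proof (intro allI)
  fix "is" and x
  obtain a' b' where "iter_partial is (\<lambda>x. a * cos (c * (k \<bullet> x)) + b * sin (c * (k \<bullet> x))) =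
     (\<lambda>x. a' * cos (c * (k \<bullet> x)) + b' * sin (c * (k \<bullet> x)))"
    using iter_partial_trig by blast
  moreover have "((\<lambda>x. a' * cos (c * (k \<bullet> x)) + b' * sin (c * (k \<bullet> x))) has_derivative
     (\<lambda>h. (b' * c * (k \<bullet> h)) * cos (c * (k \<bullet> x)) + (- a' * c * (k \<bullet> h)) * sin (c * (k \<bullet> x)))) (at x)"
    by (auto intro!: derivative_eq_intros simp: algebra_simps)
  ultimately show "iter_partial is (\<lambda>x. a * cos (c * (k \<bullet> x)) + b * sin (c * (k \<bullet> x))) differentiable (at x)"
    unfolding differentiable_def by auto
qed

section \<open>Characters of the torus\<close>

definition echar :: "real ^ 'n::finite \<Rightarrow> real ^ 'n \<Rightarrow> complex" where
  "echar k x = cis (2 * pi * (k \<bullet> x))"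

lemma norm_echar [simp]: "norm (echar k x) = 1"
  by (simp add: echar_def)

lemma echar_0 [simp]: "echar 0 x = 1" "echar k 0 = 1"
  by (simp_all add: echar_def)

lemma echar_add: "echar (k + l) x = echar k x * echar l x"
  by (simp add: echar_def cis_mult inner_add_left algebra_simps)

lemma echar_add_right: "echar k (x + y) = echar k x * echar k y"
  by (simp add: echar_def cis_mult inner_add_right algebra_simps)

lemma cnj_echar: "cnj (echar k x) = echar (- k) x"
  by (simp add: echar_def cis_cnj)

lemma continuous_on_echar [continuous_intros]: "continuous_on S (echar k)"
  unfolding echar_def[abs_def] by (intro continuous_intros)

lemma inner_int_lattice: "k \<in> int_lattice \<Longrightarrow> l \<in> int_lattice \<Longrightarrow> k \<bullet> l \<in> \<int>"
  by (auto simp: inner_vec_def int_lattice_def intro!: Ints_sum Ints_mult)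

lemma echar_int_lattice: "k \<in> int_lattice \<Longrightarrow> l \<in> int_lattice \<Longrightarrow> echar k l = 1"
  unfolding echar_def using inner_int_lattice by (intro cis_multiple_2pi)

lemma echar_periodic: "k \<in> int_lattice \<Longrightarrow> l \<in> int_lattice \<Longrightarrow> echar k (x + l) = echar k x"
  by (simp add: echar_add_right echar_int_lattice)

lemma trig_test_functions:
  assumes "k \<in> int_lattice"
  shows "(\<lambda>x. cos (2 * pi * (k \<bullet> x))) \<in> test_functions"
    and "(\<lambda>x. sin (2 * pi * (k \<bullet> x))) \<in> test_functions"
proof -
  have "cos (2 * pi * (k \<bullet> (x + l))) = cos (2 * pi * (k \<bullet> x)) \<and> sin (2 * pi * (k \<bullet> (x + l))) = sin (2 * pi * (k \<bullet> x))"
    if "l \<in> int_lattice" for x l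
    using echar_periodic[OF assms that, of x] by (auto simp: echar_def cis.ctr complex_eq_iff)
  then show "(\<lambda>x. cos (2 * pi * (k \<bullet> x))) \<in> test_functions"
    "(\<lambda>x. sin (2 * pi * (k \<bullet> x))) \<in> test_functions"
    using smooth_trig[of 1 "2 * pi" k 0] smooth_trig[of 0 "2 * pi" k 1]
    by (auto simp: test_functions_def torus_periodic_def)
qed


section \<open>Fourier coefficients of test functions\<close>

text \<open>Shifting by half a wavelength along a coordinate with \<open>k $ i \<noteq> 0\<close>
  changes the sign of the character but not its integral. Integrality of \<open>k $ i\<close> keeps
  the shift below one period.\<close>

lemma LINT_echar:
  assumes k: "k \<in> int_lattice"
  shows "(LINT x|torus_measure. echar k x) = (if k = 0 then 1 else 0)"
proof (cases "k = 0")
  case False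
  then obtain i where i: "k $ i \<noteq> 0" by (auto simp: vec_eq_iff)
  then have ge1: "\<bar>k $ i\<bar> \<ge> 1" using k by (auto simp: int_lattice_def elim!: Ints_cases dest: spec[of _ i])
  define t where "t = 1 / (2 * \<bar>k $ i\<bar>)"
  have t: "0 \<le> t" "t < 1" using ge1 by (auto simp: t_def divide_simps)
  have "echar k (t *\<^sub>R axis i 1) = -1"
    using i by (cases "k $ i > 0") (auto simp: echar_def inner_axis t_def cis.ctr complex_eq_iff)
  then have "(LINT x|torus_measure. echar k x) = - (LINT x|torus_measure. echar k x)"
    using LINT_torus_shift[of "echar k" i t] t k
    by (simp add: echar_add_right continuous_on_echar echar_int_lattice)
  then show ?thesis using False by simp
qed simp

text \<open>Coefficients of functions, complex-valued ones included;
  \<open>fourier_coeff_distr_of\<close> identifies them with those of the distribution given by a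
  test function.\<close>

definition tcoeff :: "(real ^ 'n::finite \<Rightarrow> complex) \<Rightarrow> real ^ 'n \<Rightarrow> complex" where
  "tcoeff F k = (LINT x|torus_measure. F x * echar (- k) x)"

lemma test_functions_continuous: "f \<in> test_functions \<Longrightarrow> continuous_on S f"
  by (simp add: test_functions_def smooth_imp_continuous_on)

lemma test_functions_periodic: "f \<in> test_functions \<Longrightarrow> k \<in> int_lattice \<Longrightarrow> f (x + k) = f x"
  by (simp add: test_functions_def torus_periodic_def)

lemma fourier_coeff_distr_of:
  assumes f: "f \<in> test_functions" and k: "k \<in> int_lattice"
  shows "fourier_coeff (distr_of f) k = tcoeff (\<lambda>x. of_real (f x)) k"
proof -
  note c = test_functions_continuous[OF f, of UNIV]
  have i: "integrable torus_measure (\<lambda>x. f x * cos (2 * pi * (k \<bullet> x)))"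
    "integrable torus_measure (\<lambda>x. f x * sin (2 * pi * (k \<bullet> x)))"
    by (intro integrable_torus_measure continuous_intros c)+
  have "integrable torus_measure (\<lambda>x. complex_of_real (f x) * echar (- k) x)"
    by (intro integrable_torus_measure continuous_intros c continuous_on_of_real)
  then have "tcoeff (\<lambda>x. of_real (f x)) k = Complex (LINT x|torus_measure. Re (f x * echar (- k) x)) (LINT x|torus_measure. Im (f x * echar (- k) x))"
    unfolding tcoeff_def by (simp only: complex_eq_iff complex.sel integral_Re integral_Im)
  also have "\<dots> = fourier_coeff (distr_of f) k"
    using trig_test_functions[OF k]
    by (simp add: fourier_coeff_def distr_of_def torus_inner_eq echar_def)
  finally show ?thesis ..
qed

lemma unit_cube_representative:
  obtains k where "k \<in> int_lattice" "x - k \<in> half_open_cube"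
proof
  show "(\<chi> i. of_int \<lfloor>x $ i\<rfloor>) \<in> int_lattice" by (simp add: int_lattice_def)
  show "x - (\<chi> i. of_int \<lfloor>x $ i\<rfloor>) \<in> half_open_cube"
    unfolding half_open_cube_def mem_Collect_eq
  proof
    fix i
    show "0 \<le> (x - (\<chi> i. of_int \<lfloor>x $ i\<rfloor>)) $ i \<and> (x - (\<chi> i. of_int \<lfloor>x $ i\<rfloor>)) $ i < 1"
      by simp linarith
  qed
qed

lemma test_functions_bounded:
  assumes "f \<in> test_functions"
  obtains B where "B \<ge> 0" "\<And>x. \<bar>f x\<bar> \<le> B"
proof -
  have "bounded (f ` cbox 0 1)"
    by (intro compact_imp_bounded compact_continuous_image test_functions_continuous assms compact_cbox)
  then obtain B where B: "\<And>x. x \<in> cbox 0 1 \<Longrightarrow> \<bar>f x\<bar> \<le> B"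
    by (auto simp: bounded_iff)
  have "\<bar>f x\<bar> \<le> B" for x
  proof -
    obtain k where "k \<in> int_lattice" "x - k \<in> half_open_cube" by (rule unit_cube_representative)
    then show ?thesis
      using B[of "x - k"] test_functions_periodic[OF assms, of k "x - k"] half_open_cube_subset by auto
  qed
  moreover from this[of undefined] have "B \<ge> 0" by linarith
  ultimately show ?thesis using that by blast
qed

lemma norm_tcoeff_le:
  assumes "continuous_on UNIV F" "\<And>x. norm (F x) \<le> B"
  shows "norm (tcoeff F k) \<le> B"
proof -
  have "norm (tcoeff F k) \<le> (LINT x|torus_measure. norm (F x * echar (- k) x))"
    unfolding tcoeff_def by (rule integral_norm_bound)
  also have "\<dots> \<le> (LINT x|(torus_measure :: (real ^ 'a) measure). B)"
    by (rule integral_mono) (use assms in \<open>auto intro!: integrable_torus_measure continuous_intros simp: norm_mult\<close>)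
  finally show ?thesis by simp
qed

lemma tcoeff_trig_poly:
  assumes Z: "finite Z" "Z \<subseteq> int_lattice" and l: "l \<in> int_lattice"
  shows "tcoeff (\<lambda>x. \<Sum>k\<in>Z. a k * echar k x) l = (if l \<in> Z then a l else 0)"
proof -
  have "tcoeff (\<lambda>x. \<Sum>k\<in>Z. a k * echar k x) l = (LINT x|torus_measure. (\<Sum>k\<in>Z. a k * echar (k - l) x))"
    unfolding tcoeff_def
    by (intro Bochner_Integration.integral_cong refl)
      (simp add: sum_distrib_right diff_conv_add_uminus echar_add mult.assoc del: add_uminus_conv_diff)
  also have "\<dots> = (\<Sum>k\<in>Z. a k * (LINT x|torus_measure. echar (k - l) x))"
    by (subst Bochner_Integration.integral_sum) (auto intro!: integrable_torus_measure continuous_intros)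
  also have "\<dots> = (\<Sum>k\<in>Z. if k = l then a k else 0)"
    using Z l by (intro sum.cong refl) (auto simp: LINT_echar int_lattice_diff subset_iff)
  finally show ?thesis using Z by simp
qed

text \<open>Translation invariance takes the place of integration by parts: the coefficient of a
  difference quotient of \<open>f\<close> is a difference quotient of the character times the
  coefficient of \<open>f\<close>. The step then tends to zero by dominated convergence, with the
  mean value theorem supplying the constant majorant.\<close>

lemma tcoeff_partial:
  assumes f: "f \<in> test_functions" and k: "k \<in> int_lattice"
  shows "tcoeff (\<lambda>x. of_real (iter_partial [i] f x)) k = (2 * pi * \<i> * (k $ i)) * tcoeff (\<lambda>x. of_real (f x)) k"
proof -
  let ?e = "axis i (1::real)" and ?F = "\<lambda>x. complex_of_real (f x)"
  \<comment> \<open>The offset 2 keeps the step strictly below one, as translation invariance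
    requires.\<close>
  define t where "t = (\<lambda>m::nat. 1 / real (m + 2))"
  have t: "0 < t m" "t m < 1" for m by (auto simp: t_def)
  have tlim: "t \<longlonglongrightarrow> 0"
    unfolding t_def using LIMSEQ_ignore_initial_segment[OF lim_1_over_n, of 2] by simp
  have tlim': "filterlim t (at 0) sequentially"
    using t(1) tlim by (auto simp: filterlim_at less_le)
  have D: "((\<lambda>s. f (x + s *\<^sub>R ?e)) has_real_derivative iter_partial [i] f (x + s *\<^sub>R ?e)) (at s)" for x s
    using f by (intro smooth_has_partial) (simp add: test_functions_def)
  obtain B where B: "\<And>x. \<bar>iter_partial [i] f x\<bar> \<le> B"
    using test_functions_bounded[OF test_functions_iter_partial[OF f]] by metis
  note c = test_functions_continuous[OF f, of UNIV]
  have c': "continuous_on UNIV (\<lambda>x. f (x + v))" for v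
    by (intro continuous_on_compose2[OF c] continuous_intros) auto
  define q where "q = (\<lambda>m x. (?F (x + t m *\<^sub>R ?e) - ?F x) / of_real (t m) * echar (- k) x)"
  have qc: "continuous_on UNIV (q m)" for m
    unfolding q_def using t[of m] by (intro continuous_intros c c' continuous_on_of_real) auto
  have qm [measurable]: "q m \<in> borel_measurable torus_measure" for m
    by (rule borel_measurable_integrable[OF integrable_torus_measure[OF qc]])
  have shift: "(LINT x|torus_measure. ?F (x + s *\<^sub>R ?e) * echar (- k) x) = echar k (s *\<^sub>R ?e) * tcoeff ?F k"
    if s: "0 \<le> s" "s < 1" for s
  proof -
    have eq: "?F (x + s *\<^sub>R ?e) * echar (- k) x = echar k (s *\<^sub>R ?e) * (?F (x + s *\<^sub>R ?e) * echar (- k) (x + s *\<^sub>R ?e))" for x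
    proof -
      have "echar k (s *\<^sub>R ?e) * echar (- k) (s *\<^sub>R ?e) = 1"
        by (simp flip: echar_add)
      then show ?thesis by (simp add: echar_add_right algebra_simps)
    qed
    moreover have "(LINT x|torus_measure. ?F (x + s *\<^sub>R ?e) * echar (- k) (x + s *\<^sub>R ?e)) = tcoeff ?F k"
      unfolding tcoeff_def using k s
      by (intro LINT_torus_shift[of "\<lambda>x. ?F x * echar (- k) x"] continuous_intros continuous_on_of_real c)
        (auto simp: test_functions_periodic[OF f] echar_periodic)
    ultimately show ?thesis
      by (simp only: Bochner_Integration.integral_cong[OF refl eq] integral_mult_right_zero)
  qed
  have "(LINT x|torus_measure. q m x) = (echar k (t m *\<^sub>R ?e) - 1) / of_real (t m) * tcoeff ?F k" for m
  proof -
    have "(LINT x|torus_measure. q m x) =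
      (LINT x|torus_measure. (?F (x + t m *\<^sub>R ?e) * echar (- k) x - ?F x * echar (- k) x) / of_real (t m))"
      by (simp add: q_def algebra_simps diff_divide_distrib)
    also have "\<dots> = ((LINT x|torus_measure. ?F (x + t m *\<^sub>R ?e) * echar (- k) x) - (LINT x|torus_measure. ?F x * echar (- k) x)) / of_real (t m)"
      by (subst integral_divide_zero, subst Bochner_Integration.integral_diff)
        (auto intro!: integrable_torus_measure continuous_intros continuous_on_of_real c c')
    also have "\<dots> = (echar k (t m *\<^sub>R ?e) - 1) / of_real (t m) * tcoeff ?F k"
      using shift[of "t m"] t[of m] by (simp add: tcoeff_def algebra_simps diff_divide_distrib)
    finally show ?thesis .
  qed
  moreover have "(\<lambda>m. LINT x|torus_measure. q m x) \<longlonglongrightarrow> (LINT x|torus_measure. of_real (iter_partial [i] f x) * echar (- k) x)"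
  proof (rule integral_dominated_convergence[where w = "\<lambda>_. B"])
    show "(\<lambda>x. complex_of_real (iter_partial [i] f x) * echar (- k) x) \<in> borel_measurable torus_measure"
      by (intro borel_measurable_integrable integrable_torus_measure continuous_intros continuous_on_of_real
          test_functions_continuous[OF test_functions_iter_partial[OF f]])
    show "AE x in torus_measure. (\<lambda>m. q m x) \<longlonglongrightarrow> of_real (iter_partial [i] f x) * echar (- k) x"
    proof (intro AE_I2)
      fix x
      have "((\<lambda>s. (f (x + s *\<^sub>R ?e) - f x) / s) \<longlongrightarrow> iter_partial [i] f x) (at 0)"
        using D[of x 0] by (simp add: has_field_derivative_iff)
      then have "(\<lambda>m. (f (x + t m *\<^sub>R ?e) - f x) / t m) \<longlonglongrightarrow> iter_partial [i] f x"
        using tlim' by (rule filterlim_compose)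
      then have "(\<lambda>m. complex_of_real ((f (x + t m *\<^sub>R ?e) - f x) / t m) * echar (- k) x) \<longlonglongrightarrow> of_real (iter_partial [i] f x) * echar (- k) x"
        by (intro tendsto_intros)
      then show "(\<lambda>m. q m x) \<longlonglongrightarrow> of_real (iter_partial [i] f x) * echar (- k) x"
        by (simp add: q_def)
    qed
    show "AE x in torus_measure. norm (q m x) \<le> B" for m
    proof (intro AE_I2)
      fix x
      obtain s where "f (x + t m *\<^sub>R ?e) - f (x + 0 *\<^sub>R ?e) = (t m - 0) * iter_partial [i] f (x + s *\<^sub>R ?e)"
        using MVT2[of 0 "t m" "\<lambda>s. f (x + s *\<^sub>R ?e)" "\<lambda>s. iter_partial [i] f (x + s *\<^sub>R ?e)"] D t by blast
      then have "(f (x + t m *\<^sub>R ?e) - f x) / t m = iter_partial [i] f (x + s *\<^sub>R ?e)"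
        using t[of m] by (simp add: field_simps)
      then have "\<bar>(f (x + t m *\<^sub>R ?e) - f x) / t m\<bar> \<le> B" using B by simp
      moreover have "norm (q m x) = \<bar>(f (x + t m *\<^sub>R ?e) - f x) / t m\<bar>"
        by (simp add: q_def norm_mult norm_divide flip: of_real_diff)
      ultimately show "norm (q m x) \<le> B" by simp
    qed
  qed auto
  ultimately have l1: "(\<lambda>m. (echar k (t m *\<^sub>R ?e) - 1) / of_real (t m) * tcoeff ?F k) \<longlonglongrightarrow> tcoeff (\<lambda>x. of_real (iter_partial [i] f x)) k"
    by (simp add: tcoeff_def)
  have "((\<lambda>z. exp (2 * pi * \<i> * (k $ i) * z)) has_field_derivative 2 * pi * \<i> * (k $ i)) (at 0)"
    by (auto intro!: derivative_eq_intros)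
  then have "((\<lambda>z. (exp (2 * pi * \<i> * (k $ i) * z) - 1) / z) \<longlongrightarrow> 2 * pi * \<i> * (k $ i)) (at 0)"
    by (simp add: has_field_derivative_iff)
  moreover have "filterlim (\<lambda>m. complex_of_real (t m)) (at 0) sequentially"
    using t(1) tendsto_of_real[OF tlim, where 'a = complex] by (auto simp: filterlim_at less_le)
  ultimately have "(\<lambda>m. (exp (2 * pi * \<i> * (k $ i) * of_real (t m)) - 1) / of_real (t m)) \<longlonglongrightarrow> 2 * pi * \<i> * (k $ i)"
    by (rule filterlim_compose)
  then have "(\<lambda>m. (exp (2 * pi * \<i> * (k $ i) * of_real (t m)) - 1) / of_real (t m) * tcoeff ?F k) \<longlonglongrightarrow> 2 * pi * \<i> * (k $ i) * tcoeff ?F k"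
    by (intro tendsto_intros)
  moreover have "exp (2 * pi * \<i> * (k $ i) * of_real (t m)) = echar k (t m *\<^sub>R ?e)" for m
    by (simp add: echar_def inner_axis cis_conv_exp mult_ac)
  ultimately show ?thesis
    using l1 LIMSEQ_unique by auto
qed

lemma tcoeff_iter_partial:
  assumes f: "f \<in> test_functions" and k: "k \<in> int_lattice"
  shows "tcoeff (\<lambda>x. of_real (iter_partial (replicate p i) f x)) k = (2 * pi * \<i> * (k $ i)) ^ p * tcoeff (\<lambda>x. of_real (f x)) k"
proof (induction p)
  case (Suc p)
  then show ?case
    using tcoeff_partial[OF test_functions_iter_partial[OF f, of "replicate p i"] k, of i] by simp
qed simp

text \<open>Each derivative in direction \<open>i\<close> multiplies the coefficient by a constant
  times \<open>k $ i\<close>, while the coefficient of the derivative stays below its supremum.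
  Adding the bounds over the directions gives one constant for all \<open>i\<close>.\<close>

lemma tcoeff_decay:
  assumes f: "f \<in> test_functions"
  shows "\<exists>C. \<forall>k\<in>int_lattice. \<forall>i. \<bar>k $ i\<bar> ^ p * norm (tcoeff (\<lambda>x. of_real (f x)) k) \<le> C"
proof -
  have "\<exists>B\<ge>0. \<forall>x. \<bar>iter_partial (replicate p i) f x\<bar> \<le> B" for i
    using test_functions_bounded[OF test_functions_iter_partial[OF f]] by metis
  then obtain B where B0: "\<And>i. B i \<ge> 0" and B: "\<And>i x. \<bar>iter_partial (replicate p i) f x\<bar> \<le> B i"
    by metis
  have "\<bar>k $ i\<bar> ^ p * norm (tcoeff (\<lambda>x. of_real (f x)) k) \<le> sum B UNIV" if k: "k \<in> int_lattice" for k i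
  proof -
    have "\<bar>k $ i\<bar> ^ p \<le> (2 * pi * \<bar>k $ i\<bar>) ^ p"
      using pi_ge_two mult_right_mono[of 1 "2 * pi" "\<bar>k $ i\<bar>"] by (intro power_mono) auto
    then have "\<bar>k $ i\<bar> ^ p * norm (tcoeff (\<lambda>x. of_real (f x)) k) \<le> (2 * pi * \<bar>k $ i\<bar>) ^ p * norm (tcoeff (\<lambda>x. of_real (f x)) k)"
      by (rule mult_right_mono) simp
    also have "\<dots> = norm (tcoeff (\<lambda>x. of_real (iter_partial (replicate p i) f x)) k)"
      unfolding tcoeff_iter_partial[OF f k] by (simp add: norm_mult norm_power abs_mult)
    also have "\<dots> \<le> B i"
      by (rule norm_tcoeff_le)
        (auto intro!: B continuous_on_of_real test_functions_continuous[OF test_functions_iter_partial[OF f]])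
    also have "\<dots> \<le> sum B UNIV" using B0 by (intro member_le_sum) auto
    finally show ?thesis .
  qed
  then show ?thesis by blast
qed

lemma summable_tcoeff:
  assumes "f \<in> test_functions"
  shows "(\<lambda>k. norm k ^ M * norm (tcoeff (\<lambda>x. of_real (f x)) k)) summable_on int_lattice"
  by (rule summable_lattice_decay) (rule tcoeff_decay[OF assms])


section \<open>Uniqueness and inversion for Fourier series\<close>

text \<open>Trigonometric polynomials, generated inductively so that closure under products is an
  induction on both factors. This is how powers of a peak function remain orthogonal to a function
  without coefficients.\<close>

inductive_set trig_span :: "(real ^ 'n::finite \<Rightarrow> complex) set" where
  char: "k \<in> int_lattice \<Longrightarrow> (\<lambda>x. c * echar k x) \<in> trig_span"
| add: "F \<in> trig_span \<Longrightarrow> G \<in> trig_span \<Longrightarrow> (\<lambda>x. F x + G x) \<in> trig_span"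

lemma trig_span_const: "(\<lambda>_. c) \<in> trig_span"
  using trig_span.char[of 0 c] by simp

lemma trig_span_mult:
  assumes "F \<in> trig_span" "G \<in> trig_span"
  shows "(\<lambda>x. F x * G x) \<in> trig_span"
  using assms
proof (induction arbitrary: G)
  case (char k c)
  from char(2,1) show ?case
  proof induction
    case (char l d)
    then show ?case
      using trig_span.char[of "k + l" "c * d"] by (simp add: int_lattice_add echar_add mult_ac)
  next
    case (add F G)
    then show ?case
      using trig_span.add[OF add.IH] by (simp add: algebra_simps)
  qed
next
  case (add F1 F2)
  then show ?case
    using trig_span.add[OF add.IH(1)[OF add.prems] add.IH(2)[OF add.prems]] by (simp add: distrib_right)
qed

lemma trig_span_prod:
  "finite I \<Longrightarrow> (\<And>i. i \<in> I \<Longrightarrow> F i \<in> trig_span) \<Longrightarrow> (\<lambda>x. \<Prod>i\<in>I. F i x) \<in> trig_span"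
  by (induction rule: finite_induct) (auto intro: trig_span_const trig_span_mult)

lemma trig_span_power: "F \<in> trig_span \<Longrightarrow> (\<lambda>x. F x ^ n) \<in> trig_span"
  by (induction n) (auto intro: trig_span_const trig_span_mult)

lemma trig_span_cos: "(\<lambda>x. of_real ((1 + cos (2 * pi * (x $ i - a))) / 2)) \<in> trig_span"
proof -
  have "complex_of_real ((1 + cos (2 * pi * (x $ i - a))) / 2) =
      1 / 2 + (cis (- 2 * pi * a) / 4 * echar (axis i 1) x + cis (2 * pi * a) / 4 * echar (- axis i 1) x)" for x
    by (simp add: echar_def inner_axis' cis_mult complex_eq_iff algebra_simps cos_diff sin_diff diff_divide_distrib)
  then show ?thesis
    by (simp only:) (intro trig_span.intros trig_span_const; simp)
qed

lemma trig_span_continuous: "F \<in> trig_span \<Longrightarrow> continuous_on S F"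
  by (induction rule: trig_span.induct) (auto intro!: continuous_intros)

lemma trig_span_integral_eq_0:
  assumes "F \<in> trig_span" "continuous_on UNIV G" "\<And>k. k \<in> int_lattice \<Longrightarrow> tcoeff G k = 0"
  shows "(LINT x|torus_measure. G x * F x) = 0"
  using assms(1)
proof induction
  case (char k c)
  have "(LINT x|torus_measure. G x * (c * echar k x)) = c * tcoeff G (- k)"
    unfolding tcoeff_def by (subst integral_mult_right_zero[symmetric]) (simp add: mult_ac)
  then show ?case using assms(3) char by simp
next
  case (add F1 F2)
  then show ?case
    by (simp add: distrib_left Bochner_Integration.integral_add integrable_torus_measure
        continuous_on_mult[OF assms(2)] trig_span_continuous)
qed

text \<open>Rudin's argument: powers of a nonnegative trigonometric polynomial with a unique peak at
  \<open>x0\<close> would detect a nonzero value of \<open>G\<close> there.\<close>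

lemma tcoeff_eq_0_imp_zero_on_box:
  fixes G :: "real ^ 'n::finite \<Rightarrow> complex"
  assumes cont: "continuous_on UNIV G" and G: "\<And>k. k \<in> int_lattice \<Longrightarrow> tcoeff G k = 0"
    and x0: "x0 \<in> box 0 1"
  shows "G x0 = 0"
proof (rule ccontr)
  assume nz: "G x0 \<noteq> 0"
  define r where "r x = Re (cnj (G x0) * G x)" for x
  have rc: "continuous_on S r" for S
    unfolding r_def by (intro continuous_intros continuous_on_subset[OF cont]) auto
  have r0: "r x0 > 0"
    using nz by (simp add: r_def complex_eq_iff sum_squares_gt_zero_iff)
  define \<epsilon> where "\<epsilon> = r x0 / 2"
  have "open (box 0 1 \<inter> {x. \<epsilon> < r x})"
    by (intro open_Int open_box open_Collect_less rc continuous_on_const)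
  moreover have "x0 \<in> box 0 1 \<inter> {x. \<epsilon> < r x}"
    using x0 r0 by (simp add: \<epsilon>_def)
  ultimately obtain \<delta> where \<delta>: "\<delta> > 0" "ball x0 \<delta> \<subseteq> box 0 1 \<inter> {x. \<epsilon> < r x}"
    using open_contains_ball by metis
  \<comment> \<open>Each factor lies between 0 and 1 and equals 1 only if the coordinates differ by
    an integer. As \<open>x0\<close> is interior, the difference is below 1 in modulus on the closed
    cube, so the peak there is unique.\<close>
  define T where "T x = (\<Prod>i\<in>UNIV. (1 + cos (2 * pi * (x $ i - x0 $ i))) / 2)" for x :: "real ^ 'n"
  have Tc: "continuous_on S T" for S
    unfolding T_def by (intro continuous_intros) auto
  have f01: "0 \<le> (1 + cos t) / 2 \<and> (1 + cos t) / 2 \<le> 1" for t :: real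
  proof -
    have "0 \<le> 1 + cos t" using cos_ge_minus_one[of t] by linarith
    then show ?thesis using cos_le_one[of t] by simp
  qed
  have T0: "0 \<le> T x" for x
    unfolding T_def using f01 by (intro prod_nonneg) auto
  have T1: "T x \<le> 1" for x
    unfolding T_def using f01 by (intro prod_le_1) auto
  have T_lt: "T x < 1" if "x \<in> cbox 0 1" "x \<noteq> x0" for x
  proof -
    obtain i where i: "x $ i \<noteq> x0 $ i" using \<open>x \<noteq> x0\<close> by (auto simp: vec_eq_iff)
    have lt: "\<bar>x $ i - x0 $ i\<bar> < 1"
    proof -
      have "0 \<le> x $ i \<and> x $ i \<le> 1 \<and> 0 < x0 $ i \<and> x0 $ i < 1"
        using that(1) x0 by (simp add: mem_box_cart)
      then show ?thesis by linarith
    qed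
    have "cos (2 * pi * (x $ i - x0 $ i)) \<noteq> 1"
    proof
      assume "cos (2 * pi * (x $ i - x0 $ i)) = 1"
      then obtain n :: int where n: "x $ i - x0 $ i = of_int n"
        by (auto simp: cos_one_2pi_int)
      then have "of_int \<bar>n\<bar> < (of_int 1 :: real)" using lt by simp
      then have "n = 0" unfolding of_int_less_iff by simp
      then show False using i n by simp
    qed
    then have lt1: "(1 + cos (2 * pi * (x $ i - x0 $ i))) / 2 < 1"
      using cos_le_one[of "2 * pi * (x $ i - x0 $ i)"] by (simp add: less_le)
    have "T x = (1 + cos (2 * pi * (x $ i - x0 $ i))) / 2 * (\<Prod>i\<in>UNIV-{i}. (1 + cos (2 * pi * (x $ i - x0 $ i))) / 2)"
      unfolding T_def by (subst prod.remove[of _ i]) auto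
    also have "\<dots> \<le> (1 + cos (2 * pi * (x $ i - x0 $ i))) / 2 * 1"
      using f01 by (intro mult_left_mono prod_le_1) blast+
    finally show ?thesis
      using lt1 by simp
  qed
  have "\<exists>q<1. 0 \<le> q \<and> (\<forall>x\<in>cbox 0 1 - ball x0 \<delta>. T x \<le> q)"
  proof (cases "cbox 0 1 - ball x0 \<delta> = {}")
    case False
    have "compact (cbox 0 1 - ball x0 \<delta>)" by (intro compact_diff) auto
    then obtain y where y: "y \<in> cbox 0 1 - ball x0 \<delta>" "\<forall>x\<in>cbox 0 1 - ball x0 \<delta>. T x \<le> T y"
      using continuous_attains_sup[OF _ False Tc] by blast
    moreover have "y \<noteq> x0" using y(1) \<delta>(1) by auto
    ultimately show ?thesis using T_lt[of y] T0[of y] by (intro exI[of _ "T y"]) auto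
  qed (auto intro: exI[of _ 0])
  then obtain q where q: "q < 1" "0 \<le> q" "\<And>x. x \<in> cbox 0 1 - ball x0 \<delta> \<Longrightarrow> T x \<le> q" by blast
  \<comment> \<open>\<open>T\<close> exceeds \<open>q'\<close> near the peak and stays below
    \<open>q < q'\<close> far from it, so the two contributions separate at the geometric rate
    \<open>q / q'\<close>.\<close>
  define q' where "q' = (1 + q) / 2"
  have q': "q < q'" "q' < 1" "0 < q'" using q by (auto simp: q'_def)
  have "open (ball x0 \<delta> \<inter> {x. q' < T x})"
    by (intro open_Int open_ball open_Collect_less Tc continuous_on_const)
  moreover have "x0 \<in> ball x0 \<delta> \<inter> {x. q' < T x}"
    using \<delta> q' by (simp add: T_def)
  ultimately obtain \<delta>' where \<delta>': "\<delta>' > 0" "ball x0 \<delta>' \<subseteq> ball x0 \<delta> \<inter> {x. q' < T x}"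
    using open_contains_ball by metis
  define V where "V = ball x0 \<delta>'"
  have V_sub: "V \<subseteq> box 0 1" using \<delta> \<delta>' by (auto simp: V_def)
  then have V_cube: "V \<subseteq> cbox 0 1"
    using box_subset_cbox[of 0 "1 :: real ^ 'n"] by blast
  have V_sets [measurable]: "V \<in> sets torus_measure"
    using V_sub box_subset_cbox[of 0 "1 :: real ^ 'n"]
    unfolding torus_measure_def by (subst sets_restrict_space_iff) (auto simp: V_def)
  have "emeasure torus_measure V = emeasure lborel V"
    using V_sub box_subset_cbox[of 0 "1 :: real ^ 'n"]
    unfolding torus_measure_def by (subst emeasure_restrict_space) (auto simp: V_def)
  moreover have "emeasure lborel V \<noteq> 0"
  proof
    assume "emeasure lborel V = 0"
    then have "V \<in> null_sets lborel" by (auto simp: V_def intro!: null_setsI)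
    then have "negligible V" by (simp add: negligible_iff_null_sets null_sets_completionI)
    then show False using \<delta>' open_not_negligible[of V] by (auto simp: V_def)
  qed
  ultimately have mV: "measure torus_measure V > 0"
    by (metis torus.emeasure_eq_measure ennreal_0 measure_nonneg less_le)
  obtain B where B: "\<And>x. x \<in> cbox 0 1 \<Longrightarrow> \<bar>r x\<bar> \<le> B" 
    using compact_imp_bounded[OF compact_continuous_image[OF rc compact_cbox[of 0 1]]]
    by (auto simp: bounded_iff)
  have "x0 \<in> cbox 0 1" using x0 box_subset_cbox by blast
  then have B0: "B \<ge> 0" using B[of x0] by linarith
  have int0: "(LINT x|torus_measure. r x * T x ^ N) = 0" for N
  proof -
    have "(\<lambda>x. complex_of_real (T x)) \<in> trig_span"
      unfolding T_def of_real_prod by (intro trig_span_prod trig_span_cos) auto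
    then have "(\<lambda>x. complex_of_real (T x ^ N)) \<in> trig_span"
      using trig_span_power by (simp add: of_real_power)
    then have 0: "(LINT x|torus_measure. G x * of_real (T x ^ N)) = 0"
      by (rule trig_span_integral_eq_0[OF _ cont G])
    have "integrable torus_measure (\<lambda>x. cnj (G x0) * (G x * of_real (T x ^ N)))"
      by (intro integrable_torus_measure continuous_intros continuous_on_of_real Tc cont)
    then have "(LINT x|torus_measure. Re (cnj (G x0) * (G x * of_real (T x ^ N)))) = Re (LINT x|torus_measure. cnj (G x0) * (G x * of_real (T x ^ N)))"
      by (rule integral_Re)
    also have "\<dots> = 0"
      unfolding integral_mult_right_zero 0 by simp
    also have "(\<lambda>x. Re (cnj (G x0) * (G x * of_real (T x ^ N)))) = (\<lambda>x. r x * T x ^ N)"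
      by (simp add: fun_eq_iff r_def algebra_simps del: of_real_power)
    finally show ?thesis .
  qed
  \<comment> \<open>On \<open>V\<close> the integrand is large, on the rest of the ball it is
    nonnegative, and outside the ball it is at least \<open>- B * q ^ N\<close>. The whole integral
    vanishes, so the first part cannot exceed the last.\<close>
  have key: "\<epsilon> * q' ^ N * measure torus_measure V \<le> B * q ^ N" for N
  proof -
    have "\<epsilon> * q' ^ N * indicator V x \<le> r x * T x ^ N + B * q ^ N" if x: "x \<in> cbox 0 1" for x
    proof (cases "x \<in> ball x0 \<delta>")
      case True
      then have rx: "\<epsilon> < r x" using \<delta> by blast
      have e: "\<epsilon> > 0" using r0 by (simp add: \<epsilon>_def)
      show ?thesis
      proof (cases "x \<in> V")
        case True
        then have "q' < T x" using \<delta>' by (auto simp: V_def)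
        then have "\<epsilon> * q' ^ N \<le> r x * T x ^ N"
          using rx e q' by (intro mult_mono power_mono) auto
        then show ?thesis using True B0 q by (simp add: add_increasing2)
      qed (use rx e T0 B0 q in auto)
    next
      case False
      then have "x \<notin> V" using \<delta>' by (auto simp: V_def)
      moreover have "\<bar>r x * T x ^ N\<bar> \<le> B * q ^ N"
        using B[OF x] q(3)[of x] False x T0[of x] B0 unfolding abs_mult power_abs
        by (intro mult_mono power_mono) auto
      ultimately show ?thesis by auto
    qed
    moreover have "integrable torus_measure (\<lambda>x. \<epsilon> * q' ^ N * indicator V x)"
      by (intro integrable_mult_right integrable_real_indicator V_sets) (simp add: torus.emeasure_eq_measure)
    moreover have "integrable torus_measure (\<lambda>x. r x * T x ^ N + B * q ^ N)"
      by (intro integrable_torus_measure continuous_intros rc Tc)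
    ultimately have "(LINT x|torus_measure. \<epsilon> * q' ^ N * indicator V x) \<le> (LINT x|torus_measure. r x * T x ^ N + B * q ^ N)"
      by (intro integral_mono) auto
    also have "(LINT x|torus_measure. \<epsilon> * q' ^ N * indicator V x) = \<epsilon> * q' ^ N * measure torus_measure V"
      using V_cube by (simp add: Int_absorb2)
    also have "(LINT x|(torus_measure :: (real ^ 'n) measure). r x * T x ^ N + B * q ^ N) = B * q ^ N"
      using int0[of N] by (subst Bochner_Integration.integral_add)
        (auto intro!: integrable_torus_measure continuous_intros rc Tc)
    finally show ?thesis .
  qed
  have "(\<lambda>N. B * (q / q') ^ N) \<longlonglongrightarrow> B * 0"
    using q q' by (intro tendsto_intros LIMSEQ_realpow_zero) auto
  moreover have "\<epsilon> * measure torus_measure V \<le> B * (q / q') ^ N" for N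
    using key[of N] q' by (simp add: power_divide field_simps)
  ultimately have "\<epsilon> * measure torus_measure V \<le> B * 0"
    by (intro LIMSEQ_le_const) auto
  then show False using mV r0 by (simp add: \<epsilon>_def mult_le_0_iff)
qed

text \<open>On the faces of the closed cube the peak function would attain its maximum at several
  points, so these values are reached by continuity from the open cube.\<close>

lemma tcoeff_eq_0_imp_zero:
  fixes G :: "real ^ 'n::finite \<Rightarrow> complex"
  assumes cont: "continuous_on UNIV G" and G: "\<And>k. k \<in> int_lattice \<Longrightarrow> tcoeff G k = 0"
    and per: "\<And>x k. k \<in> int_lattice \<Longrightarrow> G (x + k) = G x"
  shows "G x = 0"
proof -
  obtain k where k: "k \<in> int_lattice" "x - k \<in> half_open_cube" by (rule unit_cube_representative)
  have "box 0 (1 :: real ^ 'n) \<noteq> {}"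
    by (auto simp: box_ne_empty inner_one_Basis)
  then have "x - k \<in> closure (box 0 1)"
    using k half_open_cube_subset closure_box by blast
  then have "G (x - k) = 0"
    using continuous_constant_on_closure[OF continuous_on_subset[OF cont]] tcoeff_eq_0_imp_zero_on_box[OF cont G] by blast
  then show ?thesis using per[of k "x - k"] k by simp
qed

text \<open>The trigonometric functions are themselves test functions, so a distribution determines
  the coefficients, which in turn determine the continuous periodic function.\<close>

lemma distr_of_inj: "inj_on distr_of (test_functions :: (real ^ 'n::finite \<Rightarrow> real) set)"
proof
  fix f g :: "real ^ 'n \<Rightarrow> real"
  assume f: "f \<in> test_functions" and g: "g \<in> test_functions" and eq: "distr_of f = distr_of g"
  note c = continuous_on_of_real[OF test_functions_continuous]
  have "complex_of_real (f x) - of_real (g x) = 0" for x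
  proof (rule tcoeff_eq_0_imp_zero[of "\<lambda>x. complex_of_real (f x) - of_real (g x)"])
    fix k :: "real ^ 'n" assume k: "k \<in> int_lattice"
    show "tcoeff (\<lambda>x. complex_of_real (f x) - of_real (g x)) k = 0"
      using fourier_coeff_distr_of[OF f k] fourier_coeff_distr_of[OF g k] eq
      unfolding tcoeff_def left_diff_distrib
      by (subst Bochner_Integration.integral_diff)
        (auto intro!: integrable_torus_measure continuous_intros c f g)
  qed (use f g in \<open>auto intro!: continuous_intros c simp: test_functions_periodic\<close>)
  then show "f = g" by (auto simp: fun_eq_iff simp flip: of_real_diff)
qed

text \<open>The coefficients are absolutely summable, so the series converges uniformly to a
  continuous function with the same coefficients as \<open>f\<close>; uniqueness identifies the
  two.\<close>

lemma fourier_inversion: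
  assumes f: "f \<in> test_functions"
  defines "c \<equiv> tcoeff (\<lambda>x. of_real (f x))"
  shows "of_real (f x) = (\<Sum>\<^sub>\<infinity>k\<in>int_lattice. c k * echar k x)"
proof -
  note fc = continuous_on_of_real[OF test_functions_continuous[OF f]]
  have sm: "(\<lambda>k. norm (c k)) summable_on int_lattice"
    using summable_tcoeff[OF f, of 0] by (simp add: c_def)
  define S where "S x = (\<Sum>\<^sub>\<infinity>k\<in>int_lattice. c k * echar k x)" for x
  have ul: "uniform_limit UNIV (\<lambda>A x. \<Sum>k\<in>A. c k * echar k x) S (finite_subsets_at_top int_lattice)"
    unfolding S_def by (rule Weierstrass_m_test_general[OF _ sm]) (simp add: norm_mult)
  have Sc: "continuous_on UNIV S"
    by (rule uniform_limit_theorem[OF _ ul]) (auto intro!: always_eventually continuous_intros)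
  have coeff: "tcoeff S l = c l" if l: "l \<in> int_lattice" for l
  proof -
    have "norm (tcoeff S l - c l) \<le> 0"
    proof (rule field_le_epsilon)
      fix e :: real assume e: "e > 0"
      obtain X where X: "finite X" "X \<subseteq> int_lattice"
        "\<forall>A. finite A \<and> X \<subseteq> A \<and> A \<subseteq> int_lattice \<longrightarrow> (\<forall>x\<in>UNIV. dist (\<Sum>k\<in>A. c k * echar k x) (S x) < e)"
        using uniform_limitD[OF ul e] unfolding eventually_finite_subsets_at_top
        by (elim exE conjE) (rule that, assumption+)
      \<comment> \<open>The partial sum has to contain the index \<open>l\<close>, so that its
        coefficient there is exactly \<open>c l\<close> and only the uniformly small remainder is
        left.\<close>
      define A where "A = insert l X"
      have A: "finite A" "l \<in> A" "A \<subseteq> int_lattice" using X l by (auto simp: A_def)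
      have d: "dist (\<Sum>k\<in>A. c k * echar k x) (S x) < e" for x
        using A X(3) by (auto simp: A_def)
      have "tcoeff (\<lambda>x. \<Sum>k\<in>A. c k * echar k x) l = c l"
        using A l by (simp add: tcoeff_trig_poly)
      then have "tcoeff S l - c l = tcoeff (\<lambda>x. S x - (\<Sum>k\<in>A. c k * echar k x)) l"
        unfolding tcoeff_def left_diff_distrib
        by (subst Bochner_Integration.integral_diff) (auto intro!: integrable_torus_measure continuous_intros Sc)
      also have "norm \<dots> \<le> e"
        by (rule norm_tcoeff_le) (use d in \<open>auto intro!: continuous_intros Sc simp: dist_norm norm_minus_commute less_imp_le\<close>)
      finally show "norm (tcoeff S l - c l) \<le> 0 + e" by simp
    qed
    then show ?thesis by simp
  qed
  have "of_real (f x) - S x = 0"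
  proof (rule tcoeff_eq_0_imp_zero[of "\<lambda>x. of_real (f x) - S x"])
    fix k :: "real ^ 'a" assume k: "k \<in> int_lattice"
    show "tcoeff (\<lambda>x. of_real (f x) - S x) k = 0"
      using coeff[OF k] unfolding tcoeff_def left_diff_distrib c_def
      by (subst Bochner_Integration.integral_diff) (auto intro!: integrable_torus_measure continuous_intros Sc fc)
  next
    fix x k :: "real ^ 'a" assume k: "k \<in> int_lattice"
    have "S (x + k) = S x" unfolding S_def by (intro infsum_cong) (simp add: echar_periodic k)
    then show "of_real (f (x + k)) - S (x + k) = of_real (f x) - S x"
      using test_functions_periodic[OF f k] by simp
  qed (auto intro!: continuous_intros Sc fc)
  then show ?thesis by (simp add: S_def)
qed


section \<open>Multipliers that are constant on an open set\<close>

lemma has_sum_diff_fun: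
  fixes f g :: "'a \<Rightarrow> 'b::topological_ab_group_add"
  assumes "(f has_sum a) A" "(g has_sum b) A"
  shows "((\<lambda>x. f x - g x) has_sum (a - b)) A"
  using has_sum_add[OF assms(1), of "\<lambda>x. - g x" "- b"] assms(2) by (simp add: has_sum_uminus)

lemma has_sum_sum_fun:
  fixes f :: "'i \<Rightarrow> 'a \<Rightarrow> 'b::topological_comm_monoid_add"
  assumes "finite I" "\<And>i. i \<in> I \<Longrightarrow> (f i has_sum a i) A"
  shows "((\<lambda>x. \<Sum>i\<in>I. f i x) has_sum (\<Sum>i\<in>I. a i)) A"
  using assms by (induction rule: finite_induct) (auto intro!: has_sum_add has_sum_0)

lemma norm_has_sum_le:
  fixes f :: "'a \<Rightarrow> 'b::real_normed_vector"
  assumes f: "(f has_sum a) A" and g: "(g has_sum b) A" and le: "\<And>x. x \<in> A \<Longrightarrow> norm (f x) \<le> g x"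
  shows "norm a \<le> b"
proof -
  have "(\<lambda>x. norm (f x)) summable_on A"
    by (rule summable_on_comparison_test[OF has_sum_imp_summable[OF g]]) (use le in auto)
  then have "((\<lambda>x. norm (f x)) has_sum (\<Sum>\<^sub>\<infinity>x\<in>A. norm (f x))) A" by simp
  moreover from this have "(\<Sum>\<^sub>\<infinity>x\<in>A. norm (f x)) \<le> b"
    using g le by (rule has_sum_mono)
  ultimately show ?thesis
    using norm_has_sum_bound[OF _ f] by fastforce
qed

text \<open>The nearest lattice point. Composing a function of small support with
  \<open>x - round_vec x\<close> periodizes it without a sum over translates.\<close>

definition round_vec :: "real ^ 'n::finite \<Rightarrow> real ^ 'n" where
  "round_vec x = (\<chi> i. of_int (round (x $ i)))"

lemma round_vec_in_int_lattice: "round_vec x \<in> int_lattice"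
  by (simp add: round_vec_def int_lattice_def)

lemma round_vec_eq:
  assumes "k \<in> int_lattice" "norm (x - k) < 1 / 2"
  shows "round_vec x = k"
proof -
  have "of_int (round (x $ i)) = k $ i" for i
  proof -
    obtain n where n: "k $ i = of_int n" using assms(1) by (auto simp: int_lattice_def elim: Ints_cases)
    have "\<bar>x $ i - k $ i\<bar> < 1 / 2"
      using component_le_norm_cart[of "x - k" i] assms(2) by simp
    then have "\<bar>x $ i - of_int n\<bar> < 1 / 2" by (simp add: n)
    then have "round (x $ i) = n" by (intro round_unique) linarith+
    then show ?thesis by (simp add: n)
  qed
  then show ?thesis by (simp add: round_vec_def vec_eq_iff)
qed

lemma round_vec_add_int_lattice:
  assumes "k \<in> int_lattice"
  shows "round_vec (x + k) = round_vec x + k"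
proof -
  have "round (x $ i + k $ i) = round (x $ i) + \<lfloor>k $ i\<rfloor>" "of_int \<lfloor>k $ i\<rfloor> = k $ i" for i
  proof -
    obtain n where n: "k $ i = of_int n" using assms by (auto simp: int_lattice_def elim: Ints_cases)
    show "round (x $ i + k $ i) = round (x $ i) + \<lfloor>k $ i\<rfloor>"
      unfolding n round_def by (simp add: add.commute add.left_commute flip: floor_add_int)
    show "of_int \<lfloor>k $ i\<rfloor> = k $ i" by (simp add: n)
  qed
  then show ?thesis by (simp add: round_vec_def vec_eq_iff)
qed

text \<open>After scaling by \<open>P > 4 * R\<close> the support lies within distance 1/4 of the
  lattice. Closer than 1/2 to a lattice point rounding is constant; at any other point the ball of
  radius 1/4 misses the support.\<close>

lemma periodization_test_function:
  assumes \<Phi>: "smooth \<Phi>" and supp: "\<And>x. \<Phi> x \<noteq> 0 \<Longrightarrow> norm x \<le> R" and P: "P > 4 * R" "P > 0"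
  shows "(\<lambda>x. \<Phi> (P *\<^sub>R (x - round_vec x))) \<in> test_functions"
proof -
  have "smooth (\<lambda>x. \<Phi> (P *\<^sub>R (x - round_vec x)))"
  proof (rule smooth_locally)
    fix x0 :: "real ^ 'a"
    show "\<exists>S g. open S \<and> x0 \<in> S \<and> smooth g \<and> (\<forall>y\<in>S. \<Phi> (P *\<^sub>R (y - round_vec y)) = g y)"
    proof (cases "\<exists>k\<in>int_lattice. norm (x0 - k) < 1 / 2")
      case True
      then obtain k where k: "k \<in> int_lattice" "norm (x0 - k) < 1 / 2" by blast
      have "\<Phi> (P *\<^sub>R (y - round_vec y)) = \<Phi> (P *\<^sub>R y + - P *\<^sub>R k)" if "y \<in> ball k (1/2)" for y
        using that round_vec_eq[OF k(1), of y]
        by (simp add: dist_norm norm_minus_commute algebra_simps)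
      then show ?thesis
        using k smooth_affine[OF \<Phi>, of P "- P *\<^sub>R k"]
        by (intro exI[of _ "ball k (1/2)"] exI[of _ "\<lambda>y. \<Phi> (P *\<^sub>R y + - P *\<^sub>R k)"])
          (auto simp: dist_norm norm_minus_commute)
    next
      case False
      have "\<Phi> (P *\<^sub>R (y - round_vec y)) = 0" if "y \<in> ball x0 (1/4)" for y
      proof (rule ccontr)
        assume "\<Phi> (P *\<^sub>R (y - round_vec y)) \<noteq> 0"
        then have "P * norm (y - round_vec y) \<le> R" using supp P by fastforce
        moreover have "R < P * (1 / 4)" using P by simp
        ultimately have "P * norm (y - round_vec y) < P * (1 / 4)" by linarith
        then have "norm (y - round_vec y) < 1 / 4" using P mult_less_cancel_left_pos by blast
        moreover have "norm (x0 - y) < 1 / 4" using that by (simp add: dist_norm)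
        ultimately have "norm (x0 - round_vec y) < 1 / 2"
          using norm_triangle_ineq[of "x0 - y" "y - round_vec y"] by simp
        then show False using False round_vec_in_int_lattice by blast
      qed
      then show ?thesis
        using smooth_0 by (intro exI[of _ "ball x0 (1/4)"] exI[of _ "\<lambda>_. 0"]) auto
    qed
  qed
  then show ?thesis
    by (simp add: test_functions_def torus_periodic_def round_vec_add_int_lattice)
qed

section \<open>Vanishing moments and the expansion with separated variables\<close>

lemma cis_Taylor:
  "norm (cis y - (\<Sum>a\<le>m. (\<i> * of_real y) ^ a / fact a)) \<le> \<bar>y\<bar> ^ Suc m"
proof -
  have "norm (cis y - (\<Sum>a\<le>m. (\<i> * of_real y) ^ a / fact a)) \<le> \<bar>y\<bar> ^ Suc m / fact m"
    using Taylor_exp[of "\<i> * of_real y" m] by (simp add: cis_conv_exp norm_mult)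
  also have "\<dots> \<le> \<bar>y\<bar> ^ Suc m"
    using divide_left_mono[of 1 "fact m :: real" "\<bar>y\<bar> ^ Suc m"] fact_ge_1[of m, where 'a = real] by simp
  finally show ?thesis .
qed

text \<open>On an interval of constancy the first-order Taylor error, which is quadratic in the step, forces the
  next moment to vanish.\<close>

lemma trig_series_moments:
  fixes C :: "'i \<Rightarrow> complex" and freq :: "'i \<Rightarrow> real"
  assumes sm: "\<And>a. (\<lambda>n. norm (C n) * \<bar>freq n\<bar> ^ a) summable_on A"
    and const: "\<And>t. \<bar>t\<bar> < \<delta> \<Longrightarrow> ((\<lambda>n. C n * cis (t * freq n)) has_sum c) A"
    and t: "\<bar>t\<bar> < \<delta>"
  shows "((\<lambda>n. C n * (\<i> * of_real (freq n)) ^ a * cis (t * freq n)) has_sum (if a = 0 then c else 0)) A"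
  using t
proof (induction a arbitrary: t)
  case 0
  then show ?case using const by simp
next
  case (Suc a)
  define F where "F = (\<Sum>\<^sub>\<infinity>n\<in>A. C n * (\<i> * of_real (freq n)) ^ Suc a * cis (t * freq n))"
  have "(\<lambda>n. C n * (\<i> * of_real (freq n)) ^ Suc a * cis (t * freq n)) summable_on A"
    by (rule abs_summable_summable) (use sm[of "Suc a"] in \<open>simp add: norm_mult norm_power power_mult_distrib\<close>)
  then have F: "((\<lambda>n. C n * (\<i> * of_real (freq n)) ^ Suc a * cis (t * freq n)) has_sum F) A"
    by (simp add: F_def)
  define K where "K = (\<Sum>\<^sub>\<infinity>n\<in>A. norm (C n) * \<bar>freq n\<bar> ^ (a + 2))"
  have bd: "norm F \<le> K * h" if h: "0 < h" "h < \<delta> - \<bar>t\<bar>" for h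
  proof -
    define R where "R n = C n * (\<i> * of_real (freq n)) ^ a * cis ((t + h) * freq n) - C n * (\<i> * of_real (freq n)) ^ a * cis (t * freq n)
        - of_real h * (C n * (\<i> * of_real (freq n)) ^ Suc a * cis (t * freq n))" for n
    have "\<bar>t + h\<bar> < \<delta>" using h by linarith
    \<comment> \<open>The moments of order \<open>a\<close> at \<open>t + h\<close> and at
      \<open>t\<close> agree by induction, so only the linear term with \<open>F\<close> survives in
      the sum of \<open>R\<close>.\<close>
    then have "(R has_sum ((if a = 0 then c else 0) - (if a = 0 then c else 0) - of_real h * F)) A"
      unfolding R_def using Suc.prems
      by (intro has_sum_diff_fun Suc.IH has_sum_cmult_right F)
    then have Rs: "(R has_sum (- of_real h * F)) A" by simp
    have "norm (R n) \<le> h\<^sup>2 * (norm (C n) * \<bar>freq n\<bar> ^ (a + 2))" for n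
    proof -
      have "R n = C n * (\<i> * of_real (freq n)) ^ a * cis (t * freq n) * (cis (h * freq n) - (\<Sum>a\<le>1. (\<i> * of_real (h * freq n)) ^ a / fact a))"
        by (simp add: R_def distrib_right algebra_simps flip: cis_mult)
      then have "norm (R n) = norm (C n) * \<bar>freq n\<bar> ^ a * norm (cis (h * freq n) - (\<Sum>a\<le>1. (\<i> * of_real (h * freq n)) ^ a / fact a))"
        by (simp only: norm_mult norm_power norm_cis norm_ii norm_of_real) simp
      also have "\<dots> \<le> norm (C n) * \<bar>freq n\<bar> ^ a * \<bar>h * freq n\<bar> ^ Suc 1"
        by (intro mult_left_mono cis_Taylor) auto
      also have "\<dots> = h\<^sup>2 * (norm (C n) * \<bar>freq n\<bar> ^ (a + 2))"
        by (simp add: abs_mult power2_eq_square mult_ac)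
      finally show ?thesis .
    qed
    moreover have "((\<lambda>n. h\<^sup>2 * (norm (C n) * \<bar>freq n\<bar> ^ (a + 2))) has_sum h\<^sup>2 * K) A"
      unfolding K_def by (intro has_sum_cmult_right has_sum_infsum sm)
    ultimately have "norm (- of_real h * F) \<le> h\<^sup>2 * K"
      using norm_has_sum_le[OF Rs] by blast
    then show ?thesis using h by (simp add: norm_mult power2_eq_square mult_ac)
  qed
  have "norm F \<le> 0"
  proof (rule ccontr)
    assume nF: "\<not> norm F \<le> 0"
    have K0: "K \<ge> 0" unfolding K_def by (intro infsum_nonneg) auto
    \<comment> \<open>Small enough for \<open>K * h\<close> to fall below \<open>norm F\<close> and
      for \<open>t + h\<close> to stay in the interval; \<open>K + 1\<close> avoids a division by
      zero.\<close>
    define h where "h = min ((\<delta> - \<bar>t\<bar>) / 2) (norm F / (2 * (K + 1)))"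
    have "h \<le> (\<delta> - \<bar>t\<bar>) / 2" unfolding h_def by (rule min.cobounded1)
    then have "2 * h \<le> \<delta> - \<bar>t\<bar>" by simp
    then have "h < \<delta> - \<bar>t\<bar>" using Suc.prems by linarith
    moreover have "0 < h" using nF K0 Suc.prems by (simp add: h_def)
    ultimately have h: "0 < h" "h < \<delta> - \<bar>t\<bar>" by blast+
    have "norm F \<le> K * h" by (rule bd[OF h])
    also have "\<dots> \<le> (K + 1) * (norm F / (2 * (K + 1)))"
      using K0 h by (intro mult_mono) (auto simp: h_def)
    also have "\<dots> = norm F / 2" using K0 by (simp add: field_simps)
    finally show False using nF by simp
  qed
  then show ?case using F by simp
qed

text \<open>Taylor's theorem for \<Phi> itself would give the same decay, but with a remainder
  depending jointly on x and z. Here every summand is a character in x times a function of z, as is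
  needed to absorb it into the coefficients of two functions. On U the zeroth moment is c and the
  moments of orders 1 to m vanish, so subtracting the Taylor polynomials changes the sum by exactly
  c and leaves each term of order m + 1 in z. The majorant b depends neither on x nor on its
  distance to the boundary of U.\<close>

lemma flat_expansion:
  fixes \<Phi> :: "real ^ 'n::finite \<Rightarrow> real"
  assumes \<Phi>: "smooth \<Phi>" and supp: "\<And>x. \<Phi> x \<noteq> 0 \<Longrightarrow> norm x \<le> R"
    and U: "open U" "\<And>x. x \<in> U \<Longrightarrow> \<Phi> x = c"
  shows "\<exists>(b :: real ^ 'n \<Rightarrow> real) w q. b summable_on int_lattice \<and>
    (\<forall>n\<in>int_lattice. \<forall>z. norm (w n z) \<le> b n * norm z ^ Suc m) \<and>
    (\<forall>x\<in>U. \<forall>z. norm x \<le> L \<longrightarrow> norm z \<le> L \<longrightarrow>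
       ((\<lambda>n. echar n (q *\<^sub>R x) * w n z) has_sum complex_of_real (\<Phi> (x + z) - c)) int_lattice)"
proof -
  \<comment> \<open>The term with \<open>R\<close> is demanded by the periodization; the others make
    points of norm up to \<open>2 * L + 1\<close> shrink into the cell around 0, where
    \<open>\<phi>\<close> is just the rescaled \<Phi>.\<close>
  define P where "P = 4 * \<bar>R\<bar> + 4 * \<bar>L\<bar> + 4"
  define q where "q = 1 / P"
  have P: "P > 4 * R" "P > 0" by (auto simp: P_def)
  define \<phi> where "\<phi> x = \<Phi> (P *\<^sub>R (x - round_vec x))" for x
  have \<phi>: "\<phi> \<in> test_functions"
    unfolding \<phi>_def[abs_def] by (rule periodization_test_function[OF \<Phi> supp P])
  have \<phi>_eq: "\<phi> (q *\<^sub>R y) = \<Phi> y" if "norm y \<le> 2 * L + 1" for y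
  proof -
    have "norm y < P / 2" using that by (auto simp: P_def)
    then have "norm (q *\<^sub>R y) < 1 / 2" using P by (simp add: q_def field_simps)
    then have "round_vec (q *\<^sub>R y) = 0" by (intro round_vec_eq) auto
    then show ?thesis using P by (simp add: \<phi>_def q_def)
  qed
  define co where "co = tcoeff (\<lambda>x. of_real (\<phi> x))"
  have smM: "(\<lambda>n. norm n ^ M * norm (co n)) summable_on int_lattice" for M
    unfolding co_def by (rule summable_tcoeff[OF \<phi>])
  have inv: "((\<lambda>n. co n * echar n x) has_sum of_real (\<phi> x)) int_lattice" for x
  proof -
    have "(\<lambda>n. co n * echar n x) summable_on int_lattice"
      by (rule abs_summable_summable) (use smM[of 0] in \<open>simp add: norm_mult\<close>)
    then show ?thesis
      using has_sum_infsum fourier_inversion[OF \<phi>, of x] by (simp add: co_def)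
  qed
  define lam where "lam n z = 2 * pi * q * (n \<bullet> z)" for n z :: "real ^ 'n"
  define w where "w n z = co n * (cis (lam n z) - (\<Sum>a\<le>m. (\<i> * of_real (lam n z)) ^ a / fact a))" for n z
  define b where "b n = norm (co n) * (2 * pi * q * norm n) ^ Suc m" for n
  have q0: "q > 0" using P by (simp add: q_def)
  have lam_le: "\<bar>lam n z\<bar> \<le> 2 * pi * q * norm n * norm z" for n z
    using Cauchy_Schwarz_ineq2[of n z] q0 by (simp add: lam_def abs_mult mult_left_mono mult.assoc)
  have "b = (\<lambda>n. (2 * pi * q) ^ Suc m * (norm n ^ Suc m * norm (co n)))"
    by (simp add: b_def fun_eq_iff power_mult_distrib mult_ac)
  then have b: "b summable_on int_lattice"
    by (simp only:) (intro summable_on_cmult_right smM)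
  have w: "norm (w n z) \<le> b n * norm z ^ Suc m" for n z
  proof -
    have "norm (w n z) \<le> norm (co n) * \<bar>lam n z\<bar> ^ Suc m"
      unfolding w_def norm_mult by (intro mult_left_mono cis_Taylor) auto
    also have "\<dots> \<le> norm (co n) * (2 * pi * q * norm n * norm z) ^ Suc m"
      by (intro mult_left_mono power_mono lam_le) auto
    finally show ?thesis by (simp only: b_def power_mult_distrib mult.assoc)
  qed
  have main: "((\<lambda>n. echar n (q *\<^sub>R x) * w n z) has_sum complex_of_real (\<Phi> (x + z) - c)) int_lattice"
    if x: "x \<in> U" "norm x \<le> L" and z: "norm z \<le> L" for x z
  proof -
    define C where "C n = co n * echar n (q *\<^sub>R x)" for n
    have ch: "echar n (q *\<^sub>R (x + t *\<^sub>R z)) = echar n (q *\<^sub>R x) * cis (t * lam n z)" for n t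
      by (simp add: scaleR_add_right echar_add_right) (simp add: echar_def lam_def mult_ac)
    obtain \<delta>0 where \<delta>0: "\<delta>0 > 0" "ball x \<delta>0 \<subseteq> U"
      using U(1) x open_contains_ball by blast
    \<comment> \<open>For \<open>\<bar>t\<bar> < \<delta>\<close> the displacement
      \<open>t *\<^sub>R z\<close> is shorter than \<open>\<delta>0\<close>, hence stays in
      \<open>U\<close>, and shorter than 1, hence stays where \<open>\<phi>_eq\<close> applies. The
      added 1 covers \<open>z = 0\<close>.\<close>
    define \<delta> where "\<delta> = min \<delta>0 1 / (norm z + 1)"
    have \<delta>: "\<delta> > 0" using \<delta>0 by (simp add: \<delta>_def add_nonneg_pos)
    have const: "((\<lambda>n. C n * cis (t * lam n z)) has_sum of_real c) int_lattice" if t: "\<bar>t\<bar> < \<delta>" for t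
    proof -
      have "\<bar>t\<bar> * (norm z + 1) < min \<delta>0 1"
        using t by (simp add: \<delta>_def pos_less_divide_eq add_nonneg_pos)
      then have "\<bar>t\<bar> + norm (t *\<^sub>R z) < min \<delta>0 1" by (simp add: algebra_simps)
      then have n: "norm (t *\<^sub>R z) < min \<delta>0 1" using abs_ge_zero[of t] by linarith
      then have "x + t *\<^sub>R z \<in> U" using \<delta>0 by (auto simp: dist_norm)
      moreover have "norm (x + t *\<^sub>R z) \<le> 2 * L + 1"
        using norm_triangle_ineq[of x "t *\<^sub>R z"] n x norm_ge_zero[of x] by linarith
      ultimately show ?thesis
        using inv[of "q *\<^sub>R (x + t *\<^sub>R z)"] by (simp add: \<phi>_eq U(2) ch C_def mult.assoc)
    qed
    have sm: "(\<lambda>n. norm (C n) * \<bar>lam n z\<bar> ^ a) summable_on int_lattice" for a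
    proof (rule summable_on_comparison_test)
      show "(\<lambda>n. (2 * pi * q * norm z) ^ a * (norm n ^ a * norm (co n))) summable_on int_lattice"
        by (intro summable_on_cmult_right smM)
      fix n :: "real ^ 'n"
      have "norm (C n) * \<bar>lam n z\<bar> ^ a \<le> norm (co n) * (2 * pi * q * norm n * norm z) ^ a"
        unfolding C_def norm_mult norm_echar mult_1_right by (intro mult_left_mono power_mono lam_le) auto
      then show "norm (C n) * \<bar>lam n z\<bar> ^ a \<le> (2 * pi * q * norm z) ^ a * (norm n ^ a * norm (co n))"
        by (simp add: power_mult_distrib mult_ac)
    qed auto
    have mom: "((\<lambda>n. C n * (\<i> * lam n z) ^ a) has_sum (if a = 0 then of_real c else 0)) int_lattice" for a
      using trig_series_moments[where t = 0 and a = a and freq = "\<lambda>n. lam n z" and c = "of_real c", OF sm const] \<delta>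
      by (simp split del: if_split)
    have "norm (x + z) \<le> 2 * L + 1"
      using norm_triangle_ineq[of x z] x z by linarith
    then have 1: "((\<lambda>n. C n * cis (lam n z)) has_sum of_real (\<Phi> (x + z))) int_lattice"
      using inv[of "q *\<^sub>R (x + 1 *\<^sub>R z)"] unfolding ch by (simp add: \<phi>_eq C_def mult.assoc)
    have "((\<lambda>n. \<Sum>a\<le>m. 1 / fact a * (C n * (\<i> * lam n z) ^ a)) has_sum (\<Sum>a\<le>m. 1 / fact a * (if a = 0 then of_real c else 0))) int_lattice"
      by (intro has_sum_sum_fun has_sum_cmult_right mom) simp
    moreover have "(\<Sum>a\<le>m. 1 / fact a * (if a = 0 then complex_of_real c else 0)) = of_real c"
      by (simp add: if_distrib cong: if_cong)
    ultimately have "((\<lambda>n. C n * cis (lam n z) - (\<Sum>a\<le>m. 1 / fact a * (C n * (\<i> * lam n z) ^ a))) has_sum (of_real (\<Phi> (x + z)) - of_real c)) int_lattice"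
      using has_sum_diff_fun[OF 1] by fastforce
    moreover have "C n * cis (lam n z) - (\<Sum>a\<le>m. 1 / fact a * (C n * (\<i> * lam n z) ^ a)) = echar n (q *\<^sub>R x) * w n z" for n
      by (simp add: C_def w_def sum_distrib_left algebra_simps)
    ultimately show ?thesis by simp
  qed
  show ?thesis using b w main by blast
qed


section \<open>Trilinear multiplier bounds\<close>

text \<open>Parseval's identity for trigonometric polynomials.\<close>

lemma LINT_norm_trig_poly:
  assumes Z: "finite Z" "Z \<subseteq> int_lattice"
  shows "(LINT x|torus_measure. (norm (\<Sum>k\<in>Z. a k * echar k x))\<^sup>2) = (\<Sum>k\<in>Z. (norm (a k))\<^sup>2)"
proof -
  have "complex_of_real (LINT x|torus_measure. (norm (\<Sum>k\<in>Z. a k * echar k x))\<^sup>2)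
      = (LINT x|torus_measure. (\<Sum>k\<in>Z. \<Sum>l\<in>Z. a k * cnj (a l) * echar (k - l) x))"
    unfolding integral_complex_of_real[symmetric] complex_norm_square
    by (intro Bochner_Integration.integral_cong refl)
      (simp add: cnj_echar sum_product mult_ac diff_conv_add_uminus echar_add del: add_uminus_conv_diff)
  also have "\<dots> = (\<Sum>k\<in>Z. \<Sum>l\<in>Z. a k * cnj (a l) * (LINT x|torus_measure. echar (k - l) x))"
    by (subst Bochner_Integration.integral_sum, (intro integrable_torus_measure continuous_intros),
        subst Bochner_Integration.integral_sum, (intro integrable_torus_measure continuous_intros), simp)
  also have "\<dots> = (\<Sum>k\<in>Z. \<Sum>l\<in>Z. if l = k then a k * cnj (a l) else 0)"
    using Z by (intro sum.cong refl) (auto simp: LINT_echar int_lattice_diff subset_iff)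
  also have "\<dots> = (\<Sum>k\<in>Z. a k * cnj (a k))" using Z by simp
  also have "\<dots> = complex_of_real (\<Sum>k\<in>Z. (norm (a k))\<^sup>2)"
    by (simp only: of_real_sum complex_norm_square)
  finally show ?thesis by (simp only: of_real_eq_iff)
qed

text \<open>The double sum is the integral of a product of three functions: integrating a product of
  two characters against \<open>G\<close> produces the coefficient at minus the sum of their
  frequencies. \<open>G\<close> is then bounded pointwise and the other two factors in the square
  mean.\<close>

lemma trilinear_bound:
  fixes G :: "real ^ 'n::finite \<Rightarrow> complex"
  assumes Z: "finite Z1" "Z1 \<subseteq> int_lattice" "finite Z2" "Z2 \<subseteq> int_lattice"
    and G: "continuous_on UNIV G" "\<And>x. norm (G x) \<le> B"
  shows "norm (\<Sum>z\<in>Z1. \<Sum>y\<in>Z2. a z * c y * tcoeff G (- (z + y)))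
    \<le> B * sqrt (\<Sum>z\<in>Z1. (norm (a z))\<^sup>2) * sqrt (\<Sum>y\<in>Z2. (norm (c y))\<^sup>2)"
proof -
  define F where "F x = (\<Sum>z\<in>Z1. a z * echar z x)" for x
  define H where "H x = (\<Sum>y\<in>Z2. c y * echar y x)" for x
  define p where "p = sqrt (\<Sum>z\<in>Z1. (norm (a z))\<^sup>2)"
  define q where "q = sqrt (\<Sum>y\<in>Z2. (norm (c y))\<^sup>2)"
  have pq: "p \<ge> 0" "q \<ge> 0" by (auto simp: p_def q_def sum_nonneg)
  have B: "B \<ge> 0" using G(2)[of undefined] norm_ge_zero order_trans by blast
  have Fc: "continuous_on UNIV F" "continuous_on UNIV H"
    unfolding F_def H_def by (intro continuous_intros)+
  have F2: "(LINT x|torus_measure. (norm (F x))\<^sup>2) = p\<^sup>2" "(LINT x|torus_measure. (norm (H x))\<^sup>2) = q\<^sup>2"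
    unfolding F_def H_def using Z by (simp_all add: LINT_norm_trig_poly p_def q_def sum_nonneg)
  have eq: "(\<Sum>z\<in>Z1. \<Sum>y\<in>Z2. a z * c y * tcoeff G (- (z + y))) = (LINT x|torus_measure. F x * H x * G x)"
  proof -
    have "(LINT x|torus_measure. F x * H x * G x) = (LINT x|torus_measure. (\<Sum>z\<in>Z1. \<Sum>y\<in>Z2. a z * c y * (G x * echar (z + y) x)))"
    proof (intro Bochner_Integration.integral_cong refl)
      fix x
      have "F x * H x = (\<Sum>z\<in>Z1. \<Sum>y\<in>Z2. (a z * echar z x) * (c y * echar y x))"
        unfolding F_def H_def by (rule sum_product)
      then show "F x * H x * G x = (\<Sum>z\<in>Z1. \<Sum>y\<in>Z2. a z * c y * (G x * echar (z + y) x))"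
        by (simp add: sum_distrib_left sum_distrib_right echar_add mult_ac)
    qed
    also have "\<dots> = (\<Sum>z\<in>Z1. \<Sum>y\<in>Z2. a z * c y * tcoeff G (- (z + y)))"
      unfolding tcoeff_def
      by (subst Bochner_Integration.integral_sum, (intro integrable_torus_measure continuous_intros G),
        subst Bochner_Integration.integral_sum, (intro integrable_torus_measure continuous_intros G), simp add: add.commute)
    finally show ?thesis ..
  qed
  \<comment> \<open>The weighted arithmetic-geometric mean inequality yields the Cauchy--Schwarz
    bound: the later choice \<open>s = q / p\<close> makes both terms equal. If \<open>p\<close> or
    \<open>q\<close> is zero, all coefficients on that side vanish.\<close>
  have young: "norm (LINT x|torus_measure. F x * H x * G x) \<le> B * ((s * p\<^sup>2 + q\<^sup>2 / s) / 2)" if s: "s > 0" for s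
  proof -
    have "norm (LINT x|torus_measure. F x * H x * G x) \<le> (LINT x|torus_measure. norm (F x * H x * G x))"
      by (rule integral_norm_bound)
    also have "\<dots> \<le> (LINT x|torus_measure. B * ((s * (norm (F x))\<^sup>2 + (norm (H x))\<^sup>2 / s) / 2))"
    proof (rule integral_mono)
      fix x
      have "0 \<le> (s * norm (F x) - norm (H x))\<^sup>2 / (2 * s)" using s by simp
      then have "norm (F x) * norm (H x) \<le> (s * (norm (F x))\<^sup>2 + (norm (H x))\<^sup>2 / s) / 2"
        using s by (simp add: field_simps power2_eq_square)
      then have "norm (F x) * norm (H x) * norm (G x) \<le> ((s * (norm (F x))\<^sup>2 + (norm (H x))\<^sup>2 / s) / 2) * B"
        using G(2)[of x] s by (intro mult_mono) auto
      then show "norm (F x * H x * G x) \<le> B * ((s * (norm (F x))\<^sup>2 + (norm (H x))\<^sup>2 / s) / 2)"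
        by (simp add: norm_mult mult_ac)
    qed (use s in \<open>auto intro!: integrable_torus_measure continuous_intros Fc G\<close>)
    also have "\<dots> = B * ((s * p\<^sup>2 + q\<^sup>2 / s) / 2)"
      unfolding F2[symmetric] using s
      by (subst integral_mult_right_zero, subst integral_divide_zero, subst Bochner_Integration.integral_add)
        (auto intro!: integrable_torus_measure continuous_intros Fc)
    finally show ?thesis .
  qed
  consider "p = 0" | "q = 0" | "p > 0" "q > 0" using pq by linarith
  then have "norm (\<Sum>z\<in>Z1. \<Sum>y\<in>Z2. a z * c y * tcoeff G (- (z + y))) \<le> B * p * q"
  proof cases
    case 1
    then have "\<forall>z\<in>Z1. a z = 0" using Z by (simp add: p_def sum_nonneg_eq_0_iff)
    then show ?thesis using pq B by simp
  next
    case 2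
    then have "\<forall>y\<in>Z2. c y = 0" using Z by (simp add: q_def sum_nonneg_eq_0_iff)
    then show ?thesis using pq B by simp
  next
    case 3
    then have "((q / p) * p\<^sup>2 + q\<^sup>2 / (q / p)) / 2 = p * q"
      by (simp add: field_simps power2_eq_square)
    then show ?thesis unfolding eq using young[of "q / p"] 3 by (simp add: mult.assoc)
  qed
  then show ?thesis by (simp add: p_def q_def)
qed

text \<open>A summand \<open>u n z * v n y\<close> merely rescales the two coefficient sequences, so
  the trilinear bound holds for each \<open>n\<close> and the bounds add up. The expansion of
  \<open>kern\<close> is demanded only where the coefficient of \<open>G\<close> is nonzero, the
  only place where a flat symbol can be expanded.\<close>

lemma schur_multiplier_bound:
  fixes G :: "real ^ 'n::finite \<Rightarrow> complex" and kern :: "real ^ 'n \<Rightarrow> real ^ 'n \<Rightarrow> complex"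
  assumes Z: "finite Z1" "Z1 \<subseteq> int_lattice" "finite Z2" "Z2 \<subseteq> int_lattice"
    and G: "continuous_on UNIV G" "\<And>x. norm (G x) \<le> B"
    and b: "b summable_on A"
    and u: "\<And>n z. n \<in> A \<Longrightarrow> z \<in> Z1 \<Longrightarrow> norm (u n z) \<le> b n * W z"
    and v: "\<And>n y. n \<in> A \<Longrightarrow> y \<in> Z2 \<Longrightarrow> norm (v n y) \<le> 1"
    and W: "\<And>z. z \<in> Z1 \<Longrightarrow> 0 \<le> W z"
    and b0: "\<And>n. n \<in> A \<Longrightarrow> 0 \<le> b n"
    and kern: "\<And>z y. z \<in> Z1 \<Longrightarrow> y \<in> Z2 \<Longrightarrow> tcoeff G (- (z + y)) \<noteq> 0 \<Longrightarrow> ((\<lambda>n. u n z * v n y) has_sum kern z y) A"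
  shows "norm (\<Sum>z\<in>Z1. \<Sum>y\<in>Z2. a z * c y * tcoeff G (- (z + y)) * kern z y)
    \<le> infsum b A * B * sqrt (\<Sum>z\<in>Z1. (W z * norm (a z))\<^sup>2) * sqrt (\<Sum>y\<in>Z2. (norm (c y))\<^sup>2)"
proof -
  define K where "K = B * sqrt (\<Sum>z\<in>Z1. (W z * norm (a z))\<^sup>2) * sqrt (\<Sum>y\<in>Z2. (norm (c y))\<^sup>2)"
  have B: "B \<ge> 0" using G(2)[of undefined] norm_ge_zero order_trans by blast
  have "((\<lambda>n. \<Sum>z\<in>Z1. \<Sum>y\<in>Z2. a z * c y * tcoeff G (- (z + y)) * (u n z * v n y)) has_sum
      (\<Sum>z\<in>Z1. \<Sum>y\<in>Z2. a z * c y * tcoeff G (- (z + y)) * kern z y)) A"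
  proof (intro has_sum_sum_fun Z)
    fix z y assume zy: "z \<in> Z1" "y \<in> Z2"
    show "((\<lambda>n. a z * c y * tcoeff G (- (z + y)) * (u n z * v n y)) has_sum a z * c y * tcoeff G (- (z + y)) * kern z y) A"
      using kern[OF zy] by (cases "tcoeff G (- (z + y)) = 0") (auto intro: has_sum_cmult_right has_sum_0)
  qed
  moreover have "((\<lambda>n. b n * K) has_sum infsum b A * K) A"
    using b by (intro has_sum_cmult_left) auto
  moreover have "norm (\<Sum>z\<in>Z1. \<Sum>y\<in>Z2. a z * c y * tcoeff G (- (z + y)) * (u n z * v n y)) \<le> b n * K" if n: "n \<in> A" for n
  proof -
    have "(\<Sum>z\<in>Z1. \<Sum>y\<in>Z2. a z * c y * tcoeff G (- (z + y)) * (u n z * v n y)) =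
        (\<Sum>z\<in>Z1. \<Sum>y\<in>Z2. (a z * u n z) * (c y * v n y) * tcoeff G (- (z + y)))"
      by (simp add: mult_ac)
    also have "norm \<dots> \<le> B * sqrt (\<Sum>z\<in>Z1. (norm (a z * u n z))\<^sup>2) * sqrt (\<Sum>y\<in>Z2. (norm (c y * v n y))\<^sup>2)"
      by (rule trilinear_bound[OF Z G])
    also have "\<dots> \<le> B * sqrt (\<Sum>z\<in>Z1. (b n * (W z * norm (a z)))\<^sup>2) * sqrt (\<Sum>y\<in>Z2. (norm (c y))\<^sup>2)"
    proof (intro mult_mono mult_nonneg_nonneg real_sqrt_le_mono sum_mono power_mono)
      fix z assume "z \<in> Z1"
      then show "norm (a z * u n z) \<le> b n * (W z * norm (a z))"
        using mult_left_mono[OF u[OF n, of z], of "norm (a z)"] by (simp add: norm_mult mult_ac)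
    next
      fix y assume "y \<in> Z2"
      then show "norm (c y * v n y) \<le> norm (c y)"
        using mult_left_mono[OF v[OF n, of y], of "norm (c y)"] by (simp add: norm_mult)
    qed (use B in \<open>auto intro!: sum_nonneg\<close>)
    also have "sqrt (\<Sum>z\<in>Z1. (b n * (W z * norm (a z)))\<^sup>2) = b n * sqrt (\<Sum>z\<in>Z1. (W z * norm (a z))\<^sup>2)"
      using b0[OF n] by (simp add: power_mult_distrib[of "b n"] real_sqrt_mult flip: sum_distrib_left)
    finally show ?thesis by (simp add: K_def mult_ac)
  qed
  ultimately have "norm (\<Sum>z\<in>Z1. \<Sum>y\<in>Z2. a z * c y * tcoeff G (- (z + y)) * kern z y) \<le> infsum b A * K"
    by (rule norm_has_sum_le)
  then show ?thesis by (simp add: K_def mult.assoc)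
qed

text \<open>Apply the expansion at the frequency \<open>- (z + y)\<close> of \<open>G\<close> with
  increment z, both scaled by s: their sum is minus the scaled y, which evenness turns into the
  argument of \<Phi>, and the character at \<open>- (z + y)\<close> splits into one in z and one in
  y. Thus the multiplier acts on y while the gain falls on z. \<open>K\<close> is chosen before
  \<open>s\<close>, so it serves every dyadic scale.\<close>

lemma flat_multiplier_bound:
  fixes \<Phi> :: "real ^ 'n::finite \<Rightarrow> real"
  assumes \<Phi>: "smooth \<Phi>" and supp: "\<And>x. \<Phi> x \<noteq> 0 \<Longrightarrow> norm x \<le> R"
    and even: "\<And>x. \<Phi> (- x) = \<Phi> x"
    and U: "open U" "\<And>x. x \<in> U \<Longrightarrow> \<Phi> x = c0"
  obtains K where "K \<ge> 0"
    and "\<And>s G B Z1 Z2 a c. \<lbrakk>finite Z1; Z1 \<subseteq> int_lattice; finite Z2; Z2 \<subseteq> int_lattice;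
      continuous_on UNIV G; \<forall>x. norm (G x) \<le> B;
      \<forall>k\<in>int_lattice. tcoeff G k \<noteq> 0 \<longrightarrow> s *\<^sub>R k \<in> U \<and> norm (s *\<^sub>R k) \<le> L;
      \<forall>z\<in>Z1. norm (s *\<^sub>R z) \<le> L\<rbrakk> \<Longrightarrow>
    norm (\<Sum>z\<in>Z1. \<Sum>y\<in>Z2. a z * c y * tcoeff G (- (z + y)) * complex_of_real (\<Phi> (s *\<^sub>R y) - c0))
      \<le> K * B * sqrt (\<Sum>z\<in>Z1. (norm (s *\<^sub>R z) ^ Suc m * norm (a z))\<^sup>2) * sqrt (\<Sum>y\<in>Z2. (norm (c y))\<^sup>2)"
proof -
  have "\<exists>(b :: real ^ 'n \<Rightarrow> real) w q. b summable_on int_lattice \<and>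
    (\<forall>n\<in>int_lattice. \<forall>z. norm (w n z) \<le> b n * norm z ^ Suc m) \<and>
    (\<forall>x\<in>U. \<forall>z. norm x \<le> L \<longrightarrow> norm z \<le> L \<longrightarrow>
       ((\<lambda>n. echar n (q *\<^sub>R x) * w n z) has_sum complex_of_real (\<Phi> (x + z) - c0)) int_lattice)"
    by (rule flat_expansion[OF \<Phi> supp U])
  then obtain b w q where b: "(b :: real ^ 'n \<Rightarrow> real) summable_on int_lattice"
    and w: "\<And>n z. n \<in> int_lattice \<Longrightarrow> norm (w n z) \<le> b n * norm z ^ Suc m"
    and ser: "\<And>x z. x \<in> U \<Longrightarrow> norm x \<le> L \<Longrightarrow> norm z \<le> L \<Longrightarrow>
       ((\<lambda>n. echar n (q *\<^sub>R x) * w n z) has_sum complex_of_real (\<Phi> (x + z) - c0)) int_lattice"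
    by (elim exE conjE) (rule that, auto)
  have b0: "0 \<le> b n" if "n \<in> int_lattice" for n
  proof -
    \<comment> \<open>A vector of norm one turns the bound on \<open>w\<close> into nonnegativity of
      \<open>b n\<close>.\<close>
    have "0 \<le> b n * norm (axis undefined 1 :: real ^ 'n) ^ Suc m"
      using w[OF that, of "axis undefined 1"] norm_ge_zero order_trans by blast
    then show ?thesis by simp
  qed
  show ?thesis
  proof (rule that[of "infsum b int_lattice"])
    show "infsum b int_lattice \<ge> 0" by (intro infsum_nonneg b0)
    fix s :: real and G :: "real ^ 'n \<Rightarrow> complex" and B and Z1 Z2 :: "(real ^ 'n) set" and a c :: "real ^ 'n \<Rightarrow> complex"
    assume Z: "finite Z1" "Z1 \<subseteq> int_lattice" "finite Z2" "Z2 \<subseteq> int_lattice"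
      and G: "continuous_on UNIV G" "\<forall>x. norm (G x) \<le> B"
      and sp: "\<forall>k\<in>int_lattice. tcoeff G k \<noteq> 0 \<longrightarrow> s *\<^sub>R k \<in> U \<and> norm (s *\<^sub>R k) \<le> L"
      and Z1: "\<forall>z\<in>Z1. norm (s *\<^sub>R z) \<le> L"
    show "norm (\<Sum>z\<in>Z1. \<Sum>y\<in>Z2. a z * c y * tcoeff G (- (z + y)) * complex_of_real (\<Phi> (s *\<^sub>R y) - c0))
      \<le> infsum b int_lattice * B * sqrt (\<Sum>z\<in>Z1. (norm (s *\<^sub>R z) ^ Suc m * norm (a z))\<^sup>2) * sqrt (\<Sum>y\<in>Z2. (norm (c y))\<^sup>2)"
    proof (rule schur_multiplier_bound[where u = "\<lambda>n z. echar n (- (q * s) *\<^sub>R z) * w n (s *\<^sub>R z)"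
          and v = "\<lambda>n y. echar n (- (q * s) *\<^sub>R y)"])
      show "norm (echar n (- (q * s) *\<^sub>R z) * w n (s *\<^sub>R z)) \<le> b n * norm (s *\<^sub>R z) ^ Suc m"
        if "n \<in> int_lattice" for n z
        using w[OF that, of "s *\<^sub>R z"] by (simp add: norm_mult)
      fix z y assume zy: "z \<in> Z1" "y \<in> Z2" and nz: "tcoeff G (- (z + y)) \<noteq> 0"
      have "z \<in> int_lattice" "y \<in> int_lattice" using Z zy by auto
      then have "- (z + y) \<in> int_lattice" by (subst int_lattice_uminus) (rule int_lattice_add)
      then have "s *\<^sub>R (- (z + y)) \<in> U" "norm (s *\<^sub>R (- (z + y))) \<le> L"
        using sp nz by blast+
      then have "((\<lambda>n. echar n (q *\<^sub>R (s *\<^sub>R (- (z + y)))) * w n (s *\<^sub>R z)) has_sum complex_of_real (\<Phi> (s *\<^sub>R (- (z + y)) + s *\<^sub>R z) - c0)) int_lattice"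
        using ser Z1 zy by blast
      moreover have "s *\<^sub>R (- (z + y)) + s *\<^sub>R z = - (s *\<^sub>R y)"
        by (simp add: algebra_simps)
      moreover have "q *\<^sub>R (s *\<^sub>R (- (z + y))) = - (q * s) *\<^sub>R z + - (q * s) *\<^sub>R y"
        by (simp add: algebra_simps)
      ultimately show "((\<lambda>n. echar n (- (q * s) *\<^sub>R z) * w n (s *\<^sub>R z) * echar n (- (q * s) *\<^sub>R y)) has_sum
          complex_of_real (\<Phi> (s *\<^sub>R y) - c0)) int_lattice"
        by (simp only: even echar_add_right) (simp add: mult_ac)
    qed (use Z G b b0 in auto)
  qed
qed


section \<open>Littlewood--Paley blocks and the estimate at one scale\<close>

text \<open>The radii hidden in the partition are fixed as parameters, with a common outer radius
  for \<open>chi\<close> and \<open>\<rho>\<close>.\<close>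

locale littlewood_paley =
  fixes chi \<rho> :: "real ^ 'n::finite \<Rightarrow> real" and r R :: real
  assumes partition: "dyadic_partition chi \<rho>"
    and r: "0 < r"
    and rho_supp: "\<And>x. \<rho> x \<noteq> 0 \<Longrightarrow> r \<le> norm x \<and> norm x \<le> R"
    and chi_supp: "\<And>x. chi x \<noteq> 0 \<Longrightarrow> norm x \<le> R"
begin

lemma smooth_chi: "smooth chi" and smooth_rho: "smooth \<rho>"
  and chi_nonneg: "0 \<le> chi x" and rho_nonneg: "0 \<le> \<rho> x"
  and radial: "norm x = norm y \<Longrightarrow> chi x = chi y" "norm x = norm y \<Longrightarrow> \<rho> x = \<rho> y"
  and rho_sums: "(\<lambda>j. \<rho> ((1 / 2 ^ j) *\<^sub>R x)) sums (1 - chi x)"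
  and chi_rho: "j \<ge> 1 \<Longrightarrow> chi x * \<rho> ((1 / 2 ^ j) *\<^sub>R x) = 0"
  and rho_rho: "\<bar>int i - int j\<bar> > 1 \<Longrightarrow> \<rho> ((1 / 2 ^ i) *\<^sub>R x) * \<rho> ((1 / 2 ^ j) *\<^sub>R x) = 0"
proof -
  note p = partition[unfolded dyadic_partition_def]
  show "smooth chi" "smooth \<rho>" using p by blast+
  show "0 \<le> chi x" "0 \<le> \<rho> x" using p by blast+
  show "norm x = norm y \<Longrightarrow> chi x = chi y" "norm x = norm y \<Longrightarrow> \<rho> x = \<rho> y" using p by blast+
  show "(\<lambda>j. \<rho> ((1 / 2 ^ j) *\<^sub>R x)) sums (1 - chi x)" using p by blast
  show "j \<ge> 1 \<Longrightarrow> chi x * \<rho> ((1 / 2 ^ j) *\<^sub>R x) = 0" using p by blast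
  show "\<bar>int i - int j\<bar> > 1 \<Longrightarrow> \<rho> ((1 / 2 ^ i) *\<^sub>R x) * \<rho> ((1 / 2 ^ j) *\<^sub>R x) = 0" using p by blast
qed

section \<open>Cutoff functions derived from the dyadic partition\<close>

lemma chi_le_1: "chi x \<le> 1"
proof -
  have "0 \<le> 1 - chi x"
    using sums_le[OF _ sums_zero rho_sums] rho_nonneg by blast
  then show ?thesis by simp
qed

lemma chi_eq_1:
  assumes "\<And>j. \<rho> ((1 / 2 ^ j) *\<^sub>R x) = 0"
  shows "chi x = 1"
  using rho_sums[of x] sums_unique2[OF sums_zero, of "1 - chi x"] assms by simp

lemma chi_eq_1_near_0:
  assumes "norm x < r"
  shows "chi x = 1"
proof (rule chi_eq_1, rule ccontr)
  fix j :: nat assume "\<rho> ((1 / 2 ^ j) *\<^sub>R x) \<noteq> 0"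
  then have "r \<le> norm x / 2 ^ j" using rho_supp by fastforce
  also have "\<dots> \<le> norm x" using mult_left_mono[of 1 "2 ^ j" "norm x"] by (simp add: divide_le_eq)
  finally show False using assms by simp
qed

text \<open>The partition identity at half of x is the one at x without its first term. Partial sums
  of the symbols thereby become dilates of \<open>chi\<close>.\<close>

lemma rho_eq_chi_diff: "\<rho> x = chi ((1 / 2) *\<^sub>R x) - chi x"
proof -
  have "(\<lambda>j. \<rho> ((1 / 2 ^ Suc j) *\<^sub>R x)) sums (1 - chi ((1 / 2) *\<^sub>R x))"
    using rho_sums[of "(1 / 2) *\<^sub>R x"] by (simp add: mult.commute)
  then have "(\<lambda>j. \<rho> ((1 / 2 ^ j) *\<^sub>R x)) sums (1 - chi ((1 / 2) *\<^sub>R x) + \<rho> x)"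
    using sums_Suc[of "\<lambda>j. \<rho> ((1 / 2 ^ j) *\<^sub>R x)"] by simp
  then have "1 - chi ((1 / 2) *\<^sub>R x) + \<rho> x = 1 - chi x"
    using rho_sums sums_unique2 by blast
  then show ?thesis by simp
qed

text \<open>The orthogonality relations alone give these values, on the whole open set where
  \<open>\<rho>\<close> is nonzero. At a quarter of x every term of the partition other than
  \<open>chi\<close> vanishes, because those are the symbols at distance two or more from
  \<open>\<rho>\<close>.\<close>

lemma chi_on_rho_support:
  assumes "\<rho> x \<noteq> 0"
  shows "chi (2 *\<^sub>R x) = 0" "chi ((1 / 4) *\<^sub>R x) = 1"
proof -
  show "chi (2 *\<^sub>R x) = 0" using chi_rho[of 1 "2 *\<^sub>R x"] assms by simp
  have "\<rho> ((1 / 2 ^ j) *\<^sub>R (1 / 4) *\<^sub>R x) = 0" for j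
    using rho_rho[of 0 "j + 2" x] assms by (simp add: power_add mult.commute)
  then show "chi ((1 / 4) *\<^sub>R x) = 1" by (rule chi_eq_1)
qed

text \<open>Blocks are numbered by natural numbers: \<open>symb n\<close> is the symbol of index \<open>n - 1\<close>.\<close>

definition symb :: "nat \<Rightarrow> real ^ 'n \<Rightarrow> real" where
  "symb n = lp_symbol chi \<rho> (int n - 1)"

text \<open>Truncated subtraction is intended: \<open>low n\<close> collects the symbols up to
  number \<open>n - 2\<close> and is empty for \<open>n \<le> 1\<close>, while \<open>near n\<close>
  begins at 0 when \<open>n = 0\<close>.\<close>

definition low :: "nat \<Rightarrow> real ^ 'n \<Rightarrow> real" where
  "low n x = (\<Sum>i<n - 1. symb i x)"

definition near :: "nat \<Rightarrow> real ^ 'n \<Rightarrow> real" where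
  "near n x = (\<Sum>i\<in>{n - 1..Suc n}. symb i x)"

lemma symb_0: "symb 0 x = chi x"
  by (simp add: symb_def lp_symbol_def)

lemma symb_Suc: "symb (Suc n) x = \<rho> ((1 / 2 ^ n) *\<^sub>R x)"
  by (simp add: symb_def lp_symbol_def)

lemma symb_nonneg: "0 \<le> symb n x"
  by (cases n) (simp_all add: symb_0 symb_Suc chi_nonneg rho_nonneg)

lemma sum_symb: "(\<Sum>i\<le>n. symb i x) = chi ((1 / 2 ^ n) *\<^sub>R x)"
proof (induction n)
  case (Suc n)
  then show ?case
    using rho_eq_chi_diff[of "(1 / 2 ^ n) *\<^sub>R x"] by (simp add: symb_Suc mult.commute)
qed (simp add: symb_0)

lemma low_eq_0: "n \<le> 1 \<Longrightarrow> low n x = 0"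
  by (simp add: low_def)

lemma low_Suc_Suc: "low (Suc (Suc n)) x = chi ((1 / 2 ^ n) *\<^sub>R x)"
  using sum_symb[where n = n and x = x] by (simp add: low_def lessThan_Suc_atMost)

lemma near_eq: "near n x = chi ((1 / 2 ^ Suc n) *\<^sub>R x) - low n x"
proof -
  have "{..Suc n} = {..<n - 1} \<union> {n - 1..Suc n}" by auto
  then have "(\<Sum>i\<le>Suc n. symb i x) = (\<Sum>i<n - 1. symb i x) + (\<Sum>i\<in>{n - 1..Suc n}. symb i x)"
    by (simp add: sum.union_disjoint ivl_disj_int)
  then show ?thesis by (simp add: sum_symb low_def near_def del: sum.atMost_Suc)
qed

lemma low_bounds: "0 \<le> low n x" "low n x \<le> 1"
proof -
  show "0 \<le> low n x" unfolding low_def by (intro sum_nonneg symb_nonneg)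
  consider "n \<le> 1" | m where "n = Suc (Suc m)" by (cases n; cases "n - 1") auto
  then show "low n x \<le> 1" by cases (simp_all add: low_eq_0 low_Suc_Suc chi_le_1)
qed

lemma near_bounds: "0 \<le> near n x" "near n x \<le> 1"
proof -
  show "0 \<le> near n x" unfolding near_def by (intro sum_nonneg symb_nonneg)
  show "near n x \<le> 1" using near_eq[where n = n and x = x] low_bounds[where n = n and x = x] chi_le_1 by (simp add: add_increasing2 diff_le_eq)
qed

lemma R_pos: "0 < R"
proof -
  obtain x :: "real ^ 'n" where x: "norm x = r / 2" using vector_choose_size[of "r / 2"] r by auto
  then have "chi x \<noteq> 0" using r by (subst chi_eq_1_near_0) auto
  then have "r / 2 \<le> R" using chi_supp x by fastforce
  then show ?thesis using r by simp
qed

lemma symb_supp: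
  assumes "symb n x \<noteq> 0"
  shows "norm x \<le> R * 2 ^ n"
proof (cases n)
  case 0
  then show ?thesis using assms chi_supp by (simp add: symb_0)
next
  case (Suc m)
  then have "norm x / 2 ^ m \<le> R" using assms rho_supp[of "(1 / 2 ^ m) *\<^sub>R x"] by (simp add: symb_Suc)
  then have "norm x \<le> R * 2 ^ m" by (simp add: divide_le_eq)
  also have "\<dots> \<le> R * 2 ^ n" using R_pos Suc by (intro mult_left_mono) auto
  finally show ?thesis .
qed

lemma low_supp:
  assumes "low n x \<noteq> 0"
  shows "norm x \<le> R * 2 ^ n"
proof -
  obtain i where i: "i < n - 1" "symb i x \<noteq> 0"
    using assms unfolding low_def by (meson lessThan_iff sum.not_neutral_contains_not_neutral)
  then have "norm x \<le> R * 2 ^ i" by (intro symb_supp)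
  also have "\<dots> \<le> R * 2 ^ n" using R_pos i by (intro mult_left_mono power_increasing) auto
  finally show ?thesis .
qed

lemma near_supp:
  assumes "near n x \<noteq> 0"
  shows "norm x \<le> 2 * R * 2 ^ n"
proof -
  obtain i where i: "i \<in> {n - 1..Suc n}" "symb i x \<noteq> 0"
    using assms unfolding near_def by (meson sum.not_neutral_contains_not_neutral)
  then have "norm x \<le> R * 2 ^ i" by (intro symb_supp)
  also have "\<dots> \<le> R * 2 ^ Suc n" using R_pos i by (intro mult_left_mono power_increasing) auto
  finally show ?thesis by simp
qed

text \<open>The squared Japanese bracket at the angular frequency; its power \<open>s\<close> is the
  Sobolev weight of order \<open>s\<close>.\<close>

definition jap :: "real ^ 'n \<Rightarrow> real" where
  "jap k = 1 + (2 * pi * norm k)\<^sup>2"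

lemma jap_ge_1: "1 \<le> jap k"
  by (simp add: jap_def)

text \<open>A frequency of the test function is minus the sum of one of the block of
  \<open>g\<close>, of size at most \<open>R * 2 ^ n\<close>, and one of \<open>near n\<close>, of
  size at most \<open>2 * R * 2 ^ n\<close>; hence the factor 3.\<close>

definition freqs :: "nat \<Rightarrow> (real ^ 'n) set" where
  "freqs n = lattice_ball (3 * R * 2 ^ n)"

text \<open>The weight is of order one for frequencies of size \<open>2 ^ n\<close> and decays like
  the power \<open>2 * M\<close> of the ratio for smaller ones, down to the floor set by the 1 in
  \<open>jap\<close>.\<close>

definition wnorm :: "nat \<Rightarrow> nat \<Rightarrow> (real ^ 'n \<Rightarrow> complex) \<Rightarrow> real" where
  "wnorm M n a = sqrt (\<Sum>k\<in>freqs n. (jap k / 4 ^ n) ^ M * (norm (a k))\<^sup>2)"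

lemma finite_freqs [simp]: "finite (freqs n)"
  by (simp add: freqs_def)

lemma freqs_subset: "freqs n \<subseteq> int_lattice"
  by (auto simp: freqs_def lattice_ball_def)

text \<open>Used with \<open>W\<close> the gained power and \<open>H = 1\<close> on small
  frequencies, and with \<open>W = 1\<close> and a large \<open>H\<close> on the others.\<close>

lemma sqrt_sum_le_wnorm:
  assumes Z: "Z \<subseteq> freqs n" and H: "H \<ge> 0"
    and W: "\<And>k. k \<in> Z \<Longrightarrow> 0 \<le> W k \<and> (W k)\<^sup>2 \<le> H\<^sup>2 * (jap k / 4 ^ n) ^ M"
  shows "sqrt (\<Sum>k\<in>Z. (W k * norm (a k))\<^sup>2) \<le> H * wnorm M n a"
proof -
  have "(\<Sum>k\<in>Z. (W k * norm (a k))\<^sup>2) \<le> (\<Sum>k\<in>Z. H\<^sup>2 * ((jap k / 4 ^ n) ^ M * (norm (a k))\<^sup>2))"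
  proof (rule sum_mono)
    fix k assume "k \<in> Z"
    then show "(W k * norm (a k))\<^sup>2 \<le> H\<^sup>2 * ((jap k / 4 ^ n) ^ M * (norm (a k))\<^sup>2)"
      using mult_right_mono[of "(W k)\<^sup>2" _ "(norm (a k))\<^sup>2"] W by (fastforce simp: power_mult_distrib mult.assoc)
  qed
  also have "\<dots> \<le> (\<Sum>k\<in>freqs n. H\<^sup>2 * ((jap k / 4 ^ n) ^ M * (norm (a k))\<^sup>2))"
  proof (rule sum_mono2[OF finite_freqs Z])
    fix k
    show "0 \<le> H\<^sup>2 * ((jap k / 4 ^ n) ^ M * (norm (a k))\<^sup>2)"
      using jap_ge_1[of k] by simp
  qed
  finally have "sqrt (\<Sum>k\<in>Z. (W k * norm (a k))\<^sup>2) \<le> sqrt (H\<^sup>2 * (\<Sum>k\<in>freqs n. (jap k / 4 ^ n) ^ M * (norm (a k))\<^sup>2))"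
    by (intro real_sqrt_le_mono) (simp add: sum_distrib_left)
  then show ?thesis using H by (simp add: wnorm_def real_sqrt_mult)
qed

lemma wnorm_nonneg: "0 \<le> wnorm M n a"
  unfolding wnorm_def using jap_ge_1 by (intro real_sqrt_ge_zero sum_nonneg mult_nonneg_nonneg zero_le_power divide_nonneg_nonneg) (auto intro: order_trans[OF zero_le_one])

text \<open>\<open>low\<close> and \<open>near\<close> are locally constant on the support of \<open>symb n\<close>, where all their derivatives
  therefore vanish. This gives decay when one of the two other frequencies is much smaller
  than \<open>2\<^sup>n\<close>.\<close>

lemma block_bound:
  "\<exists>K\<ge>0. \<forall>n G B a c.
    continuous_on UNIV G \<longrightarrow> (\<forall>x. norm (G x) \<le> B) \<longrightarrow>
    (\<forall>k\<in>int_lattice. tcoeff G k \<noteq> 0 \<longrightarrow> symb n k \<noteq> 0) \<longrightarrow>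
    norm (\<Sum>z\<in>freqs n. \<Sum>y\<in>freqs n. a z * c y * tcoeff G (- (z + y)) * complex_of_real (near n y - low n z))
      \<le> K * B * wnorm (Suc m) n a * wnorm (Suc m) n c"
proof -
  \<comment> \<open>The argument is doubled because symbol number \<open>n\<close> is
    \<open>\<rho>\<close> at scale \<open>2 ^ (n - 1)\<close>, while everything below is scaled by
    \<open>2 ^ n\<close>.\<close>
  define U where "U = {x :: real ^ 'n. \<rho> (2 *\<^sub>R x) \<noteq> 0}"
  have U: "open U"
    unfolding U_def
    by (intro open_Collect_neq continuous_intros continuous_on_compose2[OF smooth_imp_continuous_on[OF smooth_rho]]) auto
  \<comment> \<open>For \<open>n \<ge> 2\<close> these are \<open>near n\<close> and
    \<open>low n\<close> after scaling by \<open>2 ^ n\<close>; on \<open>U\<close> they equal 1 and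
    0.\<close>
  define \<Phi>1 where "\<Phi>1 x = chi ((1 / 2) *\<^sub>R x) - chi (4 *\<^sub>R x)" for x
  define \<Phi>2 where "\<Phi>2 x = chi (4 *\<^sub>R x)" for x
  have sm2: "smooth \<Phi>2" unfolding \<Phi>2_def[abs_def] using smooth_affine[OF smooth_chi, of 4 0] by simp
  have sm1: "smooth \<Phi>1" unfolding \<Phi>1_def[abs_def]
    using smooth_diff[OF smooth_affine[OF smooth_chi, of "1/2" 0] smooth_affine[OF smooth_chi, of 4 0]] by simp
  have ev1: "\<Phi>1 (- x) = \<Phi>1 x" and ev2: "\<Phi>2 (- x) = \<Phi>2 x" for x
    unfolding \<Phi>1_def \<Phi>2_def by (intro arg_cong2[where f = "(-)"] radial; simp)+
  have U1: "\<Phi>1 x = 1" and U2: "\<Phi>2 x = 0" if "x \<in> U" for x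
    using chi_on_rho_support[of "2 *\<^sub>R x"] that by (auto simp: U_def \<Phi>1_def \<Phi>2_def)
  have supp2: "norm x \<le> 2 * R" if "\<Phi>2 x \<noteq> 0" for x
    using chi_supp[of "4 *\<^sub>R x"] that R_pos norm_ge_zero[of x] unfolding \<Phi>2_def norm_scaleR by linarith
  have supp1: "norm x \<le> 2 * R" if "\<Phi>1 x \<noteq> 0" for x
  proof -
    have "chi ((1 / 2) *\<^sub>R x) \<noteq> 0 \<or> chi (4 *\<^sub>R x) \<noteq> 0" using that by (auto simp: \<Phi>1_def)
    then show ?thesis
      using chi_supp[of "(1/2) *\<^sub>R x"] supp2[of x] by (auto simp: \<Phi>2_def)
  qed
  obtain K1 where K1: "K1 \<ge> 0" and b1: "\<And>s G B Z1 Z2 a c. \<lbrakk>finite Z1; Z1 \<subseteq> int_lattice; finite Z2; Z2 \<subseteq> int_lattice;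
      continuous_on UNIV G; \<forall>x. norm (G x) \<le> B;
      \<forall>k\<in>int_lattice. tcoeff G k \<noteq> 0 \<longrightarrow> s *\<^sub>R k \<in> U \<and> norm (s *\<^sub>R k) \<le> 3 * R;
      \<forall>z\<in>Z1. norm (s *\<^sub>R z) \<le> 3 * R\<rbrakk> \<Longrightarrow>
    norm (\<Sum>z\<in>Z1. \<Sum>y\<in>Z2. a z * c y * tcoeff G (- (z + y)) * complex_of_real (\<Phi>1 (s *\<^sub>R y) - 1))
      \<le> K1 * B * sqrt (\<Sum>z\<in>Z1. (norm (s *\<^sub>R z) ^ Suc m * norm (a z))\<^sup>2) * sqrt (\<Sum>y\<in>Z2. (norm (c y))\<^sup>2)"
    apply (rule flat_multiplier_bound[where m = m and L = "3 * R", OF sm1 supp1 ev1 U U1])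
      apply assumption+
    subgoal premises p for K
      by (rule p(1)[OF p(2,3)])
    done
  obtain K2 where K2: "K2 \<ge> 0" and b2: "\<And>s G B Z1 Z2 a c. \<lbrakk>finite Z1; Z1 \<subseteq> int_lattice; finite Z2; Z2 \<subseteq> int_lattice;
      continuous_on UNIV G; \<forall>x. norm (G x) \<le> B;
      \<forall>k\<in>int_lattice. tcoeff G k \<noteq> 0 \<longrightarrow> s *\<^sub>R k \<in> U \<and> norm (s *\<^sub>R k) \<le> 3 * R;
      \<forall>z\<in>Z1. norm (s *\<^sub>R z) \<le> 3 * R\<rbrakk> \<Longrightarrow>
    norm (\<Sum>z\<in>Z1. \<Sum>y\<in>Z2. a z * c y * tcoeff G (- (z + y)) * complex_of_real (\<Phi>2 (s *\<^sub>R y) - 0))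
      \<le> K2 * B * sqrt (\<Sum>z\<in>Z1. (norm (s *\<^sub>R z) ^ Suc m * norm (a z))\<^sup>2) * sqrt (\<Sum>y\<in>Z2. (norm (c y))\<^sup>2)"
    apply (rule flat_multiplier_bound[where m = m and L = "3 * R", OF sm2 supp2 ev2 U U2])
      apply assumption+
    subgoal premises p for K
      by (rule p(1)[OF p(2,3)])
    done
  \<comment> \<open>The first summand handles \<open>n \<le> 1\<close>, where
    \<open>jap k / 4 ^ n\<close> is at least 1/4; the second handles scaled frequencies above the
    threshold \<open>r / 8\<close>.\<close>
  define H where "H = 2 ^ Suc m + (8 / r) ^ Suc m"
  have H: "H \<ge> 0" "H \<ge> 2 ^ Suc m" "H \<ge> (8 / r) ^ Suc m" using r by (auto simp: H_def)
  have low_freq: "(norm ((1 / 2 ^ n) *\<^sub>R k) ^ Suc m)\<^sup>2 \<le> 1\<^sup>2 * (jap k / 4 ^ n) ^ Suc m" for n and k :: "real ^ 'n"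
  proof -
    have "norm k \<le> 2 * pi * norm k"
      using mult_right_mono[of 1 "2 * pi" "norm k"] pi_ge_two by simp
    then have "(norm k)\<^sup>2 \<le> (2 * pi * norm k)\<^sup>2" by (rule power_mono) simp
    then have "(norm k)\<^sup>2 \<le> jap k" unfolding jap_def by linarith
    then have "(norm k)\<^sup>2 / 4 ^ n \<le> jap k / 4 ^ n" by (rule divide_right_mono) simp
    moreover have "((2::real) ^ n)\<^sup>2 = 4 ^ n" by (simp add: power2_eq_square flip: power_mult_distrib)
    ultimately have "(norm ((1 / 2 ^ n) *\<^sub>R k))\<^sup>2 \<le> jap k / 4 ^ n"
      by (simp add: power_divide)
    then have "((norm ((1 / 2 ^ n) *\<^sub>R k))\<^sup>2) ^ Suc m \<le> (jap k / 4 ^ n) ^ Suc m"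
      by (rule power_mono) simp
    then show ?thesis
      unfolding power_mult[symmetric] one_power2 mult_1 mult.commute[of "Suc m"] .
  qed
  show ?thesis
  proof (intro exI[of _ "K1 * (1 * H) + K2 * (1 * H) + 2 * (H * H)"] conjI allI impI)
    show "0 \<le> K1 * (1 * H) + K2 * (1 * H) + 2 * (H * H)" using K1 K2 H by simp
    fix n :: nat and G :: "real ^ 'n \<Rightarrow> complex" and B and a c :: "real ^ 'n \<Rightarrow> complex"
    assume G: "continuous_on UNIV G" "\<forall>x. norm (G x) \<le> B"
      and sp: "\<forall>k\<in>int_lattice. tcoeff G k \<noteq> 0 \<longrightarrow> symb n k \<noteq> 0"
    define s where "s = (1 / 2 ^ n :: real)"
    have s: "s > 0" by (simp add: s_def)
    \<comment> \<open>Below \<open>r / 8\<close> both dilates of \<open>chi\<close> equal 1, so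
      \<open>low n\<close> is 1 and \<open>near n\<close> is 0. Two such frequencies add up to less
      than \<open>r / 2\<close>, the least scaled frequency of the block of \<open>g\<close>. For
      \<open>n \<le> 1\<close> every frequency counts as large.\<close>
    define Zl where "Zl = {k \<in> freqs n. 2 \<le> n \<and> norm (s *\<^sub>R k) \<le> r / 8}"
    define Zh where "Zh = freqs n - Zl"
    have Z: "finite Zl" "Zl \<subseteq> int_lattice" "finite Zh" "Zh \<subseteq> int_lattice" "Zl \<subseteq> freqs n" "Zh \<subseteq> freqs n"
      using freqs_subset by (auto simp: Zl_def Zh_def)
    have split: "freqs n = Zl \<union> Zh" "Zl \<inter> Zh = {}" by (auto simp: Zl_def Zh_def)
    have B: "B \<ge> 0" using G(2) norm_ge_zero order_trans by blast
    define E where "E = wnorm (Suc m) n"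
    have E0: "E d \<ge> 0" for d by (simp add: E_def wnorm_nonneg)
    have El: "sqrt (\<Sum>k\<in>Zl. (norm (s *\<^sub>R k) ^ Suc m * norm (d k))\<^sup>2) \<le> 1 * E d" for d
      unfolding E_def s_def using low_freq by (intro sqrt_sum_le_wnorm Z) auto
    have Eh: "sqrt (\<Sum>k\<in>Zh. (norm (d k))\<^sup>2) \<le> H * E d" for d
    proof -
      have "sqrt (\<Sum>k\<in>Zh. (1 * norm (d k))\<^sup>2) \<le> H * E d"
        unfolding E_def
      proof (intro sqrt_sum_le_wnorm Z H(1) conjI)
        fix k assume k: "k \<in> Zh"
        have "1 \<le> H\<^sup>2 * (jap k / 4 ^ n) ^ Suc m"
        proof (cases "n \<le> 1")
          case True
          then have "(4::real) ^ n \<le> 4 ^ 1" by (intro power_increasing) auto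
          then have "1 / 4 \<le> jap k / 4 ^ n"
            using jap_ge_1[of k] by (intro frac_le) auto
          then have "(1 / 4) ^ Suc m \<le> (jap k / 4 ^ n) ^ Suc m" by (intro power_mono) auto
          moreover have "(2 ^ Suc m)\<^sup>2 \<le> H\<^sup>2" using H by (intro power_mono) auto
          ultimately have "(2 ^ Suc m)\<^sup>2 * (1 / 4) ^ Suc m \<le> H\<^sup>2 * (jap k / 4 ^ n) ^ Suc m"
            by (intro mult_mono) auto
          moreover have "(2 ^ Suc m)\<^sup>2 * (1 / 4) ^ Suc m = (1 :: real)"
            by (simp only: power2_eq_square power_mult_distrib[symmetric]) simp
          ultimately show ?thesis by simp
        next
          case False
          then have "r / 8 \<le> norm (s *\<^sub>R k)" using k by (auto simp: Zh_def Zl_def)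
          then have "1 \<le> (8 / r) * norm (s *\<^sub>R k)" using r by (simp add: field_simps)
          then have "1 \<le> ((8 / r) * norm (s *\<^sub>R k)) ^ Suc m" by (rule one_le_power)
          also have "\<dots> \<le> H * norm (s *\<^sub>R k) ^ Suc m"
            unfolding power_mult_distrib using H by (intro mult_right_mono) auto
          finally have "1 \<le> (H * norm (s *\<^sub>R k) ^ Suc m)\<^sup>2" by (intro one_le_power)
          also have "\<dots> \<le> H\<^sup>2 * (jap k / 4 ^ n) ^ Suc m"
            using low_freq[of n k] unfolding power_mult_distrib s_def by (intro mult_left_mono) auto
          finally show ?thesis .
        qed
        then show "1\<^sup>2 \<le> H\<^sup>2 * (jap k / 4 ^ n) ^ Suc m" by simp
      qed auto
      then show ?thesis by simp
    qed
    define T where "T Z1 Z2 = (\<Sum>z\<in>Z1. \<Sum>y\<in>Z2. a z * c y * tcoeff G (- (z + y)) * complex_of_real (near n y - low n z))" for Z1 Z2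
    have sym_s: "symb n k = \<rho> (2 *\<^sub>R (s *\<^sub>R k))" if "n \<ge> 2" for k
      using that by (cases n) (auto simp: symb_Suc s_def)
    have spU: "s *\<^sub>R k \<in> U \<and> norm (s *\<^sub>R k) \<le> 3 * R \<and> r / 2 \<le> norm (s *\<^sub>R k)" if "n \<ge> 2" "k \<in> int_lattice" "tcoeff G k \<noteq> 0" for k
    proof -
      have nz: "\<rho> (2 *\<^sub>R (s *\<^sub>R k)) \<noteq> 0" using sp sym_s[OF that(1)] that(2,3) by auto
      have "r \<le> norm (2 *\<^sub>R (s *\<^sub>R k)) \<and> norm (2 *\<^sub>R (s *\<^sub>R k)) \<le> R" by (rule rho_supp[OF nz])
      then have "r \<le> 2 * norm (s *\<^sub>R k) \<and> 2 * norm (s *\<^sub>R k) \<le> R" by (simp only: norm_scaleR) simp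
      then show ?thesis using R_pos nz by (auto simp: U_def)
    qed
    have low_s: "low n k = \<Phi>2 (s *\<^sub>R k)" and near_s: "near n k = \<Phi>1 (s *\<^sub>R k)" if "n \<ge> 2" for k
    proof -
      define l where "l = n - 2"
      then have l: "n = Suc (Suc l)" using \<open>n \<ge> 2\<close> by linarith
      show "low n k = \<Phi>2 (s *\<^sub>R k)" unfolding l low_Suc_Suc \<Phi>2_def s_def by simp
      then show "near n k = \<Phi>1 (s *\<^sub>R k)"
        unfolding near_eq by (simp add: \<Phi>2_def \<Phi>1_def s_def)
    qed
    have low_1: "low n k = 1" and near_0: "near n k = 0" if "k \<in> Zl" for k
    proof -
      have n: "n \<ge> 2" and k: "norm (s *\<^sub>R k) \<le> r / 8" using that by (auto simp: Zl_def)
      have "norm (4 *\<^sub>R s *\<^sub>R k) < r" "norm ((1 / 2) *\<^sub>R s *\<^sub>R k) < r"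
        using k r unfolding norm_scaleR[of 4] norm_scaleR[of "1/2"] by (simp_all add: field_simps)
      then show "low n k = 1" "near n k = 0"
        using chi_eq_1_near_0 by (simp_all add: low_s[OF n] near_s[OF n] \<Phi>1_def \<Phi>2_def)
    qed
    have freqs_s: "norm (s *\<^sub>R k) \<le> 3 * R" if "k \<in> freqs n" for k
      using that s by (simp add: freqs_def lattice_ball_def s_def field_simps)
    have ll: "T Zl Zl = 0"
      unfolding T_def
    proof (intro sum.neutral ballI)
      fix z y assume zy: "z \<in> Zl" "y \<in> Zl"
      then have n: "n \<ge> 2" by (simp add: Zl_def)
      have "norm (s *\<^sub>R z + s *\<^sub>R y) \<le> r / 8 + r / 8"
        using zy by (intro norm_triangle_mono) (auto simp: Zl_def)
      then have "norm (s *\<^sub>R (- (z + y))) < r / 2"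
        using r norm_minus_cancel[of "s *\<^sub>R z + s *\<^sub>R y"] by (simp add: algebra_simps)
      moreover have "- (z + y) \<in> int_lattice"
        unfolding int_lattice_uminus using zy Z by (intro int_lattice_add) auto
      ultimately have "tcoeff G (- (z + y)) = 0" using spU[OF n, of "- (z + y)"] by fastforce
      then show "a z * c y * tcoeff G (- (z + y)) * complex_of_real (near n y - low n z) = 0" by simp
    qed
    \<comment> \<open>Here \<open>low n z\<close> is 1, exactly the value of \<open>\<Phi>1\<close>
      on \<open>U\<close>, so the symbol is \<open>\<Phi>1\<close> minus its constant.\<close>
    have lh: "norm (T Zl Zh) \<le> K1 * (1 * H) * (B * E a * E c)"
    proof (cases "n \<ge> 2")
      case True
      have "T Zl Zh = (\<Sum>z\<in>Zl. \<Sum>y\<in>Zh. a z * c y * tcoeff G (- (z + y)) * complex_of_real (\<Phi>1 (s *\<^sub>R y) - 1))"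
        unfolding T_def by (intro sum.cong refl) (simp add: near_s[OF True] low_1)
      also have "norm \<dots> \<le> K1 * B * sqrt (\<Sum>z\<in>Zl. (norm (s *\<^sub>R z) ^ Suc m * norm (a z))\<^sup>2) * sqrt (\<Sum>y\<in>Zh. (norm (c y))\<^sup>2)"
        using Z G spU[OF True] freqs_s by (intro b1) auto
      also have "\<dots> \<le> K1 * B * (1 * E a) * (H * E c)"
        using K1 B E0 H El Eh by (intro mult_mono mult_nonneg_nonneg) (auto intro!: sum_nonneg)
      finally show ?thesis by (simp add: mult_ac)
    next
      case False
      then have "Zl = {}" by (auto simp: Zl_def)
      then show ?thesis using K1 B E0 H by (simp add: T_def)
    qed
    \<comment> \<open>Now \<open>near n y\<close> is 0 and the symbol is minus
      \<open>\<Phi>2\<close>, whose constant on \<open>U\<close> is 0. The roles of the two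
      functions are exchanged so that the gain falls on the small frequency
      \<open>y\<close>.\<close>
    have hl: "norm (T Zh Zl) \<le> K2 * (1 * H) * (B * E a * E c)"
    proof (cases "n \<ge> 2")
      case True
      have "T Zh Zl = (\<Sum>z\<in>Zh. \<Sum>y\<in>Zl. - (c y * a z * tcoeff G (- (y + z)) * complex_of_real (\<Phi>2 (s *\<^sub>R z) - 0)))"
        unfolding T_def by (intro sum.cong refl) (simp add: low_s[OF True] near_0 add.commute mult_ac)
      also have "\<dots> = - (\<Sum>y\<in>Zl. \<Sum>z\<in>Zh. c y * a z * tcoeff G (- (y + z)) * complex_of_real (\<Phi>2 (s *\<^sub>R z) - 0))"
        by (subst sum.swap) (simp add: sum_negf)
      also have "norm \<dots> = norm (\<Sum>y\<in>Zl. \<Sum>z\<in>Zh. c y * a z * tcoeff G (- (y + z)) * complex_of_real (\<Phi>2 (s *\<^sub>R z) - 0))"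
        by (rule norm_minus_cancel)
      also have "\<dots> \<le> K2 * B * sqrt (\<Sum>z\<in>Zl. (norm (s *\<^sub>R z) ^ Suc m * norm (c z))\<^sup>2) * sqrt (\<Sum>y\<in>Zh. (norm (a y))\<^sup>2)"
        using Z G spU[OF True] freqs_s by (intro b2) auto
      also have "\<dots> \<le> K2 * B * (1 * E c) * (H * E a)"
        using K2 B E0 H El Eh by (intro mult_mono mult_nonneg_nonneg) (auto intro!: sum_nonneg)
      finally show ?thesis by (simp add: mult_ac)
    next
      case False
      then have "Zl = {}" by (auto simp: Zl_def)
      then show ?thesis using K2 B E0 H by (simp add: T_def)
    qed
    \<comment> \<open>No cancellation is sought: \<open>near n\<close> and \<open>low n\<close> are
      estimated separately, each absorbed into one coefficient sequence as a factor between 0 and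
      1.\<close>
    have hh: "norm (T Zh Zh) \<le> 2 * (H * H) * (B * E a * E c)"
    proof -
      have *: "norm (\<Sum>z\<in>Zh. \<Sum>y\<in>Zh. (a z * of_real (p z)) * (c y * of_real (q y)) * tcoeff G (- (z + y))) \<le> (H * H) * (B * E a * E c)"
        if pq: "\<And>k. 0 \<le> p k \<and> p k \<le> 1" "\<And>k. 0 \<le> q k \<and> q k \<le> 1" for p q :: "real ^ 'n \<Rightarrow> real"
      proof -
        have "norm (\<Sum>z\<in>Zh. \<Sum>y\<in>Zh. (a z * of_real (p z)) * (c y * of_real (q y)) * tcoeff G (- (z + y)))
          \<le> B * sqrt (\<Sum>z\<in>Zh. (norm (a z * of_real (p z)))\<^sup>2) * sqrt (\<Sum>y\<in>Zh. (norm (c y * of_real (q y)))\<^sup>2)"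
          using Z G by (intro trilinear_bound) auto
        also have "\<dots> \<le> B * sqrt (\<Sum>z\<in>Zh. (norm (a z))\<^sup>2) * sqrt (\<Sum>y\<in>Zh. (norm (c y))\<^sup>2)"
          using pq B by (intro mult_mono mult_nonneg_nonneg real_sqrt_le_mono sum_mono power_mono)
            (auto intro!: sum_nonneg mult_left_le simp: norm_mult)
        also have "\<dots> \<le> B * (H * E a) * (H * E c)"
          using B E0 H Eh by (intro mult_mono mult_nonneg_nonneg) (auto intro!: sum_nonneg)
        finally show ?thesis by (simp add: mult_ac)
      qed
      have "T Zh Zh = (\<Sum>z\<in>Zh. \<Sum>y\<in>Zh. (a z * of_real ((\<lambda>_. 1) z)) * (c y * of_real (near n y)) * tcoeff G (- (z + y)))
          - (\<Sum>z\<in>Zh. \<Sum>y\<in>Zh. (a z * of_real (low n z)) * (c y * of_real ((\<lambda>_. 1) y)) * tcoeff G (- (z + y)))"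
        unfolding T_def sum_subtractf[symmetric] by (intro sum.cong refl) (simp add: algebra_simps)
      also have "norm \<dots> \<le> (H * H) * (B * E a * E c) + (H * H) * (B * E a * E c)"
        using near_bounds low_bounds by (intro order_trans[OF norm_triangle_ineq4] add_mono *) auto
      finally show ?thesis by (simp add: mult_ac)
    qed
    have "T (freqs n) (freqs n) = T Zl Zl + T Zl Zh + (T Zh Zl + T Zh Zh)"
      unfolding split(1) T_def using Z split(2)
      by (simp add: sum.union_disjoint sum.distrib)
    then have "norm (T (freqs n) (freqs n)) \<le> norm (T Zl Zh) + (norm (T Zh Zl) + norm (T Zh Zh))"
      unfolding ll by (simp add: norm_add_rule_thm norm_triangle_le norm_triangle_ineq add_mono)
    also have "\<dots> \<le> (K1 * (1 * H) + K2 * (1 * H) + 2 * (H * H)) * B * E a * E c"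
      using lh hl hh by (simp add: algebra_simps)
    finally show "norm (\<Sum>z\<in>freqs n. \<Sum>y\<in>freqs n. a z * c y * tcoeff G (- (z + y)) * complex_of_real (near n y - low n z))
      \<le> (K1 * (1 * H) + K2 * (1 * H) + 2 * (H * H)) * B * wnorm (Suc m) n a * wnorm (Suc m) n c"
      by (simp add: T_def E_def)
  qed
qed

end


section \<open>Blocks of test functions\<close>

lemma tcoeff_uminus_real: "tcoeff (\<lambda>x. of_real (f x)) (- k) = cnj (tcoeff (\<lambda>x. of_real (f x)) k)"
proof -
  have "cnj (LINT x|torus_measure. of_real (f x) * echar (- k) x) = (LINT x|torus_measure. cnj (of_real (f x) * echar (- k) x))"
    by (rule Bochner_Integration.integral_cnj[symmetric])
  then show ?thesis unfolding tcoeff_def by (simp add: cnj_echar del: Bochner_Integration.integral_cnj)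
qed

context littlewood_paley
begin

definition block :: "nat \<Rightarrow> 'n distr \<Rightarrow> real ^ 'n \<Rightarrow> real" where
  "block n = lp_block chi \<rho> (int n - 1)"

lemma block_eq_finite:
  "block n u x = Re (\<Sum>k\<in>lattice_ball (R * 2 ^ n). of_real (symb n k) * fourier_coeff u k * echar k x)"
proof -
  have "(\<Sum>\<^sub>\<infinity>k\<in>int_lattice. of_real (symb n k) * fourier_coeff u k * echar k x) =
      (\<Sum>\<^sub>\<infinity>k\<in>lattice_ball (R * 2 ^ n). of_real (symb n k) * fourier_coeff u k * echar k x)"
    using symb_supp by (intro infsum_cong_neutral) (auto simp: lattice_ball_def)
  then show ?thesis
    by (simp add: block_def lp_block_def echar_def symb_def)
qed

lemma block_bounded: "bdd_above (range (\<lambda>x. \<bar>block n u x\<bar>))"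
proof (rule bdd_aboveI2)
  fix x
  have "\<bar>block n u x\<bar> \<le> norm (\<Sum>k\<in>lattice_ball (R * 2 ^ n). of_real (symb n k) * fourier_coeff u k * echar k x)"
    unfolding block_eq_finite by (rule abs_Re_le_cmod)
  also have "\<dots> \<le> (\<Sum>k\<in>lattice_ball (R * 2 ^ n). norm (of_real (symb n k) * fourier_coeff u k))"
    by (rule order_trans[OF norm_sum]) (simp add: norm_mult)
  finally show "\<bar>block n u x\<bar> \<le> (\<Sum>k\<in>lattice_ball (R * 2 ^ n). norm (of_real (symb n k) * fourier_coeff u k))" .
qed

lemma abs_block_le_sup_norm: "\<bar>block n u x\<bar> \<le> sup_norm (block n u)"
  unfolding sup_norm_def by (rule cSUP_upper[OF UNIV_I block_bounded])

lemma sup_norm_block_le: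
  assumes "g \<in> besov_space chi \<rho> \<beta>"
  shows "sup_norm (block n g) \<le> besov_norm chi \<rho> \<beta> g * 2 powr (- (real n - 1) * \<beta>)"
proof -
  have "2 powr (of_int (int n - 1) * \<beta>) * sup_norm (lp_block chi \<rho> (int n - 1) g) \<le> besov_norm chi \<rho> \<beta> g"
    unfolding besov_norm_def using assms by (intro cSUP_upper) (auto simp: besov_space_def)
  then have "2 powr (- (real n - 1) * \<beta>) * (2 powr ((real n - 1) * \<beta>) * sup_norm (block n g)) \<le> 2 powr (- (real n - 1) * \<beta>) * besov_norm chi \<rho> \<beta> g"
    by (intro mult_left_mono) (auto simp: block_def)
  moreover have "(2::real) powr (- (real n - 1) * \<beta>) * 2 powr ((real n - 1) * \<beta>) = 1"
    unfolding powr_add[symmetric] distrib_right[symmetric] by simp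
  ultimately show ?thesis
    by (simp only: mult.assoc[symmetric] mult_1) (simp add: mult_ac)
qed

lemma besov_norm_nonneg:
  assumes "g \<in> besov_space chi \<rho> \<beta>"
  shows "0 \<le> besov_norm chi \<rho> \<beta> g"
proof -
  have "0 \<le> sup_norm (block 0 g)"
    using abs_block_le_sup_norm[of 0 g 0] by linarith
  then have "0 \<le> besov_norm chi \<rho> \<beta> g * 2 powr (- (real 0 - 1) * \<beta>)"
    using sup_norm_block_le[OF assms, of 0] by linarith
  then show ?thesis by (simp add: zero_le_mult_iff)
qed

lemma symb_uminus: "symb n (- k) = symb n k"
  by (cases n) (auto simp: symb_0 symb_Suc intro!: radial)

text \<open>The symmetry under \<open>k \<mapsto> - k\<close> makes the finite sum real. The radius
  \<open>Q\<close> is left free so that blocks of different indices can be added over a common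
  ball.\<close>

lemma block_distr_of:
  assumes f: "f \<in> test_functions" and Q: "R * 2 ^ n \<le> Q"
  shows "complex_of_real (block n (distr_of f) x) =
    (\<Sum>k\<in>lattice_ball Q. of_real (symb n k) * tcoeff (\<lambda>x. of_real (f x)) k * echar k x)"
proof -
  let ?f = "tcoeff (\<lambda>x. of_real (f x))"
  let ?S = "\<Sum>k\<in>lattice_ball (R * 2 ^ n). of_real (symb n k) * ?f k * echar k x"
  have "cnj ?S = (\<Sum>k\<in>lattice_ball (R * 2 ^ n). of_real (symb n (- k)) * ?f (- k) * echar (- k) x)"
    by (simp add: cnj_echar tcoeff_uminus_real symb_uminus)
  also have "\<dots> = ?S"
    by (rule sum.reindex_bij_witness[of _ uminus uminus]) (auto simp: lattice_ball_def)
  finally have "?S \<in> \<real>" unfolding Reals_cnj_iff .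
  then have "complex_of_real (Re ?S) = ?S" by (rule of_real_Re)
  moreover have "block n (distr_of f) x = Re ?S"
    unfolding block_eq_finite
    by (intro arg_cong[where f = Re] sum.cong refl) (simp add: fourier_coeff_distr_of[OF f] lattice_ball_def)
  moreover have "?S = (\<Sum>k\<in>lattice_ball Q. of_real (symb n k) * ?f k * echar k x)"
    using symb_supp Q by (intro sum.mono_neutral_left[OF finite_lattice_ball]) (auto simp: lattice_ball_def)
  ultimately show ?thesis by simp
qed

lemma continuous_on_block:
  assumes f: "f \<in> test_functions"
  shows "continuous_on S (block n (distr_of f))"
proof -
  have "block n (distr_of f) = (\<lambda>x. Re (\<Sum>k\<in>lattice_ball (R * 2 ^ n). of_real (symb n k) * fourier_coeff (distr_of f) k * echar k x))"
    by (simp add: fun_eq_iff block_eq_finite)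
  then show ?thesis by (simp only:) (intro continuous_intros)
qed

lemma tcoeff_block:
  assumes f: "f \<in> test_functions" and l: "l \<in> int_lattice"
  shows "tcoeff (\<lambda>x. of_real (block n (distr_of f) x)) l = of_real (symb n l) * tcoeff (\<lambda>x. of_real (f x)) l"
proof -
  have "tcoeff (\<lambda>x. of_real (block n (distr_of f) x)) l =
      tcoeff (\<lambda>x. \<Sum>k\<in>lattice_ball (R * 2 ^ n). (of_real (symb n k) * tcoeff (\<lambda>x. of_real (f x)) k) * echar k x) l"
    by (simp only: block_distr_of[OF f order_refl])
  also have "\<dots> = (if l \<in> lattice_ball (R * 2 ^ n) then of_real (symb n l) * tcoeff (\<lambda>x. of_real (f x)) l else 0)"
    by (rule tcoeff_trig_poly[OF finite_lattice_ball _ l]) (auto simp: lattice_ball_def)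
  also have "\<dots> = of_real (symb n l) * tcoeff (\<lambda>x. of_real (f x)) l"
    using symb_supp l by (auto simp: lattice_ball_def)
  finally show ?thesis .
qed

text \<open>Only the block of \<open>g\<close> is expanded into characters: it is a finite sum, and
  each character integrates against \<open>f\<close> to a coefficient of \<open>f\<close>. No
  truncation of \<open>f\<close> is involved.\<close>

lemma LINT_test_echar_block:
  assumes f: "f \<in> test_functions" and g: "g \<in> test_functions" and y: "y \<in> lattice_ball (2 * R * 2 ^ n)"
  shows "(LINT x|torus_measure. of_real (f x) * echar y x * of_real (block n (distr_of g) x)) =
    (\<Sum>z\<in>freqs n. tcoeff (\<lambda>x. of_real (f x)) z * tcoeff (\<lambda>x. of_real (block n (distr_of g) x)) (- (z + y)))"
proof -
  let ?f = "tcoeff (\<lambda>x. of_real (f x))" and ?G = "tcoeff (\<lambda>x. of_real (block n (distr_of g) x))"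
  let ?S = "lattice_ball (R * 2 ^ n) :: (real ^ 'n) set"
  have fc: "continuous_on UNIV (\<lambda>x. complex_of_real (f x))"
    by (intro continuous_on_of_real test_functions_continuous f)
  have "(LINT x|torus_measure. of_real (f x) * echar y x * of_real (block n (distr_of g) x)) =
      (LINT x|torus_measure. (\<Sum>k\<in>?S. ?G k * (of_real (f x) * echar (- (- (k + y))) x)))"
  proof (intro Bochner_Integration.integral_cong refl)
    fix x
    have "complex_of_real (block n (distr_of g) x) = (\<Sum>k\<in>?S. ?G k * echar k x)"
      by (subst block_distr_of[OF g order_refl], intro sum.cong refl)
        (simp add: tcoeff_block[OF g] lattice_ball_def)
    then show "of_real (f x) * echar y x * of_real (block n (distr_of g) x) = (\<Sum>k\<in>?S. ?G k * (of_real (f x) * echar (- (- (k + y))) x))"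
      by (simp only: sum_distrib_left echar_add minus_minus) (simp add: mult_ac)
  qed
  also have "\<dots> = (\<Sum>k\<in>?S. ?G k * ?f (- (k + y)))"
    unfolding tcoeff_def[of _ "- (_ + y)"]
    by (subst Bochner_Integration.integral_sum, (intro integrable_torus_measure continuous_intros fc),
        simp only: integral_mult_right_zero)
  also have "\<dots> = (\<Sum>k\<in>?S. ?f (- (k + y)) * ?G (- (- (k + y) + y)))"
    by (simp add: mult.commute)
  also have "\<dots> = (\<Sum>z\<in>(\<lambda>k. - (k + y)) ` ?S. ?f z * ?G (- (z + y)))"
    by (subst sum.reindex) (auto simp: inj_on_def)
  also have "\<dots> = (\<Sum>z\<in>freqs n. ?f z * ?G (- (z + y)))"
  proof (rule sum.mono_neutral_left)
    show "(\<lambda>k. - (k + y)) ` ?S \<subseteq> freqs n"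
    proof
      fix z assume "z \<in> (\<lambda>k. - (k + y)) ` ?S"
      then obtain k where k: "k \<in> ?S" "z = - (k + y)" by blast
      have "k + y \<in> int_lattice" using k y by (auto simp: lattice_ball_def intro: int_lattice_add)
      moreover have "norm (k + y) \<le> R * 2 ^ n + 2 * R * 2 ^ n"
        using k y by (intro norm_triangle_mono) (auto simp: lattice_ball_def)
      ultimately show "z \<in> freqs n"
        unfolding k(2) freqs_def lattice_ball_def mem_Collect_eq int_lattice_uminus norm_minus_cancel by simp
    qed
    show "\<forall>z\<in>freqs n - (\<lambda>k. - (k + y)) ` ?S. ?f z * ?G (- (z + y)) = 0"
    proof
      fix z assume z: "z \<in> freqs n - (\<lambda>k. - (k + y)) ` ?S"
      have lat: "- (z + y) \<in> int_lattice"
        unfolding int_lattice_uminus using z y by (auto simp: freqs_def lattice_ball_def intro: int_lattice_add)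
      have "z = - (- (z + y) + y)" by simp
      then have "- (z + y) \<notin> ?S" using z by blast
      then have "symb n (- (z + y)) = 0" using symb_supp lat unfolding lattice_ball_def by blast
      then show "?f z * ?G (- (z + y)) = 0" by (simp only: tcoeff_block[OF g lat]) simp
    qed
  qed simp
  finally show ?thesis .
qed

section \<open>The defect of a single block in terms of Fourier coefficients\<close>

definition near_part :: "nat \<Rightarrow> (real ^ 'n \<Rightarrow> real) \<Rightarrow> real ^ 'n \<Rightarrow> real" where
  "near_part n h x = (\<Sum>i\<in>{n - 1..Suc n}. block i (distr_of h) x)"

definition low_part :: "nat \<Rightarrow> (real ^ 'n \<Rightarrow> real) \<Rightarrow> real ^ 'n \<Rightarrow> real" where
  "low_part n f x = (\<Sum>i<n - 1. block i (distr_of f) x)"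

lemma continuous_on_parts:
  assumes "f \<in> test_functions"
  shows "continuous_on S (near_part n f)" "continuous_on S (low_part n f)"
  unfolding near_part_def[abs_def] low_part_def[abs_def]
  by (intro continuous_intros continuous_on_block assms)+

lemma near_part_eq:
  assumes "h \<in> test_functions"
  shows "of_real (near_part n h x) = (\<Sum>y\<in>lattice_ball (2 * R * 2 ^ n). of_real (near n y) * tcoeff (\<lambda>x. of_real (h x)) y * echar y x)"
proof -
  have "complex_of_real (block i (distr_of h) x) = (\<Sum>k\<in>lattice_ball (2 * R * 2 ^ n). of_real (symb i k) * tcoeff (\<lambda>x. of_real (h x)) k * echar k x)"
    if "i \<in> {n - 1..Suc n}" for i
  proof (rule block_distr_of[OF assms])
    have "R * 2 ^ i \<le> R * 2 ^ Suc n" using that R_pos by (intro mult_left_mono power_increasing) auto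
    then show "R * 2 ^ i \<le> 2 * R * 2 ^ n" by simp
  qed
  then have "of_real (near_part n h x) = (\<Sum>i\<in>{n - 1..Suc n}. \<Sum>k\<in>lattice_ball (2 * R * 2 ^ n). of_real (symb i k) * tcoeff (\<lambda>x. of_real (h x)) k * echar k x)"
    unfolding near_part_def of_real_sum by (intro sum.cong refl)
  then show ?thesis
    by (subst (asm) sum.swap) (simp only: near_def of_real_sum sum_distrib_right)
qed

lemma low_part_eq:
  assumes "f \<in> test_functions"
  shows "of_real (low_part n f x) = (\<Sum>z\<in>lattice_ball (2 * R * 2 ^ n). of_real (low n z) * tcoeff (\<lambda>x. of_real (f x)) z * echar z x)"
proof -
  have "complex_of_real (block i (distr_of f) x) = (\<Sum>k\<in>lattice_ball (2 * R * 2 ^ n). of_real (symb i k) * tcoeff (\<lambda>x. of_real (f x)) k * echar k x)"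
    if "i \<in> {..<n - 1}" for i
  proof (rule block_distr_of[OF assms])
    have "R * 2 ^ i \<le> R * 2 ^ Suc n" using that R_pos by (intro mult_left_mono power_increasing) auto
    then show "R * 2 ^ i \<le> 2 * R * 2 ^ n" by simp
  qed
  then have "of_real (low_part n f x) = (\<Sum>i\<in>{..<n - 1}. \<Sum>k\<in>lattice_ball (2 * R * 2 ^ n). of_real (symb i k) * tcoeff (\<lambda>x. of_real (f x)) k * echar k x)"
    unfolding low_part_def of_real_sum by (intro sum.cong refl)
  then show ?thesis
    by (subst (asm) sum.swap) (simp only: low_def of_real_sum sum_distrib_right)
qed

text \<open>Covers both halves of the defect: \<open>near n\<close> acting on \<open>h\<close> and
  tested with \<open>f\<close>, and \<open>low n\<close> acting on \<open>f\<close> and tested with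
  \<open>h\<close>.\<close>

lemma LINT_multiplier_block:
  assumes f: "f \<in> test_functions" and g: "g \<in> test_functions"
    and P: "\<And>x. of_real (P x) = (\<Sum>y\<in>lattice_ball (2 * R * 2 ^ n). of_real (p y) * c y * echar y x)"
    and p: "\<And>y. p y \<noteq> 0 \<Longrightarrow> norm y \<le> 2 * R * 2 ^ n"
  shows "of_real (LINT x|torus_measure. f x * (P x * block n (distr_of g) x)) =
    (\<Sum>z\<in>freqs n. \<Sum>y\<in>freqs n. tcoeff (\<lambda>x. of_real (f x)) z * c y * tcoeff (\<lambda>x. of_real (block n (distr_of g) x)) (- (z + y)) * of_real (p y))"
proof -
  let ?f = "tcoeff (\<lambda>x. of_real (f x))" and ?G = "tcoeff (\<lambda>x. of_real (block n (distr_of g) x))"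
  let ?S = "lattice_ball (2 * R * 2 ^ n) :: (real ^ 'n) set"
  have cont: "continuous_on UNIV (\<lambda>x. complex_of_real (f x))" "continuous_on UNIV (\<lambda>x. complex_of_real (block n (distr_of g) x))"
    by (intro continuous_on_of_real test_functions_continuous continuous_on_block f g)+
  have "complex_of_real (LINT x|torus_measure. f x * (P x * block n (distr_of g) x)) =
      (LINT x|torus_measure. (\<Sum>y\<in>?S. of_real (p y) * c y * (of_real (f x) * echar y x * of_real (block n (distr_of g) x))))"
    unfolding integral_complex_of_real[symmetric]
    by (intro Bochner_Integration.integral_cong refl)
      (simp add: P sum_distrib_left sum_distrib_right mult_ac)
  also have "\<dots> = (\<Sum>y\<in>?S. of_real (p y) * c y * (LINT x|torus_measure. of_real (f x) * echar y x * of_real (block n (distr_of g) x)))"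
    by (subst Bochner_Integration.integral_sum, (intro integrable_torus_measure continuous_intros cont),
        simp only: integral_mult_right_zero)
  also have "\<dots> = (\<Sum>y\<in>?S. of_real (p y) * c y * (\<Sum>z\<in>freqs n. ?f z * ?G (- (z + y))))"
    by (intro sum.cong refl) (simp only: LINT_test_echar_block[OF f g])
  also have "\<dots> = (\<Sum>y\<in>freqs n. of_real (p y) * c y * (\<Sum>z\<in>freqs n. ?f z * ?G (- (z + y))))"
  proof (rule sum.mono_neutral_left)
    show "?S \<subseteq> freqs n" using R_pos by (auto simp: freqs_def lattice_ball_def intro: order_trans)
    show "\<forall>y\<in>freqs n - ?S. of_real (p y) * c y * (\<Sum>z\<in>freqs n. ?f z * ?G (- (z + y))) = 0"
      using p by (auto simp: freqs_def lattice_ball_def)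
  qed simp
  also have "\<dots> = (\<Sum>z\<in>freqs n. \<Sum>y\<in>freqs n. ?f z * c y * ?G (- (z + y)) * of_real (p y))"
    by (subst sum.swap) (simp add: sum_distrib_left mult_ac)
  finally show ?thesis .
qed

definition defect :: "nat \<Rightarrow> (real ^ 'n \<Rightarrow> real) \<Rightarrow> (real ^ 'n \<Rightarrow> real) \<Rightarrow> (real ^ 'n \<Rightarrow> real) \<Rightarrow> real" where
  "defect n f g h = (LINT x|torus_measure. f x * (near_part n h x * block n (distr_of g) x))
     - (LINT x|torus_measure. h x * (low_part n f x * block n (distr_of g) x))"

lemma defect_eq:
  assumes f: "f \<in> test_functions" and g: "g \<in> test_functions" and h: "h \<in> test_functions"
  shows "of_real (defect n f g h) = (\<Sum>z\<in>freqs n. \<Sum>y\<in>freqs n.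
    tcoeff (\<lambda>x. of_real (f x)) z * tcoeff (\<lambda>x. of_real (h x)) y *
    tcoeff (\<lambda>x. of_real (block n (distr_of g) x)) (- (z + y)) * of_real (near n y - low n z))"
proof -
  let ?f = "tcoeff (\<lambda>x. of_real (f x))" and ?G = "tcoeff (\<lambda>x. of_real (block n (distr_of g) x))"
    and ?h = "tcoeff (\<lambda>x. of_real (h x))"
  have near: "complex_of_real (LINT x|torus_measure. f x * (near_part n h x * block n (distr_of g) x)) =
      (\<Sum>z\<in>freqs n. \<Sum>y\<in>freqs n. ?f z * ?h y * ?G (- (z + y)) * of_real (near n y))"
    by (rule LINT_multiplier_block[OF f g near_part_eq[OF h] near_supp])
  have "complex_of_real (LINT x|torus_measure. h x * (low_part n f x * block n (distr_of g) x)) =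
      (\<Sum>z\<in>freqs n. \<Sum>y\<in>freqs n. ?h z * ?f y * ?G (- (z + y)) * of_real (low n y))"
  proof (rule LINT_multiplier_block[OF h g low_part_eq[OF f]])
    fix y assume "low n y \<noteq> 0"
    then have "norm y \<le> R * 2 ^ n" by (rule low_supp)
    moreover have "0 < R * 2 ^ n" using R_pos by simp
    ultimately show "norm y \<le> 2 * R * 2 ^ n" by linarith
  qed
  also have "\<dots> = (\<Sum>z\<in>freqs n. \<Sum>y\<in>freqs n. ?f z * ?h y * ?G (- (z + y)) * of_real (low n z))"
    by (subst sum.swap) (simp add: add.commute mult_ac)
  finally show ?thesis
    unfolding defect_def of_real_diff near
    by (simp only: right_diff_distrib sum_subtractf)
qed

end


section \<open>Summation over scales\<close>

lemma geometric_sum_le: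
  fixes q :: real
  assumes "0 \<le> q" "q < 1"
  shows "(\<Sum>n<N. q ^ n) \<le> 1 / (1 - q)"
  using assms by (simp add: sum_gp_strict divide_right_mono)

context littlewood_paley
begin

text \<open>The geometric sum over the scales \<open>4\<^sup>n\<close> above \<open>jap k\<close> converges because the weight exponent
  \<open>M\<close> exceeds \<open>s\<close>.\<close>

lemma sum_scales_le:
  assumes Ms: "s < real M"
  shows "\<exists>C\<ge>0. \<forall>N k. (\<Sum>n\<in>{n. n < N \<and> k \<in> freqs n}. 4 powr (real n * s) * (jap k / 4 ^ n) ^ M) \<le> C * jap k powr s"
proof -
  \<comment> \<open>From the radius \<open>3 * R * 2 ^ n\<close> of \<open>freqs n\<close>: this
    makes \<open>jap k \<le> C1 * 4 ^ n\<close> there.\<close>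
  define C1 where "C1 = 1 + (6 * pi * R)\<^sup>2"
  define d where "d = real M - s"
  have d: "d > 0" using Ms by (simp add: d_def)
  have C1: "C1 > 0" unfolding C1_def by (intro add_pos_nonneg) auto
  define q where "q = (4::real) powr - d"
  have q: "0 \<le> q" "q < 1" using d by (auto simp: q_def powr_less_one)
  have jap_le: "jap k \<le> C1 * 4 ^ n" if "k \<in> freqs n" for k n
  proof -
    have "norm k \<le> 3 * R * 2 ^ n" using that by (simp add: freqs_def lattice_ball_def)
    then have "2 * pi * norm k \<le> 2 * pi * (3 * R * 2 ^ n)" by (intro mult_left_mono) auto
    then have "(2 * pi * norm k)\<^sup>2 \<le> (2 * pi * (3 * R * 2 ^ n))\<^sup>2" by (intro power_mono) auto
    also have "\<dots> = (6 * pi * R)\<^sup>2 * 4 ^ n"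
    proof -
      have "((2::real) ^ n)\<^sup>2 = 4 ^ n" by (simp add: power2_eq_square flip: power_mult_distrib)
      then show ?thesis by (simp add: power_mult_distrib)
    qed
    finally have "(2 * pi * norm k)\<^sup>2 \<le> (6 * pi * R)\<^sup>2 * 4 ^ n" .
    moreover have "1 \<le> (4::real) ^ n" by simp
    ultimately have "1 + (2 * pi * norm k)\<^sup>2 \<le> 1 * 4 ^ n + (6 * pi * R)\<^sup>2 * 4 ^ n" by linarith
    then show ?thesis unfolding jap_def C1_def distrib_right .
  qed
  show ?thesis
  proof (intro exI[of _ "C1 powr d * (1 / (1 - q))"] conjI allI)
    show "C1 powr d * (1 / (1 - q)) \<ge> 0" using q by simp
    fix N :: nat and k :: "real ^ 'n"
    have jap0: "jap k > 0" using jap_ge_1[of k] by linarith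
    define I where "I = {n. n < N \<and> k \<in> freqs n}"
    have fI: "finite I" by (rule finite_subset[of _ "{..<N}"]) (auto simp: I_def)
    have term_eq: "4 powr (real n * s) * (jap k / 4 ^ n) ^ M = jap k powr s * (jap k / 4 ^ n) powr d" for n
    proof -
      have "(jap k / 4 ^ n) ^ M = (jap k / 4 ^ n) powr (s + d)"
        using jap0 by (simp add: d_def powr_realpow)
      also have "\<dots> = (jap k powr s / 4 powr (real n * s)) * (jap k / 4 ^ n) powr d"
        using jap0 by (simp add: powr_add powr_divide powr_powr flip: powr_realpow)
      finally show ?thesis by simp
    qed
    have "(\<Sum>n\<in>I. (jap k / 4 ^ n) powr d) \<le> C1 powr d * (1 / (1 - q))"
    proof (cases "I = {}")
      case False
      \<comment> \<open>The first scale that sees \<open>k\<close>. From there on the terms fall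
        geometrically with ratio \<open>q\<close>, and the value at \<open>n0\<close> is bounded
        independently of \<open>k\<close>.\<close>
      define n0 where "n0 = Min I"
      have n0: "n0 \<in> I" "\<And>n. n \<in> I \<Longrightarrow> n0 \<le> n" using fI False by (auto simp: n0_def)
      have "(jap k / 4 ^ n) powr d \<le> C1 powr d * q ^ (n - n0)" if "n \<in> I" for n
      proof -
        have "jap k / 4 ^ n \<le> C1 * 4 ^ n0 / 4 ^ n"
          using jap_le[of k n0] n0(1) by (intro divide_right_mono) (auto simp: I_def)
        also have "\<dots> = C1 / 4 ^ (n - n0)"
          using n0(2)[OF that] by (simp add: power_diff)
        finally have "(jap k / 4 ^ n) powr d \<le> (C1 / 4 ^ (n - n0)) powr d"
          using jap0 d by (intro powr_mono2) auto
        also have "\<dots> = C1 powr d * 4 powr (- (real (n - n0) * d))"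
        proof -
          have "((4::real) ^ (n - n0)) powr d = 4 powr (real (n - n0) * d)"
            by (simp add: powr_powr flip: powr_realpow)
          moreover have "(C1 / 4 ^ (n - n0)) powr d = C1 powr d / (4 ^ (n - n0)) powr d"
            by (rule powr_divide)
          ultimately show ?thesis by (simp add: powr_minus_divide)
        qed
        also have "4 powr (- (real (n - n0) * d)) = q ^ (n - n0)"
        proof -
          have "q ^ (n - n0) = q powr real (n - n0)" by (simp add: powr_realpow q_def)
          then show ?thesis by (simp add: q_def powr_powr mult.commute)
        qed
        finally show ?thesis .
      qed
      then have "(\<Sum>n\<in>I. (jap k / 4 ^ n) powr d) \<le> (\<Sum>n\<in>I. C1 powr d * q ^ (n - n0))"
        by (rule sum_mono)
      also have "\<dots> \<le> (\<Sum>n\<in>{n0..<n0 + N}. C1 powr d * q ^ (n - n0))"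
        using q n0(2) by (intro sum_mono2) (auto simp: I_def intro: trans_less_add2)
      also have "\<dots> = C1 powr d * (\<Sum>n<N. q ^ n)"
        by (subst sum.atLeastLessThan_shift_0) (simp add: sum_distrib_left atLeast0LessThan)
      also have "\<dots> \<le> C1 powr d * (1 / (1 - q))"
        by (intro mult_left_mono geometric_sum_le q) auto
      finally show ?thesis .
    qed (use q in simp)
    then have "jap k powr s * (\<Sum>n\<in>I. (jap k / 4 ^ n) powr d) \<le> jap k powr s * (C1 powr d * (1 / (1 - q)))"
      by (rule mult_left_mono) simp
    then show "(\<Sum>n\<in>{n. n < N \<and> k \<in> freqs n}. 4 powr (real n * s) * (jap k / 4 ^ n) ^ M) \<le> C1 powr d * (1 / (1 - q)) * jap k powr s"
      unfolding term_eq I_def[symmetric] sum_distrib_left[symmetric] by (simp add: mult_ac)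
  qed
qed

text \<open>Exchanging the sums over scales and frequencies leaves the scale sum for each fixed
  \<open>k\<close>, which is a multiple of the Sobolev weight. The bound is uniform in
  \<open>N\<close>, so it survives the passage to infinitely many blocks.\<close>

lemma sum_wnorm_le:
  assumes Ms: "s < real M"
  shows "\<exists>C\<ge>0. \<forall>N a. (\<lambda>k. jap k powr s * (norm (a k))\<^sup>2) summable_on int_lattice \<longrightarrow>
    (\<Sum>n<N. (2 powr (real n * s) * wnorm M n a)\<^sup>2) \<le> C * (\<Sum>\<^sub>\<infinity>k\<in>int_lattice. jap k powr s * (norm (a k))\<^sup>2)"
proof -
  obtain C where C: "C \<ge> 0" "\<And>N k. (\<Sum>n\<in>{n. n < N \<and> k \<in> freqs n}. 4 powr (real n * s) * (jap k / 4 ^ n) ^ M) \<le> C * jap k powr s"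
    using sum_scales_le[OF Ms] by (elim exE conjE) (rule that, assumption, elim allE)
  show ?thesis
  proof (intro exI[of _ C] conjI allI impI C(1))
    fix N and a :: "real ^ 'n \<Rightarrow> complex"
    assume sm: "(\<lambda>k. jap k powr s * (norm (a k))\<^sup>2) summable_on int_lattice"
    define F where "F = (\<Union>n<N. freqs n)"
    have F: "finite F" "F \<subseteq> int_lattice" using freqs_subset by (auto simp: F_def)
    have pos: "0 \<le> (jap k / 4 ^ n) ^ M * (norm (a k))\<^sup>2" for k n
      using jap_ge_1[of k] by simp
    have "(2 powr (real n * s) * wnorm M n a)\<^sup>2 = (\<Sum>k\<in>freqs n. 4 powr (real n * s) * (jap k / 4 ^ n) ^ M * (norm (a k))\<^sup>2)" for n
    proof -
      have "(2 powr (real n * s))\<^sup>2 = (4::real) powr (real n * s)"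
        by (simp add: power2_eq_square flip: powr_mult)
      then show ?thesis
        unfolding wnorm_def power_mult_distrib
        by (simp add: sum_nonneg pos sum_distrib_left mult.assoc)
    qed
    then have "(\<Sum>n<N. (2 powr (real n * s) * wnorm M n a)\<^sup>2) =
        (\<Sum>n<N. \<Sum>k\<in>F. if k \<in> freqs n then 4 powr (real n * s) * (jap k / 4 ^ n) ^ M * (norm (a k))\<^sup>2 else 0)"
      using F by (simp add: sum.inter_filter[symmetric]) (intro sum.cong; auto simp: F_def)
    also have "\<dots> = (\<Sum>k\<in>F. \<Sum>n<N. if k \<in> freqs n then 4 powr (real n * s) * (jap k / 4 ^ n) ^ M * (norm (a k))\<^sup>2 else 0)"
      by (rule sum.swap)
    also have "\<dots> = (\<Sum>k\<in>F. (\<Sum>n\<in>{n. n < N \<and> k \<in> freqs n}. 4 powr (real n * s) * (jap k / 4 ^ n) ^ M) * (norm (a k))\<^sup>2)"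
      by (simp add: sum.inter_filter[symmetric] sum_distrib_right)
    also have "\<dots> \<le> (\<Sum>k\<in>F. C * jap k powr s * (norm (a k))\<^sup>2)"
      by (intro sum_mono mult_right_mono C) auto
    also have "\<dots> = C * (\<Sum>k\<in>F. jap k powr s * (norm (a k))\<^sup>2)"
      by (simp add: sum_distrib_left mult.assoc)
    also have "\<dots> \<le> C * (\<Sum>\<^sub>\<infinity>k\<in>int_lattice. jap k powr s * (norm (a k))\<^sup>2)"
      using F C(1) by (intro mult_left_mono finite_sum_le_infsum sm) auto
    finally show "(\<Sum>n<N. (2 powr (real n * s) * wnorm M n a)\<^sup>2) \<le> C * (\<Sum>\<^sub>\<infinity>k\<in>int_lattice. jap k powr s * (norm (a k))\<^sup>2)" .
  qed
qed

lemma sobolev_norm_distr_of: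
  assumes f: "f \<in> test_functions" and s: "distr_of f \<in> sobolev_space s"
  shows "(\<lambda>k. jap k powr s * (norm (tcoeff (\<lambda>x. of_real (f x)) k))\<^sup>2) summable_on int_lattice"
    and "sobolev_norm s (distr_of f) = sqrt (\<Sum>\<^sub>\<infinity>k\<in>int_lattice. jap k powr s * (norm (tcoeff (\<lambda>x. of_real (f x)) k))\<^sup>2)"
proof -
  have eq: "sobolev_weight s k * (cmod (fourier_coeff (distr_of f) k))\<^sup>2 = jap k powr s * (norm (tcoeff (\<lambda>x. of_real (f x)) k))\<^sup>2"
    if "k \<in> int_lattice" for k
    using fourier_coeff_distr_of[OF f that] by (simp add: sobolev_weight_def jap_def)
  show "(\<lambda>k. jap k powr s * (norm (tcoeff (\<lambda>x. of_real (f x)) k))\<^sup>2) summable_on int_lattice"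
    using s eq by (simp add: sobolev_space_def cong: summable_on_cong)
  show "sobolev_norm s (distr_of f) = sqrt (\<Sum>\<^sub>\<infinity>k\<in>int_lattice. jap k powr s * (norm (tcoeff (\<lambda>x. of_real (f x)) k))\<^sup>2)"
    unfolding sobolev_norm_def by (intro arg_cong[where f = sqrt] infsum_cong eq)
qed

lemma sum_defect_le:
  assumes "\<alpha> + \<beta> + \<gamma> \<ge> 0"
  obtains C where "C \<ge> 0" "\<And>f g h N. \<lbrakk>f \<in> test_functions; g \<in> test_functions; h \<in> test_functions;
      distr_of f \<in> sobolev_space \<alpha>; distr_of g \<in> besov_space chi \<rho> \<beta>; distr_of h \<in> sobolev_space \<gamma>\<rbrakk> \<Longrightarrow>
    (\<Sum>n<N. \<bar>defect n f g h\<bar>) \<le> C * besov_norm chi \<rho> \<beta> (distr_of g) * sobolev_norm \<alpha> (distr_of f) * sobolev_norm \<gamma> (distr_of h)"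
proof -
  obtain m where "max \<alpha> \<gamma> < real m" using reals_Archimedean2 by blast
  then have m: "\<alpha> < real (Suc m)" "\<gamma> < real (Suc m)" by auto
  obtain K where K: "K \<ge> 0" and bb: "\<And>n G B a c. continuous_on UNIV G \<Longrightarrow> (\<forall>x. norm (G x) \<le> B) \<Longrightarrow>
      (\<forall>k\<in>int_lattice. tcoeff G k \<noteq> 0 \<longrightarrow> symb n k \<noteq> 0) \<Longrightarrow>
      norm (\<Sum>z\<in>freqs n. \<Sum>y\<in>freqs n. a z * c y * tcoeff G (- (z + y)) * complex_of_real (near n y - low n z))
      \<le> K * B * wnorm (Suc m) n a * wnorm (Suc m) n c"
    using block_bound[of m] by (elim exE conjE) (rule that, assumption, simp)
  obtain C1 where C1: "C1 \<ge> 0" "\<And>N a. (\<lambda>k. jap k powr \<alpha> * (norm (a k))\<^sup>2) summable_on int_lattice \<Longrightarrow>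
    (\<Sum>n<N. (2 powr (real n * \<alpha>) * wnorm (Suc m) n a)\<^sup>2) \<le> C1 * (\<Sum>\<^sub>\<infinity>k\<in>int_lattice. jap k powr \<alpha> * (norm (a k))\<^sup>2)"
    using sum_wnorm_le[OF m(1)] by (elim exE conjE) (rule that, assumption, simp)
  obtain C2 where C2: "C2 \<ge> 0" "\<And>N a. (\<lambda>k. jap k powr \<gamma> * (norm (a k))\<^sup>2) summable_on int_lattice \<Longrightarrow>
    (\<Sum>n<N. (2 powr (real n * \<gamma>) * wnorm (Suc m) n a)\<^sup>2) \<le> C2 * (\<Sum>\<^sub>\<infinity>k\<in>int_lattice. jap k powr \<gamma> * (norm (a k))\<^sup>2)"
    using sum_wnorm_le[OF m(2)] by (elim exE conjE) (rule that, assumption, simp)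
  show ?thesis
  proof (rule that[of "K * 2 powr \<beta> * (sqrt C1 * sqrt C2)"])
    show "K * 2 powr \<beta> * (sqrt C1 * sqrt C2) \<ge> 0" using K C1 C2 by simp
    fix f g h :: "real ^ 'n \<Rightarrow> real" and N :: nat
    assume f: "f \<in> test_functions" and g: "g \<in> test_functions" and h: "h \<in> test_functions"
      and sf: "distr_of f \<in> sobolev_space \<alpha>" and sg: "distr_of g \<in> besov_space chi \<rho> \<beta>" and sh: "distr_of h \<in> sobolev_space \<gamma>"
    define a where "a = tcoeff (\<lambda>x. of_real (f x))"
    define c where "c = tcoeff (\<lambda>x. of_real (h x))"
    define b where "b = besov_norm chi \<rho> \<beta> (distr_of g)"
    have b0: "b \<ge> 0" unfolding b_def by (rule besov_norm_nonneg[OF sg])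
    define p where "p n = 2 powr (real n * \<alpha>) * wnorm (Suc m) n a" for n
    define q where "q n = 2 powr (real n * \<gamma>) * wnorm (Suc m) n c" for n
    have pq0: "p n \<ge> 0" "q n \<ge> 0" for n by (auto simp: p_def q_def wnorm_nonneg)
    have def: "\<bar>defect n f g h\<bar> \<le> K * 2 powr \<beta> * b * (p n * q n)" for n
    proof -
      let ?G = "\<lambda>x. complex_of_real (block n (distr_of g) x)"
      define B where "B = b * 2 powr (- (real n - 1) * \<beta>)"
      have "\<bar>defect n f g h\<bar> = norm (complex_of_real (defect n f g h))" by simp
      also have "\<dots> \<le> K * B * wnorm (Suc m) n a * wnorm (Suc m) n c"
        unfolding defect_eq[OF f g h] a_def[symmetric] c_def[symmetric]
      proof (rule bb)
        show "continuous_on UNIV ?G" by (intro continuous_on_of_real continuous_on_block g)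
        show "\<forall>x. norm (?G x) \<le> B"
          using order_trans[OF abs_block_le_sup_norm sup_norm_block_le[OF sg, of n]] by (simp add: B_def b_def)
        show "\<forall>k\<in>int_lattice. tcoeff ?G k \<noteq> 0 \<longrightarrow> symb n k \<noteq> 0"
          using tcoeff_block[OF g] by auto
      qed
      also have "\<dots> \<le> K * (b * (2 powr \<beta> * 2 powr (real n * \<alpha>) * 2 powr (real n * \<gamma>))) * wnorm (Suc m) n a * wnorm (Suc m) n c"
      proof (intro mult_right_mono mult_left_mono K wnorm_nonneg)
        \<comment> \<open>The growth of the block norm of \<open>g\<close> is traded for the two
          Sobolev weights; the extra factor \<open>2 powr \<beta>\<close> comes from the shift
          between \<open>n\<close> and the block index \<open>n - 1\<close>.\<close>
        have "0 \<le> real n * (\<alpha> + \<beta> + \<gamma>)" using assms by simp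
        then have "- (real n - 1) * \<beta> \<le> \<beta> + real n * \<alpha> + real n * \<gamma>" by (simp add: algebra_simps)
        then have "2 powr (- (real n - 1) * \<beta>) \<le> (2::real) powr (\<beta> + real n * \<alpha> + real n * \<gamma>)" by simp
        then show "B \<le> b * (2 powr \<beta> * 2 powr (real n * \<alpha>) * 2 powr (real n * \<gamma>))"
          unfolding B_def powr_add by (rule mult_left_mono[OF _ b0])
      qed
      also have "\<dots> = K * 2 powr \<beta> * b * (p n * q n)" by (simp add: p_def q_def mult_ac)
      finally show ?thesis .
    qed
    have "(\<Sum>n<N. \<bar>defect n f g h\<bar>) \<le> (\<Sum>n<N. K * 2 powr \<beta> * b * (p n * q n))"
      by (intro sum_mono def)
    also have "\<dots> = K * 2 powr \<beta> * b * (\<Sum>n<N. p n * q n)" by (simp add: sum_distrib_left)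
    also have "\<dots> \<le> K * 2 powr \<beta> * b * ((sqrt C1 * sobolev_norm \<alpha> (distr_of f)) * (sqrt C2 * sobolev_norm \<gamma> (distr_of h)))"
    proof (intro mult_left_mono)
      have "(\<Sum>n<N. p n * q n) \<le> L2_set p {..<N} * L2_set q {..<N}"
        using L2_set_mult_ineq[of p q "{..<N}"] pq0 by simp
      also have "\<dots> \<le> (sqrt C1 * sobolev_norm \<alpha> (distr_of f)) * (sqrt C2 * sobolev_norm \<gamma> (distr_of h))"
      proof (intro mult_mono L2_set_nonneg)
        show "L2_set p {..<N} \<le> sqrt C1 * sobolev_norm \<alpha> (distr_of f)"
          unfolding L2_set_def sobolev_norm_distr_of(2)[OF f sf] real_sqrt_mult[symmetric] p_def a_def
          by (intro real_sqrt_le_mono C1(2) sobolev_norm_distr_of(1)[OF f sf])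
        show "L2_set q {..<N} \<le> sqrt C2 * sobolev_norm \<gamma> (distr_of h)"
          unfolding L2_set_def sobolev_norm_distr_of(2)[OF h sh] real_sqrt_mult[symmetric] q_def c_def
          by (intro real_sqrt_le_mono C2(2) sobolev_norm_distr_of(1)[OF h sh])
        show "0 \<le> sqrt C1 * sobolev_norm \<alpha> (distr_of f)"
          unfolding sobolev_norm_distr_of(2)[OF f sf] using C1(1) by (auto intro!: infsum_nonneg mult_nonneg_nonneg)
      qed
      finally show "(\<Sum>n<N. p n * q n) \<le> (sqrt C1 * sobolev_norm \<alpha> (distr_of f)) * (sqrt C2 * sobolev_norm \<gamma> (distr_of h))" .
    qed (use K b0 in auto)
    finally show "(\<Sum>n<N. \<bar>defect n f g h\<bar>) \<le> K * 2 powr \<beta> * (sqrt C1 * sqrt C2) * besov_norm chi \<rho> \<beta> (distr_of g) * sobolev_norm \<alpha> (distr_of f) * sobolev_norm \<gamma> (distr_of h)"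
      by (simp add: b_def mult_ac)
  qed
qed

end


section \<open>Resonant product and paraproduct\<close>

lemma infsum_nat_eq_suminf:
  fixes f :: "nat \<Rightarrow> 'a::banach"
  assumes "summable (\<lambda>n. norm (f n))"
  shows "infsum f UNIV = suminf f"
  using norm_summable_imp_has_sum[OF assms summable_sums[OF summable_norm_cancel[OF assms]]]
  by (rule infsumI)

lemma bij_betw_shifted_nat: "bij_betw (\<lambda>n. int n - 1) UNIV {-1..}"
  by (rule bij_betw_byWitness[where f' = "\<lambda>j. nat (j + 1)"]) auto

context littlewood_paley
begin

text \<open>A majorant of the block from absolute values of coefficients. It bounds the block
  uniformly in x and makes the product series absolutely convergent.\<close>

definition block_max :: "nat \<Rightarrow> (real ^ 'n \<Rightarrow> real) \<Rightarrow> real" where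
  "block_max n f = (\<Sum>k\<in>lattice_ball (R * 2 ^ n). symb n k * norm (tcoeff (\<lambda>x. of_real (f x)) k))"

lemma block_max_nonneg: "0 \<le> block_max n f"
  unfolding block_max_def by (intro sum_nonneg mult_nonneg_nonneg symb_nonneg) simp

lemma abs_block_le:
  assumes "f \<in> test_functions"
  shows "\<bar>block n (distr_of f) x\<bar> \<le> block_max n f"
proof -
  have "\<bar>block n (distr_of f) x\<bar> = norm (complex_of_real (block n (distr_of f) x))" by simp
  also have "\<dots> \<le> (\<Sum>k\<in>lattice_ball (R * 2 ^ n). norm (of_real (symb n k) * tcoeff (\<lambda>x. of_real (f x)) k * echar k x))"
    unfolding block_distr_of[OF assms order_refl] by (rule norm_sum)
  finally show ?thesis
    by (simp add: block_max_def norm_mult symb_nonneg)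
qed

text \<open>The symbols are nonnegative and add up to at most 1, so each coefficient is counted with
  total weight at most 1 whatever the index set.\<close>

lemma sum_block_max_le:
  assumes f: "f \<in> test_functions" and I: "finite I"
  shows "(\<Sum>i\<in>I. block_max i f) \<le> (\<Sum>\<^sub>\<infinity>k\<in>int_lattice. norm (tcoeff (\<lambda>x. of_real (f x)) k))"
proof -
  let ?f = "tcoeff (\<lambda>x. of_real (f x))"
  obtain N where N: "I \<subseteq> {..N}" using I by (auto simp: finite_nat_set_iff_bounded_le)
  have sm: "(\<lambda>k. norm (?f k)) summable_on int_lattice"
    using summable_tcoeff[OF f, of 0] by simp
  have "(\<Sum>i\<in>I. block_max i f) \<le> (\<Sum>i\<le>N. block_max i f)"
    using N by (intro sum_mono2) (auto simp: block_max_nonneg)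
  also have "\<dots> \<le> (\<Sum>i\<le>N. \<Sum>k\<in>lattice_ball (R * 2 ^ N). symb i k * norm (?f k))"
    unfolding block_max_def
  proof (intro sum_mono sum_mono2 finite_lattice_ball)
    fix i assume "i \<in> {..N}"
    then have "R * 2 ^ i \<le> R * 2 ^ N" using R_pos by (intro mult_left_mono power_increasing) auto
    then show "lattice_ball (R * 2 ^ i) \<subseteq> (lattice_ball (R * 2 ^ N) :: (real ^ 'n) set)"
      by (auto simp: lattice_ball_def)
  qed (auto simp: symb_nonneg)
  also have "\<dots> = (\<Sum>k\<in>lattice_ball (R * 2 ^ N). chi ((1 / 2 ^ N) *\<^sub>R k) * norm (?f k))"
    by (subst sum.swap) (simp add: sum_symb flip: sum_distrib_right)
  also have "\<dots> \<le> (\<Sum>k\<in>lattice_ball (R * 2 ^ N). norm (?f k))"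
    by (intro sum_mono mult_left_le_one_le chi_nonneg chi_le_1) simp
  also have "\<dots> \<le> (\<Sum>\<^sub>\<infinity>k\<in>int_lattice. norm (?f k))"
    by (rule finite_sum_le_infsum[OF sm finite_lattice_ball]) (auto simp: lattice_ball_def)
  finally show ?thesis .
qed

lemma summable_block_max:
  assumes "f \<in> test_functions"
  shows "summable (\<lambda>n. block_max n f)"
  by (rule summableI_nonneg_bounded[OF block_max_nonneg]) (rule sum_block_max_le[OF assms], simp)

lemma abs_sum_block_le:
  assumes f: "f \<in> test_functions" and I: "finite I"
  shows "\<bar>\<Sum>i\<in>I. block i (distr_of f) x\<bar> \<le> (\<Sum>\<^sub>\<infinity>k\<in>int_lattice. norm (tcoeff (\<lambda>x. of_real (f x)) k))"
proof -
  have "\<bar>\<Sum>i\<in>I. block i (distr_of f) x\<bar> \<le> (\<Sum>i\<in>I. block_max i f)"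
    by (rule order_trans[OF sum_abs]) (intro sum_mono abs_block_le f)
  also have "\<dots> \<le> (\<Sum>\<^sub>\<infinity>k\<in>int_lattice. norm (tcoeff (\<lambda>x. of_real (f x)) k))"
    by (rule sum_block_max_le[OF f I])
  finally show ?thesis .
qed

lemma summable_times_block:
  assumes g: "g \<in> test_functions" and P: "\<And>n. \<bar>P n\<bar> \<le> A"
  shows "summable (\<lambda>n. norm (P n * block n (distr_of g) x))"
proof (rule summable_comparison_test')
  show "summable (\<lambda>n. A * block_max n g)" by (intro summable_mult summable_block_max g)
  show "norm (norm (P n * block n (distr_of g) x)) \<le> A * block_max n g" for n
    using mult_mono[OF P[of n] abs_block_le[OF g, of n x]] order_trans[OF abs_ge_zero P]
    by (simp add: abs_mult)
qed

text \<open>With both indices raised by one, the condition \<open>i \<le> j - 2\<close> becomes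
  membership in \<open>{..<n - 1}\<close>, in agreement with \<open>low_part\<close>.\<close>

lemma paraproduct_eq:
  assumes f: "f \<in> test_functions" and g: "g \<in> test_functions"
  shows "paraproduct chi \<rho> f g x = (\<Sum>n. low_part n f x * block n (distr_of g) x)"
proof -
  have "paraproduct chi \<rho> f g x = (\<Sum>\<^sub>\<infinity>n\<in>UNIV. \<Sum>i\<in>{-1..int n - 1 - 2}.
      lp_block chi \<rho> i (distr_of f) x * block n (distr_of g) x)"
    unfolding paraproduct_def block_def
    by (rule infsum_reindex_bij_betw[OF bij_betw_shifted_nat, symmetric])
  also have "\<dots> = (\<Sum>\<^sub>\<infinity>n\<in>UNIV. low_part n f x * block n (distr_of g) x)"
  proof (intro infsum_cong)
    fix n :: nat
    have "(\<Sum>i\<in>{-1..int n - 1 - 2}. lp_block chi \<rho> i (distr_of f) x * block n (distr_of g) x)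
        = (\<Sum>i<n - 1. block i (distr_of f) x * block n (distr_of g) x)"
      by (rule sum.reindex_bij_witness[of _ "\<lambda>i. int i - 1" "\<lambda>j. nat (j + 1)"]) (auto simp: block_def)
    then show "(\<Sum>i\<in>{-1..int n - 1 - 2}. lp_block chi \<rho> i (distr_of f) x * block n (distr_of g) x)
        = low_part n f x * block n (distr_of g) x"
      by (simp add: low_part_def sum_distrib_right)
  qed
  also have "\<dots> = (\<Sum>n. low_part n f x * block n (distr_of g) x)"
    unfolding low_part_def
    by (intro infsum_nat_eq_suminf summable_times_block[OF g abs_sum_block_le[OF f]]) simp
  finally show ?thesis .
qed

text \<open>Grouping the unordered double sum by the index of \<open>g\<close> needs absolute
  summability. A finite set of pairs lies in the rectangle of its projections, where the sum is at
  most a product of two sums of \<open>block_max\<close>.\<close>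

lemma resonant_eq:
  assumes h: "h \<in> test_functions" and g: "g \<in> test_functions"
  shows "resonant chi \<rho> h g x = (\<Sum>n. near_part n h x * block n (distr_of g) x)"
proof -
  define S where "S = Sigma (UNIV :: nat set) (\<lambda>n. {n - 1..Suc n})"
  define F where "F n i = block i (distr_of h) x * block n (distr_of g) x" for n i
  have bij: "bij_betw (\<lambda>(n, i). (int i - 1, int n - 1)) S {(i, j). -1 \<le> i \<and> -1 \<le> j \<and> \<bar>i - j\<bar> \<le> 1}"
    by (rule bij_betw_byWitness[where f' = "\<lambda>(i, j). (nat (j + 1), nat (i + 1))"]) (auto simp: S_def)
  have "resonant chi \<rho> h g x = (\<Sum>\<^sub>\<infinity>(n, i)\<in>S. F n i)"
    unfolding resonant_def infsum_reindex_bij_betw[OF bij, symmetric]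
    by (rule infsum_cong) (auto simp: F_def block_def)
  also have "\<dots> = (\<Sum>\<^sub>\<infinity>n\<in>UNIV. \<Sum>\<^sub>\<infinity>i\<in>{n - 1..Suc n}. F n i)"
  proof -
    have "(\<lambda>(n, i). norm (F n i)) summable_on S"
    proof (rule nonneg_bdd_above_summable_on)
      let ?A = "\<Sum>\<^sub>\<infinity>k\<in>int_lattice. norm (tcoeff (\<lambda>x. of_real (h x)) k)"
        and ?B = "\<Sum>\<^sub>\<infinity>k\<in>int_lattice. norm (tcoeff (\<lambda>x. of_real (g x)) k)"
      show "bdd_above (sum (\<lambda>(n, i). norm (F n i)) ` {T. T \<subseteq> S \<and> finite T})"
      proof (rule bdd_aboveI2)
        fix T assume "T \<in> {T. T \<subseteq> S \<and> finite T}"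
        then have T: "finite T" by simp
        have "(\<Sum>(n, i)\<in>T. norm (F n i)) \<le> (\<Sum>(n, i)\<in>fst ` T \<times> snd ` T. norm (F n i))"
          using T by (intro sum_mono2) (auto simp: image_iff, force+)
        also have "\<dots> = (\<Sum>n\<in>fst ` T. \<Sum>i\<in>snd ` T. norm (F n i))"
          by (rule sum.cartesian_product[symmetric])
        also have "\<dots> \<le> (\<Sum>n\<in>fst ` T. \<Sum>i\<in>snd ` T. block_max i h * block_max n g)"
          unfolding F_def real_norm_def abs_mult
          by (intro sum_mono mult_mono abs_block_le h g block_max_nonneg) auto
        also have "\<dots> = (\<Sum>i\<in>snd ` T. block_max i h) * (\<Sum>n\<in>fst ` T. block_max n g)"
          by (subst sum.swap) (simp add: sum_product)
        also have "\<dots> \<le> ?A * ?B"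
          using T by (intro mult_mono sum_block_max_le h g sum_nonneg block_max_nonneg infsum_nonneg) auto
        finally show "(\<Sum>(n, i)\<in>T. norm (F n i)) \<le> ?A * ?B" .
      qed
    qed auto
    moreover have "(\<lambda>(n, i). norm (F n i)) = (\<lambda>p. norm (case p of (n, i) \<Rightarrow> F n i))"
      by (auto simp: fun_eq_iff)
    ultimately have "(\<lambda>p. norm (case p of (n, i) \<Rightarrow> F n i)) summable_on S" by (simp only:)
    then have "(\<lambda>(n, i). F n i) summable_on S" by (rule abs_summable_summable)
    then show ?thesis unfolding S_def by (rule infsum_Sigma'_banach[symmetric])
  qed
  also have "\<dots> = (\<Sum>\<^sub>\<infinity>n\<in>UNIV. near_part n h x * block n (distr_of g) x)"
    by (simp add: F_def near_part_def sum_distrib_right del: sum.cl_ivl_Suc)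
  also have "\<dots> = (\<Sum>n. near_part n h x * block n (distr_of g) x)"
    unfolding near_part_def
    by (intro infsum_nat_eq_suminf summable_times_block[OF g abs_sum_block_le[OF h]]) simp
  finally show ?thesis .
qed

text \<open>Integral and series are exchanged thanks to the summable bound
  \<open>B * (A * block_max n g)\<close>, which is uniform in x; the measure is finite.\<close>

lemma torus_inner_suminf_block:
  assumes f: "f \<in> test_functions" and g: "g \<in> test_functions"
    and P: "\<And>n. continuous_on UNIV (P n)" "\<And>n x. \<bar>P n x\<bar> \<le> A"
  shows "(\<lambda>n. LINT x|torus_measure. f x * (P n x * block n (distr_of g) x)) sums
    (LINT x|torus_measure. f x * (\<Sum>n. P n x * block n (distr_of g) x))"
proof -
  obtain B where B: "B \<ge> 0" "\<And>x. \<bar>f x\<bar> \<le> B" by (rule test_functions_bounded[OF f]) blast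
  have A: "A \<ge> 0" using P(2)[of 0 0] by linarith
  define F where "F n x = f x * (P n x * block n (distr_of g) x)" for n x
  have cont: "continuous_on UNIV (F n)" for n
    unfolding F_def by (intro continuous_intros P continuous_on_block g test_functions_continuous f)
  have le: "norm (F n x) \<le> B * (A * block_max n g)" for n x
    unfolding F_def real_norm_def abs_mult
    by (intro mult_mono B P abs_block_le g mult_nonneg_nonneg abs_ge_zero A)
  have sm: "summable (\<lambda>n. B * (A * block_max n g))"
    by (intro summable_mult summable_block_max g)
  have "(\<lambda>n. LINT x|torus_measure. F n x) sums (LINT x|torus_measure. (\<Sum>n. F n x))"
  proof (rule sums_integral)
    show "integrable torus_measure (F n)" for n
      by (rule integrable_torus_measure[OF cont])
    show "AE x in torus_measure. summable (\<lambda>n. norm (F n x))"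
      by (intro AE_I2 summable_comparison_test'[OF sm]) (use le in simp)
    show "summable (\<lambda>n. LINT x|torus_measure. norm (F n x))"
    proof (rule summable_comparison_test'[OF sm])
      fix n
      have "(LINT x|torus_measure. norm (F n x)) \<le> (LINT x|(torus_measure :: (real ^ 'n) measure). B * (A * block_max n g))"
        by (intro integral_mono integrable_norm integrable_torus_measure cont le continuous_on_const)
      then show "norm (LINT x|torus_measure. norm (F n x)) \<le> B * (A * block_max n g)" by simp
    qed
  qed
  moreover have "(\<Sum>n. F n x) = f x * (\<Sum>n. P n x * block n (distr_of g) x)" for x
    unfolding F_def
    by (rule suminf_mult[OF summable_norm_cancel[OF summable_times_block[OF g P(2)]]])
  ultimately show ?thesis by (simp add: F_def)
qed

lemma defect_sums:
  assumes f: "f \<in> test_functions" and g: "g \<in> test_functions" and h: "h \<in> test_functions"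
  shows "(\<lambda>n. defect n f g h) sums (torus_inner f (resonant chi \<rho> h g) - torus_inner (paraproduct chi \<rho> f g) h)"
proof -
  have "(\<lambda>n. LINT x|torus_measure. f x * (near_part n h x * block n (distr_of g) x)) sums torus_inner f (resonant chi \<rho> h g)"
    unfolding torus_inner_eq resonant_eq[OF h g]
    by (rule torus_inner_suminf_block[OF f g continuous_on_parts(1)[OF h]])
      (unfold near_part_def, rule abs_sum_block_le[OF h], simp)
  moreover have "(\<lambda>n. LINT x|torus_measure. h x * (low_part n f x * block n (distr_of g) x)) sums torus_inner (paraproduct chi \<rho> f g) h"
    unfolding torus_inner_eq paraproduct_eq[OF f g] mult.commute[of "suminf _"]
    by (rule torus_inner_suminf_block[OF h g continuous_on_parts(2)[OF f]])
      (unfold low_part_def, rule abs_sum_block_le[OF f], simp)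
  ultimately show ?thesis
    unfolding defect_def by (rule sums_diff)
qed

end

lemma littlewood_paley_exists:
  assumes "dyadic_partition chi \<rho>"
  obtains r R where "littlewood_paley chi \<rho> r R"
proof -
  note p = assms[unfolded dyadic_partition_def]
  have "\<exists>R. \<forall>x. chi x \<noteq> 0 \<longrightarrow> norm x \<le> R"
    using p by (elim conjE)
  then obtain R1 where R1: "\<And>x. chi x \<noteq> 0 \<Longrightarrow> norm x \<le> R1" by blast
  have "\<exists>r R. 0 < r \<and> r < R \<and> (\<forall>x. \<rho> x \<noteq> 0 \<longrightarrow> r \<le> norm x \<and> norm x \<le> R)"
    using p by (elim conjE)
  then obtain r R2 where R2: "0 < r" "\<And>x. \<rho> x \<noteq> 0 \<Longrightarrow> r \<le> norm x \<and> norm x \<le> R2" by blast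
  have "littlewood_paley chi \<rho> r (max R1 R2)"
    by unfold_locales (use assms R1 R2 in \<open>auto simp: le_max_iff_disj\<close>)
  then show ?thesis by (rule that)
qed

theorem lemmaA6:
  fixes chi \<rho> :: "real ^ 'n::finite \<Rightarrow> real" and \<alpha> \<beta> \<gamma> :: real
  assumes "CARD('n) \<in> {2, 3}"
    and "dyadic_partition chi \<rho>"
    and "\<alpha> + \<beta> < 0"
    and "\<alpha> + \<beta> + \<gamma> \<ge> 0"
  shows "\<exists>(D :: 'n distr \<Rightarrow> 'n distr \<Rightarrow> 'n distr \<Rightarrow> real) (C :: real).
    (\<forall>f\<in>sobolev_space \<alpha>. \<forall>g\<in>besov_space chi \<rho> \<beta>. \<forall>h\<in>sobolev_space \<gamma>.
       \<bar>D f g h\<bar> \<le> C * besov_norm chi \<rho> \<beta> g * sobolev_norm \<alpha> f * sobolev_norm \<gamma> h) \<and>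
    (\<forall>f\<in>test_functions. \<forall>g\<in>test_functions. \<forall>h\<in>test_functions.
       D (distr_of f) (distr_of g) (distr_of h) =
         torus_inner f (resonant chi \<rho> h g) - torus_inner (paraproduct chi \<rho> f g) h)"
proof -
  obtain r R where "littlewood_paley chi \<rho> r R"
    by (rule littlewood_paley_exists[OF assms(2)])
  then interpret littlewood_paley chi \<rho> r R .
  define T where "T f g h = torus_inner f (resonant chi \<rho> h g) - torus_inner (paraproduct chi \<rho> f g) h" for f g h
  define inv where "inv = inv_into (test_functions :: (real ^ 'n \<Rightarrow> real) set) distr_of"
  have inv_eq: "inv (distr_of f) = f" if "f \<in> test_functions" for f :: "real ^ 'n \<Rightarrow> real"
    unfolding inv_def using distr_of_inj that by (rule inv_into_f_f)
  define D where "D u v w = (if u \<in> distr_of ` test_functions \<and> v \<in> distr_of ` test_functions \<and> w \<in> distr_of ` test_functions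
    then T (inv u) (inv v) (inv w) else 0)" for u v w :: "'n distr"
  obtain C where C: "C \<ge> 0" and bound: "\<And>f g h N. \<lbrakk>f \<in> test_functions; g \<in> test_functions; h \<in> test_functions;
      distr_of f \<in> sobolev_space \<alpha>; distr_of g \<in> besov_space chi \<rho> \<beta>; distr_of h \<in> sobolev_space \<gamma>\<rbrakk> \<Longrightarrow>
    (\<Sum>n<N. \<bar>defect n f g h\<bar>) \<le> C * besov_norm chi \<rho> \<beta> (distr_of g) * sobolev_norm \<alpha> (distr_of f) * sobolev_norm \<gamma> (distr_of h)"
    apply (rule sum_defect_le[OF assms(4)])
    subgoal premises p for C
      by (rule p(1)[OF p(2,3)])
    done
  have "\<bar>D u v w\<bar> \<le> C * besov_norm chi \<rho> \<beta> v * sobolev_norm \<alpha> u * sobolev_norm \<gamma> w"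
    if uvw: "u \<in> sobolev_space \<alpha>" "v \<in> besov_space chi \<rho> \<beta>" "w \<in> sobolev_space \<gamma>" for u v w
  proof (cases "u \<in> distr_of ` test_functions \<and> v \<in> distr_of ` test_functions \<and> w \<in> distr_of ` test_functions")
    case True
    then obtain f g h where fgh: "f \<in> test_functions" "g \<in> test_functions" "h \<in> test_functions"
      and eq: "u = distr_of f" "v = distr_of g" "w = distr_of h" by blast
    have D: "D u v w = T f g h" using fgh by (simp add: D_def eq inv_eq)
    \<comment> \<open>The bound is known for partial sums over scales, uniformly in
      \<open>N\<close>, and passes to the limit.\<close>
    have "(\<lambda>N. \<bar>\<Sum>n<N. defect n f g h\<bar>) \<longlonglongrightarrow> \<bar>T f g h\<bar>"
      using defect_sums[OF fgh] unfolding T_def sums_def by (rule tendsto_rabs)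
    moreover have "\<bar>\<Sum>n<N. defect n f g h\<bar> \<le> C * besov_norm chi \<rho> \<beta> v * sobolev_norm \<alpha> u * sobolev_norm \<gamma> w" for N
      unfolding eq by (rule order_trans[OF sum_abs bound]) (use fgh uvw in \<open>simp_all add: eq\<close>)
    ultimately show ?thesis unfolding D by (intro LIMSEQ_le_const2) auto
  next
    case False
    have "0 \<le> C * besov_norm chi \<rho> \<beta> v * sobolev_norm \<alpha> u * sobolev_norm \<gamma> w"
      using C besov_norm_nonneg[OF uvw(2)]
      by (auto intro!: mult_nonneg_nonneg infsum_nonneg simp: sobolev_norm_def sobolev_weight_def)
    then show ?thesis using False by (simp only: D_def if_False abs_zero)
  qed
  moreover have "D (distr_of f) (distr_of g) (distr_of h) =
         torus_inner f (resonant chi \<rho> h g) - torus_inner (paraproduct chi \<rho> f g) h"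
    if "f \<in> test_functions" "g \<in> test_functions" "h \<in> test_functions" for f g h
    using that by (simp add: D_def T_def inv_eq)
  ultimately show ?thesis by (intro exI[of _ D] exI[of _ C]) blast
qed

end
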